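(* Let $0<\gamma\le 1$, $\alpha\in\mathbb{R}$, and fix an admissible scale-dependent selection rule $\mathsf s$ on a domain $\mathcal D^{\mathsf s}_\gamma(\Delta_T^3;B_\alpha)$. Let $p\in[1,\infty)$. If $0<\gamma<1$ and $H\in L^p(\Omega;\mathcal D^{\mathsf s}_\gamma(\Delta_T^3;B_\alpha))$, then $R^{\mathsf s}:=\hat\Lambda^{\mathsf s}_{S,\gamma,\alpha}H$ satisfies $$\mathbb E\bigl[\|R^{\mathsf s}\|_{\gamma,\alpha}^p\bigr]\le C^p\,\mathbb E\bigl[\|H\|_{\gamma,\alpha}^p\bigr]$$ and $\hat\delta R^{\mathsf s}=H$ almost surely. For a family of individual random defects not lying in one fixed linear domain (each realization being admissible with constant $C_H(\omega)$ and satisfying the residual continuity criterion), the same estimate holds with the right-hand side replaced by $C^p\,\mathbb E\bigl[(\|H\|_{\gamma,\alpha}+C_H(\omega))^p\bigr]$. If $\gamma=1$ and $H\in L^p(\Omega;\mathcal D^{\mathsf s}_1(\Delta_T^3;B_\alpha))$, then $R^{\mathsf s}:=\hat\Lambda^{\mathsf s}_{S,1,\alpha}H$ satisfies $$\mathbb E\bigl[\|R^{\mathsf s}\|_{1,\log;\alpha}^p\bigr]\le C^p\,\mathbb E\bigl[\|H\|_{1,\alpha}^p\bigr]$$ and $\hat\delta R^{\mathsf s}=H$ almost surely. Again, for individual defects one may replace $\|H\|_{1,\alpha}$ by $\|H\|_{1,\alpha}+C_H(\omega)$.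
   Context: Fix $T>0$ and a probability space $(\Omega,\mathcal F,\mathbb P)$ with expectation $\mathbb E$. $(B_\alpha)_{\alpha\in\mathbb{R}}$ is a Banach scale, i.e. a family of Banach spaces such that for $\alpha\le\beta$ the embedding $B_\beta\hookrightarrow B_\alpha$ is continuous. $S=(S_t)_{t\ge0}$ is an analytic (in particular strongly continuous) semigroup of bounded linear operators acting on this scale, with $S_0=\mathrm{Id}$; for every $\alpha\in\mathbb{R}$, $\varepsilon\in(0,1)$ there is $C_{\alpha,\varepsilon,T}>0$ with $\|S_tx\|_{B_{\alpha+\varepsilon}}\le C_{\alpha,\varepsilon,T}t^{-\varepsilon}\|x\|_{B_\alpha}$ and $\|(S_t-\mathrm{Id})x\|_{B_\alpha}\le C_{\alpha,\varepsilon,T}t^{\varepsilon}\|x\|_{B_{\alpha+\varepsilon}}$ for all $t\in(0,T]$. $\Delta_T^n:=\{(t_1,\dots,t_n)\in[0,T]^n:0\le t_n\le\dots\le t_1\le T\}$; $C(\Delta_T^n;B_\alpha)$ denotes continuous maps; $(\hat\delta g)_{t_1\dots t_{n+1}}:=\sum_{i=1}^{n+1}(-1)^ig_{t_1\dots\hat t_i\dots t_{n+1}}-(S_{t_1-t_2}-\mathrm{Id})g_{t_2\dots t_{n+1}}$. For $g\in C(\Delta_T^2;B_\alpha)$: $\|g\|_{\gamma,\alpha}:=\sup_{s<t}\|g_{ts}\|_{B_\alpha}/|t-s|^\gamma$, $\|g\|_{1,\log;\alpha}:=\sup_{s<t}\frac{\|g_{ts}\|_{B_\alpha}}{|t-s|(1+|\log|t-s||)}$;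 $C^\gamma(\Delta_T^2;B_\alpha)$, $C^1_{\log}(\Delta_T^2;B_\alpha)$ are the sets of finite norm. For $h\in C(\Delta_T^3;B_\alpha)$: $\|h\|_{\gamma,\alpha}:=\inf\{\sum_{j=1}^m\sup_{s<u<t}\frac{\|h_{j,tus}\|_{B_\alpha}}{|t-u|^{\rho_j}|u-s|^{\gamma-\rho_j}}:h=\sum_{j=1}^mh_j,\ m\in\mathbb{N},\ 0<\rho_j<\gamma\}$; $Z\hat C^\gamma(\Delta_T^3;B_\alpha)$ is the set of $h$ with $\hat\delta h=0$ and finite norm. A random semigroup defect of regularity $\gamma$ is a measurable map $H:\Omega\to Z\hat C^\gamma(\Delta_T^3;B_\alpha)$; $H\in L^p(\Omega;\mathcal V)$, for a subspace $\mathcal V\subset Z\hat C^\gamma(\Delta_T^3;B_\alpha)$, means $H$ takes values in $\mathcal V$ and $\mathbb E[\|H\|_{\gamma,\alpha}^p]<\infty$. Dyadic recursion. Let $\mathcal D:=\bigcup_{n\ge0}\{kT2^{-n}:0\le k\le2^n\}$; a dyadic interval is an interval between consecutive points of some $\{kT2^{-n}:0\le k\le 2^n\}$. For $H\in Z\hat C^\gamma(\Delta_T^3;B_\alpha)$ let $B^H_{ts}:=-H_{ts0}$. A splitting rule $\mathsf s$ assigns to each dyadic interval $[a,c]$ with midpoint $b$ carrying a residual $Q_{ca}\in B_\alpha$ generated by the recursion two child residuals $Q^{\mathsf s}_{cb},Q^{\mathsf s}_{ba}\in B_\alpha$ with $(\ast)$ $Q_{ca}=Q^{\mathsf s}_{cb}+S_{c-b}Q^{\mathsf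 s}_{ba}+H_{cba}$. The recursion builds $I^{\mathsf s}(H):\mathcal D\to B_\alpha$ and $R^{\mathsf s}_{ts}(H):=B^H_{ts}-I^{\mathsf s}_t(H)+S_{t-s}I^{\mathsf s}_s(H)$: $I^{\mathsf s}_0:=0$, $I^{\mathsf s}_T:=B^H_{T0}$; given endpoint values on $[a,c]$, put $Q_{ca}:=R^{\mathsf s}_{ca}$, apply $\mathsf s$, and set $I^{\mathsf s}_b:=B^H_{ba}+S_{b-a}I^{\mathsf s}_a-Q^{\mathsf s}_{ba}$. Admissibility for $H$ with constant $C_H$ (with $L=c-a$, for all generated residuals): if $0<\gamma<1$, $\max\{\|Q^{\mathsf s}_{cb}\|_{B_\alpha},\|Q^{\mathsf s}_{ba}\|_{B_\alpha}\}\le\theta\|Q_{ca}\|_{B_\alpha}+C_HL^\gamma$ for some $0\le\theta<2^{-\gamma}$; if $\gamma=1$, $\max\{\|Q^{\mathsf s}_{cb}\|_{B_\alpha},\|Q^{\mathsf s}_{ba}\|_{B_\alpha}\}\le(\tfrac12+C_\ast L^\eta)\|Q_{ca}\|_{B_\alpha}+C_HL$ for some $C_\ast,\eta>0$. Residual continuity criterion: $\lim_{h\downarrow0}\sup\{\|(S_h-\mathrm{Id})R^{\mathsf s}_{ts}\|_{B_\alpha}:s\le t,\ s,t\in\mathcal D,\ t+h\le T\}=0$. An admissible selection domain for a fixed linear rule $\mathsf s$ (one for which the generated residuals depend linearly on $H$) is a linear subspace $\mathcal D^{\mathsf s}_\gamma(\Delta_T^3;B_\alpha)\subset Z\hat C^\gamma(\Delta_T^3;B_\alpha)$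 such that for every $H$ in it the recursion is well defined, $(\ast)$ holds at each step, the admissibility estimate holds with fixed $\theta$ (resp. fixed $C_\ast,\eta$) and $C_H\le C_{\mathsf s}\|H\|_{\gamma,\alpha}$, and the residual continuity criterion holds. The Sewing map $\hat\Lambda^{\mathsf s}_{S,\gamma,\alpha}:\mathcal D^{\mathsf s}_\gamma(\Delta_T^3;B_\alpha)\to C^\gamma(\Delta_T^2;B_\alpha)$ (into $C^1_{\log}(\Delta_T^2;B_\alpha)$ if $\gamma=1$) sends $H$ to the unique continuous extension to $\Delta_T^2$ of $R^{\mathsf s}(H)$. For random $H$ it is applied pathwise. $C$ is a deterministic constant independent of $H$ and $p$; in the individual-defect case the remaining admissibility constants ($\theta$, resp. $C_\ast,\eta$) are fixed, i.e. do not depend on $\omega$. *)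

theory Defs
  imports "HOL-Probability.Probability"
begin

section \<open>Banach scales and analytic semigroups\<close>

text \<open>
  A Banach space is a linear subspace \<open>X\<close> of an ambient real vector space together with a
  functional \<open>N\<close> that is a complete norm on \<open>X\<close>; values of \<open>N\<close> off \<open>X\<close> are irrelevant.
  For a scale the ambient space plays the role of the union of the \<open>B \<alpha>\<close>, so that the embeddings
  are inclusions.
\<close>

text \<open>
  The library's metric spaces need a distance that is nonnegative and symmetric on the whole type,
  hence the guard.
\<close>

definition ndist :: "'a::real_vector set \<Rightarrow> ('a \<Rightarrow> real) \<Rightarrow> 'a \<Rightarrow> 'a \<Rightarrow> real" where
  "ndist X N x y = (if x \<in> X \<and> y \<in> X then N (x - y) else 0)"

abbreviation ntop :: "'a::real_vector set \<Rightarrow> ('a \<Rightarrow> real) \<Rightarrow> 'a topology" where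
  "ntop X N \<equiv> Metric_space.mtopology X (ndist X N)"

locale banach_on =
  fixes X :: "'a::real_vector set" and N :: "'a \<Rightarrow> real"
  assumes subspace: "subspace X"
    and nonneg: "x \<in> X \<Longrightarrow> 0 \<le> N x"
    and definite: "x \<in> X \<Longrightarrow> N x = 0 \<longleftrightarrow> x = 0"
    and triangle: "x \<in> X \<Longrightarrow> y \<in> X \<Longrightarrow> N (x + y) \<le> N x + N y"
    and homogeneous: "x \<in> X \<Longrightarrow> N (c *\<^sub>R x) = \<bar>c\<bar> * N x"
    and complete: "Metric_space.mcomplete X (ndist X N)"
begin

lemma Metric_space: "Metric_space X (ndist X N)"
proof
  fix x y z
  show "0 \<le> ndist X N x y"
    by (simp add: ndist_def nonneg subspace subspace_diff)
  show "ndist X N x y = ndist X N y x"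
    using homogeneous[of "x - y" "-1"] by (auto simp: ndist_def subspace subspace_diff)
  assume "x \<in> X" "y \<in> X"
  then show "ndist X N x y = 0 \<longleftrightarrow> x = y"
    using definite[of "x - y"] by (auto simp: ndist_def subspace subspace_diff)
  assume "z \<in> X"
  then show "ndist X N x z \<le> ndist X N x y + ndist X N y z"
    using triangle[of "x - y" "y - z"] \<open>x \<in> X\<close> \<open>y \<in> X\<close>
    by (auto simp: ndist_def subspace subspace_diff)
qed

end

locale banach_scale =
  fixes B :: "real \<Rightarrow> 'a::real_vector set" and nrm :: "real \<Rightarrow> 'a \<Rightarrow> real"
  assumes banach: "banach_on (B \<alpha>) (nrm \<alpha>)"
    and incl: "\<alpha> \<le> \<beta> \<Longrightarrow> B \<beta> \<subseteq> B \<alpha>"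
    and incl_continuous: "\<alpha> \<le> \<beta> \<Longrightarrow> \<exists>C. \<forall>x\<in>B \<beta>. nrm \<alpha> x \<le> C * nrm \<beta> x"

text \<open>
  Analyticity of a semigroup is existence of a holomorphic semigroup extension to a sector. As the
  spaces are real, the extension acts on the complexification \<open>X \<times> X\<close>, the pair \<open>(x, y)\<close> standing
  for \<open>x + \<i> y\<close>. The sum norm induces the topology of the complexification.
\<close>

definition cscale :: "complex \<Rightarrow> 'a::real_vector \<times> 'a \<Rightarrow> 'a \<times> 'a" where
  "cscale c v = (Re c *\<^sub>R fst v - Im c *\<^sub>R snd v, Im c *\<^sub>R fst v + Re c *\<^sub>R snd v)"

definition cnorm :: "('a \<Rightarrow> real) \<Rightarrow> 'a \<times> 'a \<Rightarrow> real" where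
  "cnorm N v = N (fst v) + N (snd v)"

definition sector :: "real \<Rightarrow> complex set" where
  "sector \<phi> = {z. z \<noteq> 0 \<and> \<bar>Arg z\<bar> < \<phi>}"

definition analytic_semigroup_on ::
  "'a::real_vector set \<Rightarrow> ('a \<Rightarrow> real) \<Rightarrow> (real \<Rightarrow> 'a \<Rightarrow> 'a) \<Rightarrow> bool" where
  "analytic_semigroup_on X N S \<longleftrightarrow>
    (\<exists>\<phi> E. 0 < \<phi> \<and> \<phi> \<le> pi / 2 \<and>
      (\<forall>z\<in>sector \<phi>.
        (\<forall>v\<in>X \<times> X. E z v \<in> X \<times> X) \<and>
        (\<forall>v\<in>X \<times> X. \<forall>w\<in>X \<times> X. E z (v + w) = E z v + E z w) \<and>
        (\<forall>c. \<forall>v\<in>X \<times> X. E z (cscale c v) = cscale c (E z v)) \<and>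
        (\<exists>K. \<forall>v\<in>X \<times> X. cnorm N (E z v) \<le> K * cnorm N v)) \<and>
      (\<forall>z\<in>sector \<phi>. \<forall>w\<in>sector \<phi>. \<forall>v\<in>X \<times> X. E (z + w) v = E z (E w v)) \<and>
      (\<forall>t>0. \<forall>x\<in>X. E (of_real t) (x, 0) = (S t x, 0)) \<and>
      (\<forall>v\<in>X \<times> X. ((\<lambda>z. cnorm N (E z v - v)) \<longlongrightarrow> 0) (at 0 within sector \<phi>)) \<and>
      (\<forall>v\<in>X \<times> X. \<forall>z\<in>sector \<phi>. \<exists>d\<in>X \<times> X.
        ((\<lambda>h. cnorm N (E (z + h) v - E z v - cscale h d) / cmod h) \<longlongrightarrow> 0) (at 0)))"

locale scale_semigroup = banach_scale B nrm
  for B :: "real \<Rightarrow> 'a::real_vector set" and nrm :: "real \<Rightarrow> 'a \<Rightarrow> real" +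
  fixes S :: "real \<Rightarrow> 'a \<Rightarrow> 'a" and T :: real
  assumes maps: "0 \<le> t \<Longrightarrow> x \<in> B \<alpha> \<Longrightarrow> S t x \<in> B \<alpha>"
    and add: "0 \<le> t \<Longrightarrow> x \<in> B \<alpha> \<Longrightarrow> y \<in> B \<alpha> \<Longrightarrow> S t (x + y) = S t x + S t y"
    and scale: "0 \<le> t \<Longrightarrow> x \<in> B \<alpha> \<Longrightarrow> S t (c *\<^sub>R x) = c *\<^sub>R S t x"
    and bounded: "0 \<le> t \<Longrightarrow> \<exists>C. \<forall>x\<in>B \<alpha>. nrm \<alpha> (S t x) \<le> C * nrm \<alpha> x"
    and zero: "x \<in> B \<alpha> \<Longrightarrow> S 0 x = x"
    and semigroup: "0 \<le> r \<Longrightarrow> 0 \<le> t \<Longrightarrow> x \<in> B \<alpha> \<Longrightarrow> S (r + t) x = S r (S t x)"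
    and strongly_continuous:
      "x \<in> B \<alpha> \<Longrightarrow> continuous_map (top_of_set {0..}) (ntop (B \<alpha>) (nrm \<alpha>)) (\<lambda>t. S t x)"
    and analytic: "analytic_semigroup_on (B \<alpha>) (nrm \<alpha>) S"
    and smoothing: "0 < \<epsilon> \<Longrightarrow> \<epsilon> < 1 \<Longrightarrow> \<exists>C>0. \<forall>t. 0 < t \<and> t \<le> T \<longrightarrow>
      (\<forall>x\<in>B \<alpha>. S t x \<in> B (\<alpha> + \<epsilon>) \<and> nrm (\<alpha> + \<epsilon>) (S t x) \<le> C * t powr (-\<epsilon>) * nrm \<alpha> x) \<and>
      (\<forall>x\<in>B (\<alpha> + \<epsilon>). nrm \<alpha> (S t x - x) \<le> C * t powr \<epsilon> * nrm (\<alpha> + \<epsilon>) x)"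


section \<open>Increments and their norms\<close>

definition simp2 :: "real \<Rightarrow> (real \<times> real) set" where
  "simp2 T = {(t, s). 0 \<le> s \<and> s \<le> t \<and> t \<le> T}"

definition simp3 :: "real \<Rightarrow> (real \<times> real \<times> real) set" where
  "simp3 T = {(t, u, s). 0 \<le> s \<and> s \<le> u \<and> u \<le> t \<and> t \<le> T}"

definition simp4 :: "real \<Rightarrow> (real \<times> real \<times> real \<times> real) set" where
  "simp4 T = {(t, u, v, s). 0 \<le> s \<and> s \<le> v \<and> v \<le> u \<and> u \<le> t \<and> t \<le> T}"

text \<open>
  A map on a simplex \<open>D\<close> is represented by the total function that extends it by zero. Hence
  distinct functions below are distinct maps on the simplex.
\<close>

definition cont_maps ::
  "'b::topological_space set \<Rightarrow> 'a::real_vector set \<Rightarrow> ('a \<Rightarrow> real) \<Rightarrow> ('b \<Rightarrow> 'a) set" where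
  "cont_maps D X N =
    {g. continuous_map (top_of_set D) (ntop X N) g \<and> (\<forall>x. x \<notin> D \<longrightarrow> g x = 0)}"

definition delta2 ::
  "(real \<Rightarrow> 'a \<Rightarrow> 'a) \<Rightarrow> (real \<times> real \<Rightarrow> 'a::real_vector) \<Rightarrow> real \<times> real \<times> real \<Rightarrow> 'a" where
  "delta2 S g = (\<lambda>(t, u, s).
     - g (u, s) + g (t, s) - g (t, u) - (S (t - u) (g (u, s)) - g (u, s)))"

definition delta3 ::
  "(real \<Rightarrow> 'a \<Rightarrow> 'a) \<Rightarrow> (real \<times> real \<times> real \<Rightarrow> 'a::real_vector) \<Rightarrow>
    real \<times> real \<times> real \<times> real \<Rightarrow> 'a" where
  "delta3 S h = (\<lambda>(t, u, v, s).
     - h (u, v, s) + h (t, v, s) - h (t, u, s) + h (t, u, v)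
     - (S (t - u) (h (u, v, s)) - h (u, v, s)))"

definition hnorm2 :: "real \<Rightarrow> ('a \<Rightarrow> real) \<Rightarrow> real \<Rightarrow> (real \<times> real \<Rightarrow> 'a) \<Rightarrow> ennreal" where
  "hnorm2 T N \<gamma> g =
    (SUP (t, s)\<in>{(t, s). 0 \<le> s \<and> s < t \<and> t \<le> T}. ennreal (N (g (t, s)) / \<bar>t - s\<bar> powr \<gamma>))"

definition lognorm2 :: "real \<Rightarrow> ('a \<Rightarrow> real) \<Rightarrow> (real \<times> real \<Rightarrow> 'a) \<Rightarrow> ennreal" where
  "lognorm2 T N g =
    (SUP (t, s)\<in>{(t, s). 0 \<le> s \<and> s < t \<and> t \<le> T}.
       ennreal (N (g (t, s)) / (\<bar>t - s\<bar> * (1 + \<bar>ln \<bar>t - s\<bar>\<bar>))))"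

definition hnorm3_term ::
  "real \<Rightarrow> ('a \<Rightarrow> real) \<Rightarrow> real \<Rightarrow> real \<Rightarrow> (real \<times> real \<times> real \<Rightarrow> 'a) \<Rightarrow> ennreal" where
  "hnorm3_term T N \<gamma> \<rho> h =
    (SUP (t, u, s)\<in>{(t, u, s). 0 \<le> s \<and> s < u \<and> u < t \<and> t \<le> T}.
       ennreal (N (h (t, u, s)) / (\<bar>t - u\<bar> powr \<rho> * \<bar>u - s\<bar> powr (\<gamma> - \<rho>))))"

text \<open>
  The summands of a decomposition are taken in the same space of continuous maps as \<open>h\<close> itself.
\<close>

definition hnorm3 ::
  "real \<Rightarrow> 'a::real_vector set \<Rightarrow> ('a \<Rightarrow> real) \<Rightarrow> real \<Rightarrow> (real \<times> real \<times> real \<Rightarrow> 'a) \<Rightarrow> ennreal"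
  where
  "hnorm3 T X N \<gamma> h =
    Inf {\<Sum>j<m. hnorm3_term T N \<gamma> (\<rho> j) (k j) | (m::nat) \<rho> k.
           (\<forall>j<m. 0 < \<rho> j \<and> \<rho> j < \<gamma> \<and> k j \<in> cont_maps (simp3 T) X N) \<and>
           (\<forall>x\<in>simp3 T. h x = (\<Sum>j<m. k j x))}"

definition C_holder ::
  "real \<Rightarrow> 'a::real_vector set \<Rightarrow> ('a \<Rightarrow> real) \<Rightarrow> real \<Rightarrow> (real \<times> real \<Rightarrow> 'a) set" where
  "C_holder T X N \<gamma> = {g \<in> cont_maps (simp2 T) X N. hnorm2 T N \<gamma> g < \<top>}"

definition C_log ::
  "real \<Rightarrow> 'a::real_vector set \<Rightarrow> ('a \<Rightarrow> real) \<Rightarrow> (real \<times> real \<Rightarrow> 'a) set" where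
  "C_log T X N = {g \<in> cont_maps (simp2 T) X N. lognorm2 T N g < \<top>}"

definition ZC ::
  "real \<Rightarrow> 'a::real_vector set \<Rightarrow> ('a \<Rightarrow> real) \<Rightarrow> (real \<Rightarrow> 'a \<Rightarrow> 'a) \<Rightarrow> real \<Rightarrow>
    (real \<times> real \<times> real \<Rightarrow> 'a) set" where
  "ZC T X N S \<gamma> = {h \<in> cont_maps (simp3 T) X N.
     (\<forall>x\<in>simp4 T. delta3 S h x = 0) \<and> hnorm3 T X N \<gamma> h < \<top>}"


section \<open>Dyadic recursion\<close>

text \<open>
  A rule maps a defect \<open>H\<close>, the endpoints \<open>c\<close>, \<open>a\<close> of a dyadic interval and the residual
  \<open>Q\<^sub>c\<^sub>a\<close> it carries to the pair \<open>(Q\<^sub>c\<^sub>b, Q\<^sub>b\<^sub>a)\<close> of child residuals.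
\<close>

type_synonym 'a rule = "(real \<times> real \<times> real \<Rightarrow> 'a) \<Rightarrow> real \<Rightarrow> real \<Rightarrow> 'a \<Rightarrow> 'a \<times> 'a"

definition dpt :: "real \<Rightarrow> nat \<Rightarrow> nat \<Rightarrow> real" where
  "dpt T n k = real k * T / 2 ^ n"

definition dyadics :: "real \<Rightarrow> real set" where
  "dyadics T = {dpt T n k | n k. k \<le> 2 ^ n}"

definition germ :: "(real \<times> real \<times> real \<Rightarrow> 'a::real_vector) \<Rightarrow> real \<Rightarrow> real \<Rightarrow> 'a" where
  "germ H t s = - H (t, s, 0)"

text \<open>
  \<open>lvl_I T S r H n k\<close> is the value at \<open>dpt T n k\<close> once all intervals of levels below \<open>n\<close> have
  been split; the odd points of level \<open>Suc n\<close> are the midpoints of level \<open>n\<close>.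
\<close>

primrec lvl_I ::
  "real \<Rightarrow> (real \<Rightarrow> 'a \<Rightarrow> 'a) \<Rightarrow> 'a rule \<Rightarrow> (real \<times> real \<times> real \<Rightarrow> 'a::real_vector) \<Rightarrow>
    nat \<Rightarrow> nat \<Rightarrow> 'a" where
  "lvl_I T S r H 0 = (\<lambda>k. if k = 0 then 0 else germ H T 0)"
| "lvl_I T S r H (Suc n) = (\<lambda>j.
     let k = j div 2; a = dpt T n k; c = dpt T n (Suc k); b = dpt T (Suc n) j;
         Q = germ H c a - lvl_I T S r H n (Suc k) + S (c - a) (lvl_I T S r H n k)
     in if even j then lvl_I T S r H n k
        else germ H b a + S (b - a) (lvl_I T S r H n k) - snd (r H c a Q))"

definition dy_I ::
  "real \<Rightarrow> (real \<Rightarrow> 'a \<Rightarrow> 'a) \<Rightarrow> 'a rule \<Rightarrow> (real \<times> real \<times> real \<Rightarrow> 'a::real_vector) \<Rightarrow>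
    real \<Rightarrow> 'a" where
  "dy_I T S r H t = (THE v. \<exists>n k. k \<le> 2 ^ n \<and> t = dpt T n k \<and> v = lvl_I T S r H n k)"

lemma dpt_double: "dpt T (m + n) (2 ^ m * k) = dpt T n k"
  by (simp add: dpt_def power_add)

lemma lvl_I_double: "lvl_I T S r H (m + n) (2 ^ m * k) = lvl_I T S r H n k"
  by (induction m) (simp_all add: Let_def mult.assoc)

lemma lvl_I_unique:
  assumes "T > 0" "dpt T n k = dpt T m j"
  shows "lvl_I T S r H n k = lvl_I T S r H m j"
proof -
  have "real k * 2 ^ m = real j * 2 ^ n"
    using assms by (simp add: dpt_def field_simps)
  then have "k * 2 ^ m = j * 2 ^ n"
    by (metis of_nat_eq_iff of_nat_mult of_nat_numeral of_nat_power)
  then show ?thesis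
    by (metis add.commute lvl_I_double mult.commute)
qed

lemma dy_I_dpt:
  assumes "T > 0" "k \<le> 2 ^ n"
  shows "dy_I T S r H (dpt T n k) = lvl_I T S r H n k"
  unfolding dy_I_def using assms by (blast intro: the_equality lvl_I_unique[symmetric])

definition dy_R ::
  "real \<Rightarrow> (real \<Rightarrow> 'a \<Rightarrow> 'a) \<Rightarrow> 'a rule \<Rightarrow> (real \<times> real \<times> real \<Rightarrow> 'a::real_vector) \<Rightarrow>
    real \<Rightarrow> real \<Rightarrow> 'a" where
  "dy_R T S r H t s = germ H t s - dy_I T S r H t + S (t - s) (dy_I T S r H s)"

text \<open>The residual carried by the \<open>k\<close>-th dyadic interval of level \<open>n\<close>, and its two children.\<close>

definition gen_res ::
  "real \<Rightarrow> (real \<Rightarrow> 'a \<Rightarrow> 'a) \<Rightarrow> 'a rule \<Rightarrow> (real \<times> real \<times> real \<Rightarrow> 'a::real_vector) \<Rightarrow>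
    nat \<Rightarrow> nat \<Rightarrow> 'a" where
  "gen_res T S r H n k = dy_R T S r H (dpt T n (Suc k)) (dpt T n k)"

definition gen_children ::
  "real \<Rightarrow> (real \<Rightarrow> 'a \<Rightarrow> 'a) \<Rightarrow> 'a rule \<Rightarrow> (real \<times> real \<times> real \<Rightarrow> 'a::real_vector) \<Rightarrow>
    nat \<Rightarrow> nat \<Rightarrow> 'a \<times> 'a" where
  "gen_children T S r H n k = r H (dpt T n (Suc k)) (dpt T n k) (gen_res T S r H n k)"

definition recursion_ok ::
  "real \<Rightarrow> 'a::real_vector set \<Rightarrow> (real \<Rightarrow> 'a \<Rightarrow> 'a) \<Rightarrow> 'a rule \<Rightarrow>
    (real \<times> real \<times> real \<Rightarrow> 'a) \<Rightarrow> bool" where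
  "recursion_ok T X S r H \<longleftrightarrow>
    (\<forall>n k. k < 2 ^ n \<longrightarrow>
      (let a = dpt T n k; c = dpt T n (Suc k); b = (a + c) / 2;
           Qcb = fst (gen_children T S r H n k); Qba = snd (gen_children T S r H n k)
       in Qcb \<in> X \<and> Qba \<in> X \<and>
          gen_res T S r H n k = Qcb + S (c - b) Qba + H (c, b, a)))"

text \<open>
  The factor \<open>\<kappa> L\<close> multiplying the parent residual in the admissibility estimate carries the
  constants other than \<open>C\<^sub>H\<close>.
\<close>

definition admissible_factor :: "real \<Rightarrow> (real \<Rightarrow> real) \<Rightarrow> bool" where
  "admissible_factor \<gamma> \<kappa> \<longleftrightarrow>
    (\<gamma> < 1 \<and> (\<exists>\<theta>. 0 \<le> \<theta> \<and> \<theta> < 2 powr (-\<gamma>) \<and> \<kappa> = (\<lambda>L. \<theta>))) \<or>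
    (\<gamma> = 1 \<and> (\<exists>K \<eta>. 0 < K \<and> 0 < \<eta> \<and> \<kappa> = (\<lambda>L. 1 / 2 + K * L powr \<eta>)))"

definition admissible ::
  "real \<Rightarrow> ('a::real_vector \<Rightarrow> real) \<Rightarrow> (real \<Rightarrow> 'a \<Rightarrow> 'a) \<Rightarrow> 'a rule \<Rightarrow> real \<Rightarrow>
    (real \<Rightarrow> real) \<Rightarrow> (real \<times> real \<times> real \<Rightarrow> 'a) \<Rightarrow> real \<Rightarrow> bool" where
  "admissible T N S r \<gamma> \<kappa> H CH \<longleftrightarrow>
    (\<forall>n k. k < 2 ^ n \<longrightarrow>
      (let L = dpt T n (Suc k) - dpt T n k
       in max (N (fst (gen_children T S r H n k))) (N (snd (gen_children T S r H n k)))
            \<le> \<kappa> L * N (gen_res T S r H n k) + CH * L powr \<gamma>))"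

definition residual_continuity ::
  "real \<Rightarrow> ('a::real_vector \<Rightarrow> real) \<Rightarrow> (real \<Rightarrow> 'a \<Rightarrow> 'a) \<Rightarrow> 'a rule \<Rightarrow>
    (real \<times> real \<times> real \<Rightarrow> 'a) \<Rightarrow> bool" where
  "residual_continuity T N S r H \<longleftrightarrow>
    ((\<lambda>h. SUP (t, s)\<in>{(t, s). s \<in> dyadics T \<and> t \<in> dyadics T \<and> s \<le> t \<and> t + h \<le> T}.
            ennreal (N (S h (dy_R T S r H t s) - dy_R T S r H t s))) \<longlongrightarrow> 0) (at_right 0)"

definition selection_domain ::
  "real \<Rightarrow> 'a::real_vector set \<Rightarrow> ('a \<Rightarrow> real) \<Rightarrow> (real \<Rightarrow> 'a \<Rightarrow> 'a) \<Rightarrow> 'a rule \<Rightarrow> real \<Rightarrow>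
    (real \<times> real \<times> real \<Rightarrow> 'a) set \<Rightarrow> bool" where
  "selection_domain T X N S r \<gamma> D \<longleftrightarrow>
    D \<subseteq> ZC T X N S \<gamma> \<and> (\<lambda>x. 0) \<in> D \<and>
    (\<forall>H\<in>D. \<forall>H'\<in>D. (\<lambda>x. H x + H' x) \<in> D) \<and>
    (\<forall>c. \<forall>H\<in>D. (\<lambda>x. c *\<^sub>R H x) \<in> D) \<and>
    (\<forall>n k. k < 2 ^ n \<longrightarrow>
      (\<forall>H\<in>D. \<forall>H'\<in>D.
        gen_res T S r (\<lambda>x. H x + H' x) n k = gen_res T S r H n k + gen_res T S r H' n k) \<and>
      (\<forall>c. \<forall>H\<in>D. gen_res T S r (\<lambda>x. c *\<^sub>R H x) n k = c *\<^sub>R gen_res T S r H n k)) \<and>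
    (\<exists>\<kappa> Cs. admissible_factor \<gamma> \<kappa> \<and> 0 \<le> Cs \<and>
      (\<forall>H\<in>D. recursion_ok T X S r H \<and> residual_continuity T N S r H \<and>
        (\<exists>CH. 0 \<le> CH \<and> ennreal CH \<le> ennreal Cs * hnorm3 T X N \<gamma> H \<and>
              admissible T N S r \<gamma> \<kappa> H CH)))"

definition is_sewing ::
  "real \<Rightarrow> 'a::real_vector set \<Rightarrow> ('a \<Rightarrow> real) \<Rightarrow> (real \<Rightarrow> 'a \<Rightarrow> 'a) \<Rightarrow> 'a rule \<Rightarrow>
    (real \<times> real \<times> real \<Rightarrow> 'a) \<Rightarrow> (real \<times> real \<Rightarrow> 'a) \<Rightarrow> bool" where
  "is_sewing T X N S r H R \<longleftrightarrow> R \<in> cont_maps (simp2 T) X N \<and>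
    (\<forall>t\<in>dyadics T. \<forall>s\<in>dyadics T. s \<le> t \<longrightarrow> R (t, s) = dy_R T S r H t s)"

text \<open>
  Informative only where \<open>is_sewing\<close> has a unique solution; uniqueness is automatic, existence
  is not.
\<close>

definition sewing ::
  "real \<Rightarrow> 'a::real_vector set \<Rightarrow> ('a \<Rightarrow> real) \<Rightarrow> (real \<Rightarrow> 'a \<Rightarrow> 'a) \<Rightarrow> 'a rule \<Rightarrow>
    (real \<times> real \<times> real \<Rightarrow> 'a) \<Rightarrow> real \<times> real \<Rightarrow> 'a" where
  "sewing T X N S r H = (THE R. is_sewing T X N S r H R)"


section \<open>Random defects\<close>

definition ZC_borel ::
  "real \<Rightarrow> 'a::real_vector set \<Rightarrow> ('a \<Rightarrow> real) \<Rightarrow> (real \<Rightarrow> 'a \<Rightarrow> 'a) \<Rightarrow> real \<Rightarrow>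
    (real \<times> real \<times> real \<Rightarrow> 'a) measure" where
  "ZC_borel T X N S \<gamma> = sigma (ZC T X N S \<gamma>)
    {U. openin (Metric_space.mtopology (ZC T X N S \<gamma>)
          (\<lambda>h h'. enn2real (hnorm3 T X N \<gamma> (\<lambda>x. h x - h' x)))) U}"

definition epowr :: "ennreal \<Rightarrow> real \<Rightarrow> ennreal" where
  "epowr x p = (if x = \<top> then \<top> else ennreal (enn2real x powr p))"

definition Lp_defect ::
  "'w measure \<Rightarrow> real \<Rightarrow> 'a::real_vector set \<Rightarrow> ('a \<Rightarrow> real) \<Rightarrow> (real \<Rightarrow> 'a \<Rightarrow> 'a) \<Rightarrow> real \<Rightarrow>
    real \<Rightarrow> (real \<times> real \<times> real \<Rightarrow> 'a) set \<Rightarrow> ('w \<Rightarrow> real \<times> real \<times> real \<Rightarrow> 'a) \<Rightarrow> bool" where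
  "Lp_defect M T X N S \<gamma> p V H \<longleftrightarrow>
    H \<in> M \<rightarrow>\<^sub>M ZC_borel T X N S \<gamma> \<and> (\<forall>\<omega>\<in>space M. H \<omega> \<in> V) \<and>
    (\<integral>\<^sup>+\<omega>. epowr (hnorm3 T X N \<gamma> (H \<omega>)) p \<partial>M) < \<top>"

text \<open>
  A random defect whose realizations are individually admissible, with a random constant \<open>CH\<close>
  but a factor \<open>\<kappa>\<close> that does not depend on the realization.
\<close>

definition individual_defect ::
  "'w measure \<Rightarrow> real \<Rightarrow> 'a::real_vector set \<Rightarrow> ('a \<Rightarrow> real) \<Rightarrow> (real \<Rightarrow> 'a \<Rightarrow> 'a) \<Rightarrow> 'a rule \<Rightarrow>
    real \<Rightarrow> (real \<Rightarrow> real) \<Rightarrow> ('w \<Rightarrow> real \<times> real \<times> real \<Rightarrow> 'a) \<Rightarrow> ('w \<Rightarrow> real) \<Rightarrow> bool" where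
  "individual_defect M T X N S r \<gamma> \<kappa> H CH \<longleftrightarrow>
    H \<in> M \<rightarrow>\<^sub>M ZC_borel T X N S \<gamma> \<and> CH \<in> borel_measurable M \<and>
    (\<forall>\<omega>\<in>space M. 0 \<le> CH \<omega> \<and> recursion_ok T X S r (H \<omega>) \<and>
      admissible T N S r \<gamma> \<kappa> (H \<omega>) (CH \<omega>) \<and> residual_continuity T N S r (H \<omega>))"

end

theory Submission
  imports Defs "HOL-Real_Asymp.Real_Asymp"
begin

text \<open>
  Everything happens along one path. For a fixed defect \<open>H\<close> the residual
  \<open>R t s = B t s - I t + S (t - s) (I s)\<close> satisfies \<open>\<delta>R = H\<close> on the dyadic points for purely algebraic
  reasons: \<open>I\<close> enters through a coboundary, and \<open>\<delta>H = 0\<close> says that the germ \<open>B t s = - H (t, s, 0)\<close>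
  has coboundary \<open>H\<close> (\<open>R_cocycle\<close>). Consequently the two child residuals chosen by the splitting rule
  are the residuals of the two halves, and the admissibility estimate becomes a scalar recursion
  from one dyadic level to the next. It starts from zero, because \<open>I\<close> is normalised to make the
  residual of \<open>[0, T]\<close> vanish. Its solution is of order \<open>L powr \<gamma>\<close> on intervals of length \<open>L\<close> if
  \<open>\<gamma> < 1\<close>; at \<open>\<gamma> = 1\<close> halving the length and halving the residual balance exactly, every level
  contributes the same amount, and a factor \<open>\<bar>ln L\<bar>\<close> appears (\<open>level_profile\<close>, \<open>gen_res_bound\<close>).

  To pass from grid intervals to arbitrary dyadic \<open>s < t\<close>, one picks the level whose mesh is
  comparable to \<open>t - s\<close> and approaches both end points through finer and finer grids, using
  \<open>R t s = R t u + S (t - u) (R u s) + H (t, u, s)\<close>. The contributions of the levels are dominated by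
  the coarsest one (\<open>chain\<close>, \<open>dyadic_residual_bound\<close>). This needs a bound on the operators \<open>S t\<close> that
  is uniform for \<open>t\<close> in \<open>[0, T]\<close>, which the Banach--Steinhaus theorem extracts from strong continuity.

  The same relation shows that \<open>R\<close> is uniformly continuous on the dyadic simplex: moving the
  lower end point is controlled by the bound just obtained, moving the upper one produces
  \<open>(S h - id) (R t s)\<close>, which is small by the residual continuity criterion. Completeness then
  yields the continuous extension, and the bound and the equation \<open>\<delta>R = H\<close> pass to the limit
  (\<open>pathwise_sewing\<close>).

  The resulting constant does not depend on the defect, so raising to the power \<open>p\<close> and integrating
  gives the moment estimates. Measurability of the norm of the sewing uses linearity: on a
  selection domain the bound applied to a difference of two defects says that this norm is
  Lipschitz in the defect (\<open>measurable_Lipschitz\<close>).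
\<close>

section \<open>Banach spaces carried by a set\<close>

context banach_on
begin

lemma zero_mem [simp]: "0 \<in> X"
  using subspace by (rule subspace_0)

lemma add_mem: "x \<in> X \<Longrightarrow> y \<in> X \<Longrightarrow> x + y \<in> X"
  using subspace by (rule subspace_add)

lemma diff_mem: "x \<in> X \<Longrightarrow> y \<in> X \<Longrightarrow> x - y \<in> X"
  using subspace by (rule subspace_diff)

lemma uminus_mem: "x \<in> X \<Longrightarrow> - x \<in> X"
  using subspace by (rule subspace_neg)

lemma scale_mem: "x \<in> X \<Longrightarrow> c *\<^sub>R x \<in> X"
  using subspace by (rule subspace_scale)

lemma N_zero [simp]: "N 0 = 0"
  using definite[of 0] by simp

lemma N_minus: "x \<in> X \<Longrightarrow> N (- x) = N x"
  using homogeneous[of x "-1"] by simp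

lemma N_diff_commute: "x \<in> X \<Longrightarrow> y \<in> X \<Longrightarrow> N (x - y) = N (y - x)"
  using N_minus[of "x - y"] diff_mem by simp

lemma triangle_diff: "x \<in> X \<Longrightarrow> y \<in> X \<Longrightarrow> N (x - y) \<le> N x + N y"
  using triangle[of x "- y"] by (simp add: N_minus uminus_mem)

lemma triangle_via: "x \<in> X \<Longrightarrow> y \<in> X \<Longrightarrow> z \<in> X \<Longrightarrow> N (x - z) \<le> N (x - y) + N (y - z)"
  using triangle[of "x - y" "y - z"] by (simp add: diff_mem)

lemma triangle3: "x \<in> X \<Longrightarrow> y \<in> X \<Longrightarrow> z \<in> X \<Longrightarrow> N (x + y + z) \<le> N x + N y + N z"
  using triangle[of "x + y" z] triangle[of x y] by (simp add: add_mem)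

lemma reverse_triangle: "x \<in> X \<Longrightarrow> y \<in> X \<Longrightarrow> \<bar>N x - N y\<bar> \<le> N (x - y)"
  using triangle[of "x - y" y] triangle[of "y - x" x]
  by (simp add: diff_mem N_diff_commute[of x y])

lemma sum_mem: "(\<And>i. i \<in> I \<Longrightarrow> f i \<in> X) \<Longrightarrow> sum f I \<in> X"
  using subspace by (rule subspace_sum)

lemma triangle_sum: "(\<And>i. i \<in> I \<Longrightarrow> f i \<in> X) \<Longrightarrow> N (sum f I) \<le> (\<Sum>i\<in>I. N (f i))"
proof (induction I rule: infinite_finite_induct)
  case (insert i I)
  then have "N (f i + sum f I) \<le> N (f i) + N (sum f I)"
    by (intro triangle sum_mem) auto
  with insert show ?case by auto
qed auto

text \<open>
  Norm convergence of sequences inside the carrier. Sequences suffice because the limits below are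
  taken along dyadic approximations.
\<close>

definition tends :: "(nat \<Rightarrow> 'a) \<Rightarrow> 'a \<Rightarrow> bool" where
  "tends f l \<longleftrightarrow> (\<forall>n. f n \<in> X) \<and> l \<in> X \<and> (\<lambda>n. N (f n - l)) \<longlonglongrightarrow> 0"

lemma tends_eventually:
  assumes "\<And>n. f n \<in> X" "l \<in> X" "eventually (\<lambda>n. f n = l) sequentially"
  shows "tends f l"
  unfolding tends_def using assms
  by (auto intro!: tendsto_eventually elim!: eventually_mono)

lemma tends_null:
  assumes "\<And>n. f n \<in> X" "l \<in> X" "\<And>n. N (f n - l) \<le> g n" "g \<longlonglongrightarrow> 0"
  shows "tends f l"
proof -
  have "(\<lambda>n. N (f n - l)) \<longlonglongrightarrow> 0"
    by (rule tendsto_sandwich[OF _ _ tendsto_const assms(4)])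
      (simp_all add: assms nonneg diff_mem)
  with assms show ?thesis
    by (simp add: tends_def)
qed

lemma tends_add:
  assumes "tends f l" "tends g m"
  shows "tends (\<lambda>n. f n + g n) (l + m)"
proof (rule tends_null)
  show "N (f n + g n - (l + m)) \<le> N (f n - l) + N (g n - m)" for n
    using assms triangle[of "f n - l" "g n - m"]
    by (simp add: tends_def diff_mem algebra_simps)
  show "(\<lambda>n. N (f n - l) + N (g n - m)) \<longlonglongrightarrow> 0"
    using assms tendsto_add[of _ "0::real" sequentially _ 0] by (simp add: tends_def)
qed (use assms in \<open>auto simp: tends_def add_mem\<close>)

lemma tends_uminus:
  assumes "tends f l"
  shows "tends (\<lambda>n. - f n) (- l)"
proof (rule tends_null)
  show "N (- f n - - l) \<le> N (f n - l)" for n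
    using assms by (simp add: tends_def N_diff_commute)
qed (use assms in \<open>auto simp: tends_def uminus_mem\<close>)

lemma tends_diff:
  assumes "tends f l" "tends g m"
  shows "tends (\<lambda>n. f n - g n) (l - m)"
  using tends_add[OF assms(1) tends_uminus[OF assms(2)]] by simp

lemma tends_norm:
  assumes "tends f l"
  shows "(\<lambda>n. N (f n)) \<longlonglongrightarrow> N l"
proof (rule LIM_zero_cancel, rule Lim_null_comparison)
  show "\<forall>\<^sub>F n in sequentially. norm (N (f n) - N l) \<le> N (f n - l)"
    unfolding real_norm_def
    by (rule always_eventually) (use assms in \<open>blast intro: reverse_triangle dest: tends_def[THEN iffD1]\<close>)
  show "(\<lambda>n. N (f n - l)) \<longlonglongrightarrow> 0"
    using assms unfolding tends_def by (elim conjE)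
qed

lemma tends_unique:
  assumes "tends f l" "tends f m"
  shows "l = m"
proof -
  have "(\<lambda>n. N (f n - f n)) \<longlonglongrightarrow> N (l - m)"
    using tends_norm[OF tends_diff[OF assms]] .
  then have "N (l - m) = 0"
    by (simp add: LIMSEQ_const_iff)
  then show ?thesis
    using assms definite[of "l - m"] by (simp add: tends_def diff_mem)
qed

lemma Cauchy_tends:
  assumes "\<And>n. f n \<in> X"
    and "\<And>e. e > 0 \<Longrightarrow> \<exists>n0. \<forall>n\<ge>n0. \<forall>m\<ge>n0. N (f n - f m) < e"
  shows "\<exists>l. tends f l"
proof -
  interpret Metric_space X "ndist X N"
    by (rule Metric_space)
  have "MCauchy f"
    using assms unfolding MCauchy_def by (auto simp: ndist_def)
  then obtain l where "limitin mtopology f l sequentially"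
    using complete unfolding mcomplete_def by blast
  then have "l \<in> X" "(\<lambda>n. ndist X N (f n) l) \<longlonglongrightarrow> 0"
    unfolding limitin_metric_dist_null by auto
  then show ?thesis
    using assms(1) by (auto simp: tends_def ndist_def)
qed

lemma continuous_map_ntop:
  fixes g :: "'b::metric_space \<Rightarrow> 'a"
  shows "continuous_map (top_of_set D) (ntop X N) g \<longleftrightarrow>
    (\<forall>x\<in>D. g x \<in> X) \<and> (\<forall>x\<in>D. \<forall>e>0. \<exists>d>0. \<forall>y\<in>D. dist y x < d \<longrightarrow> N (g y - g x) < e)"
    (is "?L \<longleftrightarrow> ?R")
proof -
  interpret Metric_space X "ndist X N"
    by (rule Metric_space)
  show ?thesis
  proof
    assume L: ?L
    then have mem: "g x \<in> X" if "x \<in> D" for x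
      using that by (auto simp: continuous_map_def)
    moreover have "\<exists>d>0. \<forall>y\<in>D. dist y x < d \<longrightarrow> N (g y - g x) < e" if "x \<in> D" "e > 0" for x e
    proof -
      have "\<exists>U. openin (top_of_set D) U \<and> x \<in> U \<and> (\<forall>y\<in>U. g y \<in> mball (g x) e)"
        using L that unfolding continuous_map_to_metric topspace_euclidean_subtopology by blast
      then obtain U
        where U: "openin (top_of_set D) U" "x \<in> U" "\<forall>y\<in>U. g y \<in> mball (g x) e"
        by blast
      then obtain d where "d > 0" "\<forall>y\<in>D. dist y x < d \<longrightarrow> y \<in> U"
        unfolding openin_euclidean_subtopology_iff by blast
      moreover have "N (g y - g x) < e" if "y \<in> D" "y \<in> U" for y
        using U(3) N_diff_commute[of "g x" "g y"] mem[OF \<open>x \<in> D\<close>] mem[OF \<open>y \<in> D\<close>] that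
        by (auto simp: ndist_def)
      ultimately show ?thesis by blast
    qed
    ultimately show ?R by blast
  next
    assume R: ?R
    have "\<exists>U. openin (top_of_set D) U \<and> x \<in> U \<and> (\<forall>y\<in>U. g y \<in> mball (g x) e)"
      if xe: "x \<in> D" "e > 0" for x e
    proof -
      obtain d where "d > 0" "\<forall>y\<in>D. dist y x < d \<longrightarrow> N (g y - g x) < e"
        using R xe by blast
      then show ?thesis
        using R xe
        by (intro exI[of _ "D \<inter> ball x d"])
          (auto simp: ndist_def N_diff_commute dist_commute)
    qed
    then show ?L
      unfolding continuous_map_to_metric by simp
  qed
qed

lemma continuous_map_tends:
  fixes g :: "'b::metric_space \<Rightarrow> 'a"
  assumes "continuous_map (top_of_set D) (ntop X N) g"
    and "\<And>n. \<xi> n \<in> D" "x \<in> D" "\<xi> \<longlonglongrightarrow> x"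
  shows "tends (\<lambda>n. g (\<xi> n)) (g x)"
proof -
  have "\<exists>n0. \<forall>n\<ge>n0. N (g (\<xi> n) - g x) < e" if "e > 0" for e
  proof -
    obtain d where "d > 0" "\<forall>y\<in>D. dist y x < d \<longrightarrow> N (g y - g x) < e"
      using assms(1,3) \<open>e > 0\<close> unfolding continuous_map_ntop by blast
    moreover obtain n0 where "\<forall>n\<ge>n0. dist (\<xi> n) x < d"
      using assms(4) \<open>d > 0\<close> unfolding lim_sequentially by blast
    ultimately show ?thesis
      using assms(2) by blast
  qed
  then have "(\<lambda>n. N (g (\<xi> n) - g x)) \<longlonglongrightarrow> 0"
    using assms unfolding lim_sequentially continuous_map_ntop
    by (simp add: nonneg diff_mem)
  then show ?thesis
    using assms unfolding tends_def continuous_map_ntop by blast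
qed

lemma continuous_on_norm:
  fixes g :: "'b::metric_space \<Rightarrow> 'a"
  assumes "continuous_map (top_of_set D) (ntop X N) g"
  shows "continuous_on D (\<lambda>x. N (g x))"
  unfolding continuous_on_sequentially comp_def
  using assms by (auto intro!: tends_norm continuous_map_tends)

lemma cont_maps_mem: "g \<in> cont_maps D X N \<Longrightarrow> g x \<in> X"
  for g :: "'b::metric_space \<Rightarrow> 'a"
  unfolding cont_maps_def continuous_map_ntop by (cases "x \<in> D") auto

lemma cont_maps_uminus:
  fixes g :: "'b::metric_space \<Rightarrow> 'a"
  assumes "g \<in> cont_maps D X N"
  shows "(\<lambda>x. - g x) \<in> cont_maps D X N"
proof -
  have "N (- g y - - g x) = N (g y - g x)" for x y
    using N_diff_commute[of "g x" "g y"] assms by (simp add: cont_maps_mem)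
  then show ?thesis
    using assms unfolding cont_maps_def continuous_map_ntop
    by (simp only: mem_Collect_eq) (auto simp: uminus_mem)
qed

text \<open>
  Banach--Steinhaus. The closed sets on which the family is bounded by \<open>n\<close> cover the space, so by
  Baire's theorem one of them contains a ball; translating that ball to the origin bounds all
  operators at once.
\<close>

theorem uniform_boundedness:
  assumes maps: "\<And>i x. i \<in> I \<Longrightarrow> x \<in> X \<Longrightarrow> L i x \<in> X"
    and add: "\<And>i x y. i \<in> I \<Longrightarrow> x \<in> X \<Longrightarrow> y \<in> X \<Longrightarrow> L i (x + y) = L i x + L i y"
    and scale: "\<And>i x c. i \<in> I \<Longrightarrow> x \<in> X \<Longrightarrow> L i (c *\<^sub>R x) = c *\<^sub>R L i x"
    and bounded: "\<And>i. i \<in> I \<Longrightarrow> \<exists>C. \<forall>x\<in>X. N (L i x) \<le> C * N x"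
    and pointwise: "\<And>x. x \<in> X \<Longrightarrow> \<exists>C. \<forall>i\<in>I. N (L i x) \<le> C"
  shows "\<exists>C\<ge>1. \<forall>i\<in>I. \<forall>x\<in>X. N (L i x) \<le> C * N x"
proof -
  interpret Metric_space X "ndist X N"
    by (rule Metric_space)
  define F where "F n = {x\<in>X. \<forall>i\<in>I. N (L i x) \<le> real n}" for n :: nat
  have diff: "L i (x - y) = L i x - L i y" if "i \<in> I" "x \<in> X" "y \<in> X" for i x y
    using add[of i x "-y"] scale[of i y "-1"] that by (simp add: uminus_mem)
  have closed: "closedin mtopology (F n)" for n
    unfolding closedin_metric
  proof (intro conjI allI impI)
    show "F n \<subseteq> X" by (auto simp: F_def)
    fix x assume "x \<in> X - F n"
    then obtain i where i: "i \<in> I" "x \<in> X" "real n < N (L i x)"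
      by (auto simp: F_def not_le)
    obtain C where C: "\<forall>x\<in>X. N (L i x) \<le> C * N x"
      using bounded i by blast
    define e where "e = (N (L i x) - real n) / (\<bar>C\<bar> + 1)"
    have "e > 0"
      using i by (simp add: e_def)
    moreover have "disjnt (F n) (mball x e)"
    proof -
      have False if "y \<in> F n" "y \<in> mball x e" for y
      proof -
        have y: "y \<in> X" "N (x - y) < e" "N (L i y) \<le> real n"
          using that i by (auto simp: F_def ndist_def)
        have "N (L i x) \<le> N (L i y) + N (L i x - L i y)"
          using reverse_triangle[of "L i x" "L i y"] i y maps by auto
        also have "N (L i x - L i y) \<le> C * N (x - y)"
          using C diff[of i x y] i y diff_mem by metis
        also have "\<dots> \<le> (\<bar>C\<bar> + 1) * N (x - y)"
          using banach_on.nonneg[OF banach_on_axioms diff_mem[OF i(2) y(1)]]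
          by (intro mult_right_mono) auto
        also have "\<dots> < (\<bar>C\<bar> + 1) * e"
          using y by (intro mult_strict_left_mono) auto
        also have "\<dots> = N (L i x) - real n"
          by (simp add: e_def)
        finally show False using y by simp
      qed
      then show ?thesis by (meson disjnt_iff)
    qed
    ultimately show "\<exists>e>0. disjnt (F n) (mball x e)" by blast
  qed
  have "(\<Union>n. F n) = X"
  proof -
    have "x \<in> (\<Union>n. F n)" if "x \<in> X" for x
    proof -
      obtain C where "\<forall>i\<in>I. N (L i x) \<le> C"
        using pointwise \<open>x \<in> X\<close> by blast
      moreover obtain n where "C \<le> real n"
        using real_arch_simple by blast
      ultimately have "x \<in> F n"
        using \<open>x \<in> X\<close> by (auto simp: F_def intro: order_trans)
      then show ?thesis by blast
    qed
    then show ?thesis by (auto simp: F_def)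
  qed
  then have "mtopology interior_of (\<Union>(range F)) \<noteq> {}"
    using interior_of_topspace[of mtopology] zero_mem by (metis empty_iff topspace_mtopology)
  then obtain n where "mtopology interior_of (F n) \<noteq> {}"
    using metric_Baire_category_alt[of "range F"] complete closed by auto
  then obtain x0 where "x0 \<in> mtopology interior_of (F n)"
    by auto
  moreover have "openin mtopology (mtopology interior_of (F n))"
    by simp
  ultimately obtain e where "e > 0" "mball x0 e \<subseteq> mtopology interior_of (F n)"
    unfolding openin_mtopology by blast
  with \<open>x0 \<in> mtopology interior_of (F n)\<close> have x0: "x0 \<in> F n" "e > 0" "mball x0 e \<subseteq> F n"
    using interior_of_subset[of mtopology "F n"] by blast+
  have small: "N (L i y) \<le> 2 * real n" if "i \<in> I" "y \<in> X" "N y < e" for i y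
  proof -
    have "x0 + y \<in> F n"
      using x0 that by (intro subsetD[OF x0(3)]) (auto simp: F_def ndist_def N_minus add_mem)
    then have "N (L i (x0 + y)) \<le> real n" "N (L i x0) \<le> real n"
      using x0 that by (auto simp: F_def)
    moreover have "N (L i y) \<le> N (L i (x0 + y)) + N (L i x0)"
      using triangle_diff[of "L i (x0 + y)" "L i x0"] add[of i x0 y] that x0 maps[of i]
      by (auto simp: F_def add_mem)
    ultimately show ?thesis by simp
  qed
  define C where "C = 4 * real n / e + 1"
  have "N (L i x) \<le> C * N x" if "i \<in> I" "x \<in> X" for i x
  proof (cases "x = 0")
    case True
    then show ?thesis using diff[of i 0 0] that by simp
  next
    case False
    then have pos: "0 < N x"
      using definite banach_on.nonneg[OF banach_on_axioms] that by (metis order_le_less)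
    define c where "c = e / (2 * N x)"
    have c: "c > 0" using x0 pos by (simp add: c_def)
    have "c *\<^sub>R x \<in> X" "N (c *\<^sub>R x) < e"
      using that pos x0 c
      by (auto simp: homogeneous c_def scale_mem)
    then have "c * N (L i x) \<le> 2 * real n"
      using small[of i "c *\<^sub>R x"] scale[of i x c] that maps[of i x] c by (simp add: homogeneous)
    then have "N (L i x) \<le> 4 * real n / e * N x"
      using pos x0 by (simp add: c_def field_simps)
    also have "\<dots> \<le> C * N x"
      using pos by (intro mult_right_mono) (auto simp: C_def)
    finally show ?thesis .
  qed
  moreover have "C \<ge> 1" using x0 by (simp add: C_def)
  ultimately show ?thesis by blast
qed

end


section \<open>The norm of three-parameter increments\<close>

context banach_on
begin

text \<open>
  The supremum only sees the open simplex; continuity carries the bound over to the faces, where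
  it forces the increment to vanish because both exponents are positive.
\<close>

lemma hnorm3_term_bound:
  assumes "0 < T" and k: "k \<in> cont_maps (simp3 T) X N" and fin: "hnorm3_term T N \<gamma> \<rho> k < \<top>"
    and \<rho>: "0 < \<rho>" "\<rho> < \<gamma>" and tus: "(t, u, s) \<in> simp3 T"
  shows "N (k (t, u, s)) \<le>
    enn2real (hnorm3_term T N \<gamma> \<rho> k) * ((t - u) powr \<rho> * (u - s) powr (\<gamma> - \<rho>))"
proof -
  define A where "A = enn2real (hnorm3_term T N \<gamma> \<rho> k)"
  have interior: "N (k (t, u, s)) \<le> A * ((t - u) powr \<rho> * (u - s) powr (\<gamma> - \<rho>))"
    if "0 \<le> s" "s < u" "u < t" "t \<le> T" for t u s
  proof -
    define w where "w = (t - u) powr \<rho> * (u - s) powr (\<gamma> - \<rho>)"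
    have "w > 0" using that by (simp add: w_def)
    have "ennreal (N (k (t, u, s)) / (\<bar>t - u\<bar> powr \<rho> * \<bar>u - s\<bar> powr (\<gamma> - \<rho>)))
        \<le> hnorm3_term T N \<gamma> \<rho> k"
      unfolding hnorm3_term_def
      by (rule SUP_upper2[where i = "(t, u, s)"]) (use that in auto)
    also have "\<dots> = ennreal A"
      using fin by (simp add: A_def ennreal_enn2real)
    finally have "N (k (t, u, s)) / w \<le> A"
      using that by (subst (asm) ennreal_le_iff) (auto simp: A_def w_def)
    then show ?thesis
      using \<open>w > 0\<close> by (simp add: w_def[symmetric] pos_divide_le_eq)
  qed
  define l where "l n = 1 / real (Suc (Suc n))" for n
  have l: "0 < l n" "l n < 1" for n
    by (auto simp: l_def)
  have l0: "l \<longlonglongrightarrow> 0"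
    unfolding l_def using LIMSEQ_ignore_initial_segment[OF lim_1_over_n, of 2]
    by (simp add: numeral_2_eq_2)
  \<comment> \<open>Points of the open simplex on the segment from \<open>(T, T/2, 0)\<close> to the given point.\<close>
  define t' u' s' where "t' n = t + l n * (T - t)" and "u' n = u + l n * (T / 2 - u)"
    and "s' n = s - l n * s" for n
  have lims: "t' \<longlonglongrightarrow> t" "u' \<longlonglongrightarrow> u" "s' \<longlonglongrightarrow> s"
    unfolding t'_def u'_def s'_def using l0 by (auto intro!: tendsto_eq_intros)
  have ord: "0 \<le> s' n" "s' n < u' n" "u' n < t' n" "t' n \<le> T" for n
  proof -
    have 1: "t' n = (1 - l n) * t + l n * T" "u' n = (1 - l n) * u + l n * (T / 2)"
      "s' n = (1 - l n) * s"
      by (auto simp: t'_def u'_def s'_def algebra_simps)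
    have 2: "(1 - l n) * s \<le> (1 - l n) * u" "(1 - l n) * u \<le> (1 - l n) * t"
      "(1 - l n) * t \<le> (1 - l n) * T" "0 \<le> (1 - l n) * s" "0 < l n * T"
      using tus l[of n] \<open>0 < T\<close> by (auto simp: simp3_def intro!: mult_left_mono)
    have 3: "(1 - l n) * T + l n * T = T" by (simp add: algebra_simps)
    show "0 \<le> s' n" "s' n < u' n" "u' n < t' n" "t' n \<le> T"
      unfolding 1 using 2 3 by linarith+
  qed
  have "tends (\<lambda>n. k (t' n, u' n, s' n)) (k (t, u, s))"
    by (rule continuous_map_tends[where D = "simp3 T"])
      (use k ord tus lims in \<open>auto simp: cont_maps_def simp3_def less_imp_le intro!: tendsto_Pair\<close>)
  then have "(\<lambda>n. N (k (t' n, u' n, s' n))) \<longlonglongrightarrow> N (k (t, u, s))"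
    by (rule tends_norm)
  moreover have "(\<lambda>n. A * ((t' n - u' n) powr \<rho> * (u' n - s' n) powr (\<gamma> - \<rho>)))
      \<longlonglongrightarrow> A * ((t - u) powr \<rho> * (u - s) powr (\<gamma> - \<rho>))"
    using \<rho> ord
    by (intro tendsto_mult tendsto_const tendsto_powr' tendsto_diff lims)
      (auto intro!: always_eventually simp: less_imp_le)
  ultimately show ?thesis
    unfolding A_def[symmetric]
    by (rule LIMSEQ_le) (use interior ord in blast)
qed

lemma powr_split_le:
  fixes t u s \<rho> \<gamma> :: real
  assumes "s \<le> u" "u \<le> t" "0 \<le> \<rho>" "\<rho> \<le> \<gamma>"
  shows "(t - u) powr \<rho> * (u - s) powr (\<gamma> - \<rho>) \<le> (t - s) powr \<gamma>"
proof -
  have "(t - u) powr \<rho> * (u - s) powr (\<gamma> - \<rho>) \<le> (t - s) powr \<rho> * (t - s) powr (\<gamma> - \<rho>)"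
    using assms by (intro mult_mono powr_mono2) auto
  then show ?thesis
    by (simp flip: powr_add)
qed

definition hnorm3_decomp ::
  "real \<Rightarrow> real \<Rightarrow> (real \<times> real \<times> real \<Rightarrow> 'a) \<Rightarrow> nat \<Rightarrow> (nat \<Rightarrow> real) \<Rightarrow>
    (nat \<Rightarrow> real \<times> real \<times> real \<Rightarrow> 'a) \<Rightarrow> bool" where
  "hnorm3_decomp T \<gamma> h m \<rho> k \<longleftrightarrow>
    (\<forall>j<m. 0 < \<rho> j \<and> \<rho> j < \<gamma> \<and> k j \<in> cont_maps (simp3 T) X N) \<and>
    (\<forall>x\<in>simp3 T. h x = (\<Sum>j<m. k j x))"

lemma hnorm3_decompD:
  assumes "hnorm3_decomp T \<gamma> h m \<rho> k"
  shows "j < m \<Longrightarrow> 0 < \<rho> j" "j < m \<Longrightarrow> \<rho> j < \<gamma>"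
    "j < m \<Longrightarrow> k j \<in> cont_maps (simp3 T) X N"
    "x \<in> simp3 T \<Longrightarrow> h x = (\<Sum>j<m. k j x)"
  using assms by (auto simp: hnorm3_decomp_def)

lemma hnorm3_eq_Inf_decomp:
  "hnorm3 T X N \<gamma> h =
    Inf {\<Sum>j<m. hnorm3_term T N \<gamma> (\<rho> j) (k j) | m \<rho> k. hnorm3_decomp T \<gamma> h m \<rho> k}"
  unfolding hnorm3_def hnorm3_decomp_def ..

lemma hnorm3_lessE:
  assumes "hnorm3 T X N \<gamma> h < c"
  obtains m \<rho> k where "hnorm3_decomp T \<gamma> h m \<rho> k"
    "(\<Sum>j<m. hnorm3_term T N \<gamma> (\<rho> j) (k j)) < c"
  using assms unfolding hnorm3_eq_Inf_decomp Inf_less_iff by blast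

lemma hnorm3_le:
  assumes "hnorm3_decomp T \<gamma> h m \<rho> k"
  shows "hnorm3 T X N \<gamma> h \<le> (\<Sum>j<m. hnorm3_term T N \<gamma> (\<rho> j) (k j))"
  unfolding hnorm3_eq_Inf_decomp using assms by (intro Inf_lower) blast

lemma hnorm3_bound:
  assumes "0 < T" and fin: "hnorm3 T X N \<gamma> h < \<top>" and tus: "(t, u, s) \<in> simp3 T"
  shows "N (h (t, u, s)) \<le> enn2real (hnorm3 T X N \<gamma> h) * (t - s) powr \<gamma>"
proof -
  define w where "w = (t - s) powr \<gamma>"
  have *: "N (h (t, u, s)) \<le> (enn2real (hnorm3 T X N \<gamma> h) + e) * w" if "e > 0" for e
  proof -
    define c where "c = enn2real (hnorm3 T X N \<gamma> h) + e"
    have "c > 0" using that by (simp add: c_def add_nonneg_pos)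
    have "hnorm3 T X N \<gamma> h = ennreal (enn2real (hnorm3 T X N \<gamma> h))"
      using fin by (simp add: ennreal_enn2real)
    also have "\<dots> < ennreal c"
      using that by (intro ennreal_lessI) (auto simp: c_def add_nonneg_pos)
    finally obtain m \<rho> k where dec: "hnorm3_decomp T \<gamma> h m \<rho> k"
      and small: "(\<Sum>j<m. hnorm3_term T N \<gamma> (\<rho> j) (k j)) < ennreal c"
      by (rule hnorm3_lessE)
    note d = hnorm3_decompD[OF dec] small
    let ?A = "\<lambda>j. hnorm3_term T N \<gamma> (\<rho> j) (k j)"
    have A: "?A j < \<top>" if "j < m" for j
    proof -
      have "?A j \<le> (\<Sum>j<m. ?A j)"
        using that by (intro member_le_sum) auto
      also note d(5)
      also note ennreal_less_top
      finally show ?thesis .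
    qed
    have "(\<Sum>j<m. ?A j) = ennreal (\<Sum>j<m. enn2real (?A j))"
      using A by (subst sum_ennreal[symmetric]) (auto simp: ennreal_enn2real)
    then have sumA: "(\<Sum>j<m. enn2real (?A j)) \<le> c"
      using d(5) \<open>c > 0\<close> by (simp add: ennreal_less_iff sum_nonneg)
    have "N (h (t, u, s)) = N (\<Sum>j<m. k j (t, u, s))"
      using d(4) tus by simp
    also have "\<dots> \<le> (\<Sum>j<m. N (k j (t, u, s)))"
      by (rule triangle_sum) (auto intro: cont_maps_mem[OF d(3)])
    also have "\<dots> \<le> (\<Sum>j<m. enn2real (?A j) * w)"
    proof (intro sum_mono)
      fix j assume "j \<in> {..<m}"
      then have j: "j < m" by simp
      have "N (k j (t, u, s)) \<le>
          enn2real (?A j) * ((t - u) powr \<rho> j * (u - s) powr (\<gamma> - \<rho> j))"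
        by (intro hnorm3_term_bound assms d A j)
      also have "\<dots> \<le> enn2real (?A j) * w"
        unfolding w_def using tus d(1,2)[OF j]
        by (intro mult_left_mono powr_split_le) (auto simp: simp3_def)
      finally show "N (k j (t, u, s)) \<le> enn2real (?A j) * w" .
    qed
    also have "\<dots> \<le> c * w"
      using sumA by (simp add: sum_distrib_right[symmetric] w_def mult_right_mono)
    finally show ?thesis by (simp add: c_def)
  qed
  have "((\<lambda>e. (enn2real (hnorm3 T X N \<gamma> h) + e) * w) \<longlongrightarrow> (enn2real (hnorm3 T X N \<gamma> h) + 0) * w)
      (at_right 0)"
    by (intro tendsto_intros)
  then show ?thesis
    unfolding w_def[symmetric]
    by (rule tendsto_lowerbound[where F = "at_right 0", THEN order_trans])
      (use * in \<open>auto simp: eventually_at_right_less intro: eventually_mono[OF eventually_at_right_less]\<close>)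
qed

text \<open>
  Vanishing on the faces has to be read off from the summands: the combined bound by
  \<open>(t - s) powr \<gamma>\<close> no longer sees the position of \<open>u\<close>.
\<close>

lemma hnorm3_face:
  assumes "0 < T" and fin: "hnorm3 T X N \<gamma> h < \<top>" and tus: "(t, u, s) \<in> simp3 T"
    and face: "u = t \<or> u = s"
  shows "h (t, u, s) = 0"
proof -
  obtain m \<rho> k where dec: "hnorm3_decomp T \<gamma> h m \<rho> k"
    and small: "(\<Sum>j<m. hnorm3_term T N \<gamma> (\<rho> j) (k j)) < \<top>"
    using fin by (rule hnorm3_lessE)
  note d = hnorm3_decompD[OF dec] small
  have "k j (t, u, s) = 0" if j: "j < m" for j
  proof -
    have "hnorm3_term T N \<gamma> (\<rho> j) (k j) \<le> (\<Sum>j<m. hnorm3_term T N \<gamma> (\<rho> j) (k j))"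
      using that by (intro member_le_sum) auto
    then have "hnorm3_term T N \<gamma> (\<rho> j) (k j) < \<top>"
      using d(5) by (rule le_less_trans)
    from hnorm3_term_bound[OF \<open>0 < T\<close> d(3)[OF j] this d(1)[OF j] d(2)[OF j] tus]
    have "N (k j (t, u, s)) \<le> 0"
      using face d(1)[OF j] d(2)[OF j] by auto
    then show ?thesis
      using cont_maps_mem[OF d(3)[OF j]] nonneg definite by (metis order_antisym)
  qed
  then show ?thesis
    using d(4)[OF tus] by simp
qed

lemma hnorm3_zero: "hnorm3 T X N \<gamma> (\<lambda>x. 0) = 0"
  using hnorm3_le[of T \<gamma> "\<lambda>x. 0" 0] by (simp add: hnorm3_decomp_def)

lemma sum_append:
  fixes f g :: "nat \<Rightarrow> 'b::comm_monoid_add"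
  shows "(\<Sum>j<m + n. if j < m then f j else g (j - m)) = (\<Sum>j<m. f j) + (\<Sum>j<n. g j)"
  by (induction n) (simp_all add: add.assoc)

text \<open>
  Concatenating decompositions of the two increments decomposes their sum. The infima need not be
  attained, hence the slack \<open>e / 2\<close> on either side.
\<close>

lemma hnorm3_triangle:
  "hnorm3 T X N \<gamma> (\<lambda>x. h x + h' x) \<le> hnorm3 T X N \<gamma> h + hnorm3 T X N \<gamma> h'"
proof (rule ennreal_le_epsilon)
  fix e :: real
  assume fin: "hnorm3 T X N \<gamma> h + hnorm3 T X N \<gamma> h' < \<top>" and "0 < e"
  then have "hnorm3 T X N \<gamma> h < hnorm3 T X N \<gamma> h + ennreal (e / 2)"
    "hnorm3 T X N \<gamma> h' < hnorm3 T X N \<gamma> h' + ennreal (e / 2)"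
    by (auto intro!: ennreal_add_left_cancel_less[of _ 0, THEN iffD2, simplified] simp: less_top)
  then obtain m \<rho> k m' \<rho>' k' where
    dec: "hnorm3_decomp T \<gamma> h m \<rho> k"
      "(\<Sum>j<m. hnorm3_term T N \<gamma> (\<rho> j) (k j)) < hnorm3 T X N \<gamma> h + ennreal (e / 2)" and
    dec': "hnorm3_decomp T \<gamma> h' m' \<rho>' k'"
      "(\<Sum>j<m'. hnorm3_term T N \<gamma> (\<rho>' j) (k' j)) < hnorm3 T X N \<gamma> h' + ennreal (e / 2)"
    by (elim hnorm3_lessE) blast
  note d = hnorm3_decompD[OF dec(1)] dec(2) and d' = hnorm3_decompD[OF dec'(1)] dec'(2)
  define \<rho>'' where "\<rho>'' j = (if j < m then \<rho> j else \<rho>' (j - m))" for j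
  define k'' where "k'' j = (if j < m then k j else k' (j - m))" for j
  have "hnorm3 T X N \<gamma> (\<lambda>x. h x + h' x)
      \<le> (\<Sum>j<m + m'. hnorm3_term T N \<gamma> (\<rho>'' j) (k'' j))"
  proof (rule hnorm3_le)
    have "(\<Sum>j<m + m'. k'' j x) = (\<Sum>j<m + m'. if j < m then k j x else k' (j - m) x)" for x
      by (intro sum.cong) (auto simp: k''_def)
    then have "h x + h' x = (\<Sum>j<m + m'. k'' j x)" if "x \<in> simp3 T" for x
      using that by (simp only: d(4) d'(4) sum_append[where f = "\<lambda>j. k j x" and g = "\<lambda>j. k' j x"])
    then show "hnorm3_decomp T \<gamma> (\<lambda>x. h x + h' x) (m + m') \<rho>'' k''"
      unfolding hnorm3_decomp_def by (auto simp: \<rho>''_def k''_def d d')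
  qed
  also have "\<dots> = (\<Sum>j<m + m'. if j < m then hnorm3_term T N \<gamma> (\<rho> j) (k j)
        else hnorm3_term T N \<gamma> (\<rho>' (j - m)) (k' (j - m)))"
    by (intro sum.cong) (auto simp: k''_def \<rho>''_def)
  also have "\<dots> \<le> (hnorm3 T X N \<gamma> h + ennreal (e / 2)) + (hnorm3 T X N \<gamma> h' + ennreal (e / 2))"
    unfolding sum_append[where f = "\<lambda>j. hnorm3_term T N \<gamma> (\<rho> j) (k j)"
      and g = "\<lambda>j. hnorm3_term T N \<gamma> (\<rho>' j) (k' j)"]
    by (intro add_mono less_imp_le d d')
  also have "\<dots> = hnorm3 T X N \<gamma> h + hnorm3 T X N \<gamma> h' + (ennreal (e / 2) + ennreal (e / 2))"
    by (simp add: ac_simps)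
  also have "ennreal (e / 2) + ennreal (e / 2) = ennreal e"
    using \<open>0 < e\<close> by (simp flip: ennreal_plus)
  finally show "hnorm3 T X N \<gamma> (\<lambda>x. h x + h' x)
      \<le> hnorm3 T X N \<gamma> h + hnorm3 T X N \<gamma> h' + ennreal e" .
qed

lemma hnorm3_term_uminus:
  assumes "k \<in> cont_maps (simp3 T) X N"
  shows "hnorm3_term T N \<gamma> \<rho> (\<lambda>x. - k x) = hnorm3_term T N \<gamma> \<rho> k"
  unfolding hnorm3_term_def by (simp add: N_minus[OF cont_maps_mem[OF assms]])

lemma hnorm3_uminus: "hnorm3 T X N \<gamma> (\<lambda>x. - h x) = hnorm3 T X N \<gamma> h"
proof -
  have le: "hnorm3 T X N \<gamma> (\<lambda>x. - h x) \<le> hnorm3 T X N \<gamma> h" for h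
  proof (rule dense_ge)
    fix c assume "hnorm3 T X N \<gamma> h < c"
    then obtain m \<rho> k where dec: "hnorm3_decomp T \<gamma> h m \<rho> k"
      "(\<Sum>j<m. hnorm3_term T N \<gamma> (\<rho> j) (k j)) < c"
      by (rule hnorm3_lessE)
    note d = hnorm3_decompD[OF dec(1)] dec(2)
    have "hnorm3 T X N \<gamma> (\<lambda>x. - h x) \<le> (\<Sum>j<m. hnorm3_term T N \<gamma> (\<rho> j) (\<lambda>x. - k j x))"
      by (rule hnorm3_le) (auto simp: hnorm3_decomp_def d cont_maps_uminus sum_negf)
    also have "\<dots> = (\<Sum>j<m. hnorm3_term T N \<gamma> (\<rho> j) (k j))"
      by (simp add: hnorm3_term_uminus d)
    finally show "hnorm3 T X N \<gamma> (\<lambda>x. - h x) \<le> c"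
      using d(5) by simp
  qed
  show ?thesis
    using le[of h] le[of "\<lambda>x. - h x"] by simp
qed

lemma hnorm3_diff_commute: "hnorm3 T X N \<gamma> (\<lambda>x. h x - h' x) = hnorm3 T X N \<gamma> (\<lambda>x. h' x - h x)"
  using hnorm3_uminus[of T \<gamma> "\<lambda>x. h x - h' x"] by simp

lemma hnorm3_diff_finite:
  assumes "hnorm3 T X N \<gamma> h < \<top>" "hnorm3 T X N \<gamma> h' < \<top>"
  shows "hnorm3 T X N \<gamma> (\<lambda>x. h x - h' x) < \<top>"
  using hnorm3_triangle[of T \<gamma> h "\<lambda>x. - h' x"] assms
  by (simp only: hnorm3_uminus diff_conv_add_uminus[symmetric])
    (metis ennreal_add_less_top le_less_trans)

lemma hnorm3_diff_triangle:
  "hnorm3 T X N \<gamma> (\<lambda>x. h x - h'' x)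
    \<le> hnorm3 T X N \<gamma> (\<lambda>x. h x - h' x) + hnorm3 T X N \<gamma> (\<lambda>x. h' x - h'' x)"
  using hnorm3_triangle[of T \<gamma> "\<lambda>x. h x - h' x" "\<lambda>x. h' x - h'' x"] by simp

text \<open>
  The metric whose open sets generate \<open>ZC_borel\<close>. Distinct defects have positive distance because
  the norm dominates the increment pointwise and increments vanish off the simplex.
\<close>

lemma Metric_space_ZC:
  assumes "0 < T"
  shows "Metric_space (ZC T X N S \<gamma>) (\<lambda>h h'. enn2real (hnorm3 T X N \<gamma> (\<lambda>x. h x - h' x)))"
proof
  fix h h' h'' :: "real \<times> real \<times> real \<Rightarrow> 'a"
  let ?d = "\<lambda>h h'. hnorm3 T X N \<gamma> (\<lambda>x. h x - h' x)"
  show "0 \<le> enn2real (?d h h')" by simp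
  show "enn2real (?d h h') = enn2real (?d h' h)"
    by (rule arg_cong[OF hnorm3_diff_commute])
  assume h: "h \<in> ZC T X N S \<gamma>" and h': "h' \<in> ZC T X N S \<gamma>"
  have fin: "?d h h' < \<top>"
    using h h' by (intro hnorm3_diff_finite) (auto simp: ZC_def)
  show "enn2real (?d h h') = 0 \<longleftrightarrow> h = h'"
  proof
    assume d0: "enn2real (?d h h') = 0"
    show "h = h'"
    proof
      fix x :: "real \<times> real \<times> real"
      show "h x = h' x"
      proof (cases "x \<in> simp3 T")
        case True
        obtain t u s where x: "x = (t, u, s)" by (cases x)
        have "N (h x - h' x) \<le> 0"
          using hnorm3_bound[OF assms fin, of t u s] True d0 by (simp add: x)
        moreover have "h x - h' x \<in> X"
          using h h' by (auto simp: ZC_def cont_maps_mem intro: diff_mem)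
        ultimately show ?thesis
          using nonneg definite by (metis eq_iff_diff_eq_0 order_antisym)
      next
        case False
        then show ?thesis
          using h h' by (simp add: ZC_def cont_maps_def del: split_paired_All)
      qed
    qed
  qed (simp add: hnorm3_zero)
  assume h'': "h'' \<in> ZC T X N S \<gamma>"
  have fin': "?d h' h'' < \<top>"
    using h' h'' by (intro hnorm3_diff_finite) (auto simp: ZC_def)
  show "enn2real (?d h h'') \<le> enn2real (?d h h') + enn2real (?d h' h'')"
    using enn2real_mono[OF hnorm3_diff_triangle] fin fin' 
    by (subst enn2real_plus[symmetric]) (auto simp: ennreal_add_less_top)
qed

end


section \<open>Level weights and the modulus of continuity\<close>

text \<open>
  The residuals of level \<open>n\<close> will be of size \<open>level_weight \<gamma> n * 2 powr (-\<gamma> * n)\<close>: at \<open>\<gamma> = 1\<close> the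
  critical factor \<open>1/2\<close> makes each level contribute the same amount, which costs a factor \<open>n + 1\<close>
  and, in terms of interval lengths, the logarithm in \<open>modulus\<close>.
\<close>

definition level_weight :: "real \<Rightarrow> nat \<Rightarrow> real" where
  "level_weight \<gamma> n = (if \<gamma> = 1 then real (Suc n) else 1)"

definition level_size :: "real \<Rightarrow> nat \<Rightarrow> real" where
  "level_size \<gamma> n = level_weight \<gamma> n * (2 powr (-\<gamma>)) ^ n"

definition modulus :: "real \<Rightarrow> real \<Rightarrow> real" where
  "modulus \<gamma> d = d powr \<gamma> * (if \<gamma> = 1 then 1 + \<bar>ln d\<bar> else 1)"

lemma level_weight_ge_1: "1 \<le> level_weight \<gamma> n"
  by (simp add: level_weight_def)

lemma level_size_nonneg: "0 \<le> level_size \<gamma> n"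
  using level_weight_ge_1[of \<gamma> n] by (simp add: level_size_def)

lemma level_size_add: "level_size \<gamma> (n + i) \<le> level_size \<gamma> n * level_size \<gamma> i"
proof -
  have "level_weight \<gamma> (n + i) \<le> level_weight \<gamma> n * level_weight \<gamma> i"
    by (simp add: level_weight_def algebra_simps)
  then have "level_weight \<gamma> (n + i) * (2 powr (-\<gamma>)) ^ (n + i)
      \<le> level_weight \<gamma> n * level_weight \<gamma> i * (2 powr (-\<gamma>)) ^ (n + i)"
    by (intro mult_right_mono) auto
  then show ?thesis
    by (simp add: level_size_def power_add mult_ac)
qed

lemma powr_grid:
  fixes T \<gamma> :: real
  assumes "0 < T"
  shows "(T / 2 ^ n) powr \<gamma> = T powr \<gamma> * (2 powr (-\<gamma>)) ^ n"
proof -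
  have "(2 ^ n :: real) powr \<gamma> = 2 powr (real n * \<gamma>)"
    by (simp add: powr_powr flip: powr_realpow)
  then show ?thesis
    using assms by (simp add: powr_divide powr_power powr_minus field_simps)
qed

lemma powr_grid_le: "0 < T \<Longrightarrow> (T / 2 ^ n) powr \<gamma> \<le> T powr \<gamma> * level_size \<gamma> n"
  unfolding powr_grid level_size_def
  using level_weight_ge_1[of \<gamma> n] by (intro mult_left_mono) auto

lemma summable_level_size:
  assumes "0 < \<gamma>"
  shows "summable (level_size \<gamma>)"
proof (cases "\<gamma> = 1")
  case True
  have "summable (\<lambda>n. of_nat (Suc n) * (1 / 2 :: real) ^ n)"
    using geometric_deriv_sums[of "1 / 2 :: real"] by (auto simp: sums_iff)
  then show ?thesis
    by (simp add: level_size_def[abs_def] level_weight_def True powr_minus inverse_eq_divide)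
next
  case False
  have "2 powr (-\<gamma>) < 2 powr 0"
    using assms by (intro powr_less_mono) auto
  then show ?thesis
    using False by (simp add: level_size_def[abs_def] level_weight_def summable_geometric)
qed

lemma level_size_tail:
  assumes "0 < \<gamma>"
  shows "(\<Sum>j=n..<m. level_size \<gamma> j) \<le> suminf (level_size \<gamma>) * level_size \<gamma> n"
proof (cases "n \<le> m")
  case True
  have "(\<Sum>j=n..<m. level_size \<gamma> j) = (\<Sum>i<m - n. level_size \<gamma> (n + i))"
    using True sum.shift_bounds_nat_ivl[of "level_size \<gamma>" 0 n "m - n"]
    by (simp add: atLeast0LessThan add.commute)
  also have "\<dots> \<le> (\<Sum>i<m - n. level_size \<gamma> n * level_size \<gamma> i)"
    by (intro sum_mono level_size_add)
  also have "\<dots> = level_size \<gamma> n * (\<Sum>i<m - n. level_size \<gamma> i)"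
    by (simp add: sum_distrib_left)
  also have "\<dots> \<le> level_size \<gamma> n * suminf (level_size \<gamma>)"
    by (intro mult_left_mono sum_le_suminf summable_level_size assms) (auto simp: level_size_nonneg)
  finally show ?thesis by (simp add: mult.commute)
next
  case False
  then show ?thesis
    by (simp add: level_size_nonneg suminf_nonneg summable_level_size assms)
qed

lemma admissible_factor_nonneg: "admissible_factor \<gamma> \<kappa> \<Longrightarrow> 0 \<le> \<kappa> L"
  by (auto simp: admissible_factor_def)

text \<open>
  A supersolution of the scalar recursion that the admissibility estimate imposes on the largest
  residual of each level. Below the critical exponent it is a multiple of \<open>2 powr (-\<gamma> * n)\<close>; at
  \<open>\<gamma> = 1\<close> the perturbations of the factor \<open>1/2\<close> enter through a convergent infinite product.
\<close>

lemma level_profile: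
  assumes adm: "admissible_factor \<gamma> \<kappa>" and "0 < T" "0 < \<gamma>"
  shows "\<exists>K\<ge>0. \<exists>b. (\<forall>n. 0 \<le> b n \<and> b n \<le> K * level_size \<gamma> n) \<and>
    (\<forall>n. \<kappa> (T / 2 ^ n) * b n + (T / 2 ^ n) powr \<gamma> \<le> b (Suc n))"
proof (cases "\<gamma> < 1")
  case True
  then obtain \<theta> where \<theta>: "0 \<le> \<theta>" "\<theta> < 2 powr (-\<gamma>)" "\<kappa> = (\<lambda>L. \<theta>)"
    using adm by (auto simp: admissible_factor_def)
  define q where "q = 2 powr (-\<gamma>)"
  define K where "K = T powr \<gamma> / (q - \<theta>)"
  have "K \<ge> 0" using \<theta> by (simp add: K_def q_def)
  have "\<theta> * K + T powr \<gamma> = q * K"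
    using \<theta>(2) by (simp add: K_def q_def field_simps)
  then have "\<theta> * (K * q ^ n) + T powr \<gamma> * q ^ n = K * q ^ Suc n" for n
    by (metis (no_types, opaque_lifting) distrib_right mult.assoc mult.commute power_Suc)
  with \<open>K \<ge> 0\<close> show ?thesis
    by (intro exI[of _ K] conjI exI[of _ "\<lambda>n. K * q ^ n"] allI)
      (use True in \<open>auto simp: q_def \<theta>(3) powr_grid[OF \<open>0 < T\<close>] level_size_def level_weight_def\<close>)
next
  case False
  then obtain K \<eta> where K: "\<gamma> = 1" "0 < K" "0 < \<eta>" "\<kappa> = (\<lambda>L. 1 / 2 + K * L powr \<eta>)"
    using adm by (auto simp: admissible_factor_def)
  define p where "p i = 2 * K * (T / 2 ^ i) powr \<eta>" for i :: nat
  define P where "P n = (\<Prod>i<n. 1 + p i)" for n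
  have p0: "0 \<le> p i" for i using K by (simp add: p_def)
  have P1: "1 \<le> P n" for n
    unfolding P_def using p0 by (intro prod_ge_1) auto
  have sp: "summable p"
  proof -
    have "2 powr (-\<eta>) < 2 powr 0"
      using K by (intro powr_less_mono) auto
    then show ?thesis
      unfolding p_def powr_grid[OF \<open>0 < T\<close>]
      by (intro summable_mult summable_geometric) auto
  qed
  define E where "E = exp (suminf p)"
  have PE: "P n \<le> E" for n
  proof -
    \<comment> \<open>\<open>1 + x \<le> exp x\<close> turns the product into the exponential of a convergent series.\<close>
    have "P n \<le> (\<Prod>i<n. exp (p i))"
      unfolding P_def using p0 by (intro prod_mono) (auto simp: add_nonneg_nonneg)
    also have "\<dots> = exp (\<Sum>i<n. p i)"
      by (simp add: exp_sum)
    also have "\<dots> \<le> E"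
      unfolding E_def using p0 sp by (auto intro!: sum_le_suminf)
    finally show ?thesis .
  qed
  define b where "b n = 2 * T * (real n * P n) / 2 ^ n" for n
  have "0 \<le> b n" for n
    using P1[of n] \<open>0 < T\<close> by (simp add: b_def)
  moreover have "b n \<le> 2 * T * E * level_size \<gamma> n" for n
  proof -
    have "real n * P n \<le> real (Suc n) * E"
      using PE[of n] P1[of n] by (intro mult_mono) auto
    then have "2 * T * (real n * P n) / 2 ^ n \<le> 2 * T * (real (Suc n) * E) / 2 ^ n"
      using \<open>0 < T\<close> by (intro divide_right_mono mult_left_mono) auto
    then show ?thesis
      by (simp add: b_def level_size_def level_weight_def K powr_minus power_inverse field_simps)
  qed
  moreover have "\<kappa> (T / 2 ^ n) * b n + (T / 2 ^ n) powr \<gamma> \<le> b (Suc n)" for n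
  proof -
    have "\<kappa> (T / 2 ^ n) * b n = (1 + p n) / 2 * b n"
      by (simp add: K(4) p_def algebra_simps)
    also have "\<dots> = T / 2 ^ n * (real n * P (Suc n))"
      by (simp add: b_def P_def mult_ac)
    also have "\<dots> + (T / 2 ^ n) powr \<gamma> = T / 2 ^ n * (real n * P (Suc n) + 1)"
      using \<open>0 < T\<close> K(1) by (simp add: algebra_simps)
    also have "\<dots> \<le> T / 2 ^ n * (real n * P (Suc n) + P (Suc n))"
      using P1[of "Suc n"] \<open>0 < T\<close> by (intro mult_left_mono) auto
    also have "\<dots> = b (Suc n)"
      by (simp add: b_def field_simps)
    finally show ?thesis by simp
  qed
  moreover have "2 * T * E \<ge> 0"
    using \<open>0 < T\<close> by (simp add: E_def)
  ultimately show ?thesis by blast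
qed

lemma level_of_length:
  assumes "0 < d" "d \<le> (T::real)"
  shows "\<exists>n. T / 2 ^ n \<le> d \<and> d < 2 * T / 2 ^ n"
proof -
  have ex: "\<exists>n. T / 2 ^ n \<le> d"
  proof -
    obtain n where "T / d < 2 ^ n"
      using real_arch_pow[of 2 "T / d"] by auto
    then show ?thesis
      using assms by (intro exI[of _ n]) (simp add: field_simps)
  qed
  define n where "n = (LEAST n. T / 2 ^ n \<le> d)"
  have "T / 2 ^ n \<le> d"
    unfolding n_def using ex by (rule LeastI_ex)
  moreover have "d < 2 * T / 2 ^ n"
  proof (cases n)
    case 0
    then show ?thesis using assms by simp
  next
    case (Suc m)
    then have "\<not> T / 2 ^ m \<le> d"
      unfolding n_def using not_less_Least[of m "\<lambda>n. T / 2 ^ n \<le> d"] by (simp add: n_def)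
    then show ?thesis using Suc by simp
  qed
  ultimately show ?thesis by blast
qed

lemma level_size_le_modulus:
  assumes "0 < T" "0 < \<gamma>"
  shows "\<exists>K>0. \<forall>n d. 0 < d \<longrightarrow> T / 2 ^ n \<le> d \<longrightarrow> d < 2 * T / 2 ^ n \<longrightarrow>
    level_size \<gamma> n \<le> K * modulus \<gamma> d"
proof (cases "\<gamma> = 1")
  case False
  have "level_size \<gamma> n \<le> T powr (-\<gamma>) * modulus \<gamma> d" if "0 < d" "T / 2 ^ n \<le> d" for n d
  proof -
    have "(T / 2 ^ n) powr \<gamma> \<le> d powr \<gamma>"
      using that assms by (intro powr_mono2) auto
    then have "T powr (-\<gamma>) * (T powr \<gamma> * (2 powr (-\<gamma>)) ^ n) \<le> T powr (-\<gamma>) * d powr \<gamma>"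
      unfolding powr_grid[OF \<open>0 < T\<close>] by (intro mult_left_mono) auto
    moreover have "T powr (-\<gamma>) * T powr \<gamma> = 1"
      using assms by (simp flip: powr_add)
    ultimately show ?thesis
      using False by (simp add: modulus_def level_size_def level_weight_def flip: mult.assoc)
  qed
  then show ?thesis using assms by (intro exI[of _ "T powr (-\<gamma>)"]) auto
next
  case True
  define c where "c = (\<bar>ln (2 * T)\<bar> + 1) / ln 2"
  have c0: "c > 0" by (simp add: c_def add_nonneg_pos)
  have "level_size \<gamma> n \<le> (1 + c) / T * modulus \<gamma> d"
    if d: "0 < d" "T / 2 ^ n \<le> d" "d < 2 * T / 2 ^ n" for n d
  proof -
    have "2 ^ n < 2 * T / d"
      using d(1,3) by (simp add: pos_less_divide_eq mult.commute)
    then have "ln (2 ^ n) < ln (2 * T / d)"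
      using assms d by (subst ln_less_cancel_iff) auto
    then have "real n * ln 2 < ln (2 * T) - ln d"
      using assms d by (simp add: ln_realpow ln_div)
    also have "\<dots> \<le> (\<bar>ln (2 * T)\<bar> + 1) * (1 + \<bar>ln d\<bar>)"
    proof -
      have "0 \<le> \<bar>ln (2 * T)\<bar> * \<bar>ln d\<bar>" by simp
      then show ?thesis
        unfolding distrib_left distrib_right mult_1_left mult_1_right by linarith
    qed
    finally have "real n \<le> c * (1 + \<bar>ln d\<bar>)"
      by (simp add: c_def field_simps)
    then have n: "real (Suc n) \<le> (1 + c) * (1 + \<bar>ln d\<bar>)"
      by (simp add: distrib_left distrib_right)
    have "1 / 2 ^ n \<le> d / T"
      using d assms by (simp add: field_simps)
    with n have "real (Suc n) * (1 / 2 ^ n) \<le> ((1 + c) * (1 + \<bar>ln d\<bar>)) * (d / T)"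
      using c0 by (intro mult_mono) auto
    then show ?thesis
      using d by (simp add: level_size_def level_weight_def modulus_def True powr_minus
          power_inverse abs_of_pos[OF d(1)] field_simps)
  qed
  then show ?thesis
    using assms c0 by (intro exI[of _ "(1 + c) / T"]) auto
qed

lemma modulus_pos: "0 < d \<Longrightarrow> 0 < modulus \<gamma> d"
  by (simp add: modulus_def add_pos_nonneg)

lemma modulus_nonneg: "0 \<le> modulus \<gamma> d"
  by (simp add: modulus_def)

lemma isCont_modulus: "0 < d \<Longrightarrow> isCont (modulus \<gamma>) d"
  unfolding modulus_def[abs_def] by (cases "\<gamma> = 1") (auto intro!: continuous_intros)

lemma modulus_small:
  assumes "0 < \<gamma>" "0 < e"
  shows "\<exists>\<delta>>0. \<forall>d. 0 \<le> d \<longrightarrow> d < \<delta> \<longrightarrow> modulus \<gamma> d < e"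
proof -
  have "(modulus \<gamma> \<longlongrightarrow> 0) (at_right 0)"
  proof (cases "\<gamma> = 1")
    case True
    have "((\<lambda>d::real. d * (1 + \<bar>ln d\<bar>)) \<longlongrightarrow> 0) (at_right 0)"
      by real_asymp
    moreover have "\<forall>\<^sub>F d in at_right 0. modulus \<gamma> d = d * (1 + \<bar>ln d\<bar>)"
      using True by (auto simp: modulus_def eventually_at_filter)
    ultimately show ?thesis
      by (simp add: tendsto_cong)
  next
    case False
    have "((\<lambda>d::real. d powr \<gamma>) \<longlongrightarrow> 0) (at_right 0)"
      using \<open>0 < \<gamma>\<close> by real_asymp
    then show ?thesis
      using False by (simp add: modulus_def[abs_def])
  qed
  then have "\<forall>\<^sub>F d in at_right 0. modulus \<gamma> d < e"
    using \<open>0 < e\<close> by (rule order_tendstoD)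
  then obtain \<delta> where "\<delta> > 0" "\<forall>d. 0 < d \<longrightarrow> d < \<delta> \<longrightarrow> modulus \<gamma> d < e"
    unfolding eventually_at_right_field by auto
  moreover have "modulus \<gamma> 0 < e"
    using assms by (simp add: modulus_def)
  ultimately show ?thesis
    by (intro exI[of _ \<delta>]) (metis order_le_less)
qed


section \<open>Dyadic rounding\<close>

definition dfloor :: "real \<Rightarrow> nat \<Rightarrow> real \<Rightarrow> nat" where
  "dfloor T n t = nat \<lfloor>t * 2 ^ n / T\<rfloor>"

definition dceil :: "real \<Rightarrow> nat \<Rightarrow> real \<Rightarrow> nat" where
  "dceil T n t = nat \<lceil>t * 2 ^ n / T\<rceil>"

lemma dpt_mono: "0 \<le> T \<Longrightarrow> i \<le> j \<Longrightarrow> dpt T n i \<le> dpt T n j"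
  by (auto simp: dpt_def intro!: divide_right_mono mult_right_mono)

lemma dpt_Suc: "dpt T n (Suc k) = dpt T n k + T / 2 ^ n"
  by (simp add: dpt_def field_simps)

lemma dpt_range:
  assumes "0 < T" "k \<le> 2 ^ n"
  shows "0 \<le> dpt T n k" "dpt T n k \<le> T"
proof -
  have "real k \<le> 2 ^ n"
    using assms(2) by (metis of_nat_le_iff of_nat_numeral of_nat_power)
  then show "0 \<le> dpt T n k" "dpt T n k \<le> T"
    using assms by (auto simp: dpt_def field_simps)
qed

lemma dpt_dyadic: "k \<le> 2 ^ n \<Longrightarrow> dpt T n k \<in> dyadics T"
  by (auto simp: dyadics_def)

lemma dyadics_range: "0 < T \<Longrightarrow> t \<in> dyadics T \<Longrightarrow> 0 \<le> t \<and> t \<le> T"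
  by (auto simp: dyadics_def dpt_range)

lemma dyadics_dpt_level:
  assumes "dpt T n k = t" "n \<le> m"
  shows "dpt T m (2 ^ (m - n) * k) = t"
  using dpt_double[of T "m - n" n k] assms by simp

lemma dyadics_level:
  assumes "t \<in> dyadics T"
  shows "\<exists>n0. \<forall>n\<ge>n0. \<exists>k\<le>2 ^ n. t = dpt T n k"
proof -
  obtain n0 k where k: "k \<le> 2 ^ n0" "t = dpt T n0 k"
    using assms by (auto simp: dyadics_def)
  have "2 ^ (n - n0) * k \<le> 2 ^ n" if "n \<ge> n0" for n
    using mult_left_mono[OF k(1), of "2 ^ (n - n0)"] that by (simp flip: power_add)
  then show ?thesis
    using dyadics_dpt_level[OF k(2)[symmetric]] by metis
qed

context
  fixes T t :: real
  assumes T: "0 < T" and t: "0 \<le> t" "t \<le> T"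
begin

lemma scaled_range: "0 \<le> t * 2 ^ n / T" "t * 2 ^ n / T \<le> 2 ^ n"
  using T t by (auto simp: field_simps)

lemma real_dfloor: "real (dfloor T n t) = of_int \<lfloor>t * 2 ^ n / T\<rfloor>"
  using scaled_range[of n] by (simp add: dfloor_def)

lemma real_dceil: "real (dceil T n t) = of_int \<lceil>t * 2 ^ n / T\<rceil>"
  using scaled_range[of n] by (simp add: dceil_def)

lemma dfloor_le: "dpt T n (dfloor T n t) \<le> t"
proof -
  have "real (dfloor T n t) \<le> t * 2 ^ n / T"
    unfolding real_dfloor by (rule of_int_floor_le)
  then show ?thesis using T by (simp add: dpt_def field_simps)
qed

lemma dfloor_gt: "t < dpt T n (dfloor T n t) + T / 2 ^ n"
proof -
  have "t * 2 ^ n / T < real (dfloor T n t) + 1"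
    unfolding real_dfloor by linarith
  then show ?thesis using T by (simp add: dpt_def field_simps)
qed

lemma dceil_ge: "t \<le> dpt T n (dceil T n t)"
proof -
  have "t * 2 ^ n / T \<le> real (dceil T n t)"
    unfolding real_dceil by (rule le_of_int_ceiling)
  then show ?thesis using T by (simp add: dpt_def field_simps)
qed

lemma dceil_lt: "dpt T n (dceil T n t) < t + T / 2 ^ n"
proof -
  have "real (dceil T n t) < t * 2 ^ n / T + 1"
    unfolding real_dceil by linarith
  then show ?thesis using T by (simp add: dpt_def field_simps)
qed

lemma dfloor_bound: "dfloor T n t \<le> 2 ^ n"
proof -
  have "\<lfloor>t * 2 ^ n / T\<rfloor> \<le> 2 ^ n"
    using scaled_range(2)[of n] by (simp add: floor_le_iff)
  then show ?thesis by (simp add: dfloor_def nat_le_iff)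
qed

lemma dceil_bound: "dceil T n t \<le> 2 ^ n"
proof -
  have "\<lceil>t * 2 ^ n / T\<rceil> \<le> 2 ^ n"
    using scaled_range(2)[of n] by (simp add: ceiling_le_iff)
  then show ?thesis by (simp add: dceil_def nat_le_iff)
qed

lemma dfloor_Suc:
  "dfloor T (Suc n) t = 2 * dfloor T n t \<or> dfloor T (Suc n) t = Suc (2 * dfloor T n t)"
proof -
  have "t * 2 ^ Suc n / T = 2 * (t * 2 ^ n / T)" by simp
  then have "\<lfloor>t * 2 ^ Suc n / T\<rfloor> = 2 * \<lfloor>t * 2 ^ n / T\<rfloor> \<or>
      \<lfloor>t * 2 ^ Suc n / T\<rfloor> = 2 * \<lfloor>t * 2 ^ n / T\<rfloor> + 1"
    by linarith
  then show ?thesis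
    using real_dfloor[of n] real_dfloor[of "Suc n"] by linarith
qed

lemma dceil_Suc:
  "dceil T (Suc n) t = 2 * dceil T n t \<or> Suc (dceil T (Suc n) t) = 2 * dceil T n t"
proof -
  have "t * 2 ^ Suc n / T = 2 * (t * 2 ^ n / T)" by simp
  then have "\<lceil>t * 2 ^ Suc n / T\<rceil> = 2 * \<lceil>t * 2 ^ n / T\<rceil> \<or>
      \<lceil>t * 2 ^ Suc n / T\<rceil> + 1 = 2 * \<lceil>t * 2 ^ n / T\<rceil>"
    by linarith
  then show ?thesis
    using real_dceil[of n] real_dceil[of "Suc n"] by linarith
qed

lemma dfloor_tendsto: "(\<lambda>n. dpt T n (dfloor T n t)) \<longlonglongrightarrow> t"
proof (rule tendsto_sandwich)
  show "\<forall>\<^sub>F n in sequentially. t - T / 2 ^ n \<le> dpt T n (dfloor T n t)"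
    using dfloor_gt by (intro always_eventually allI) (simp add: less_imp_le diff_le_eq)
  show "\<forall>\<^sub>F n in sequentially. dpt T n (dfloor T n t) \<le> t"
    using dfloor_le by (intro always_eventually allI)
  have "(\<lambda>n. t - T * (1 / 2) ^ n) \<longlonglongrightarrow> t - T * 0"
    by (intro tendsto_intros LIMSEQ_power_zero) auto
  then show "(\<lambda>n. t - T / 2 ^ n) \<longlonglongrightarrow> t"
    by (simp add: power_divide)
qed auto

end

lemma dfloor_dpt: "0 < T \<Longrightarrow> dfloor T n (dpt T n k) = k"
  by (simp add: dfloor_def dpt_def)

lemma dceil_dpt: "0 < T \<Longrightarrow> dceil T n (dpt T n k) = k"
  by (simp add: dceil_def dpt_def)

lemma dfloor_mono: "0 < T \<Longrightarrow> s \<le> t \<Longrightarrow> dfloor T n s \<le> dfloor T n t"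
  unfolding dfloor_def by (intro nat_mono floor_mono divide_right_mono mult_right_mono) auto

text \<open>
  An increment whose length is comparable to the mesh contains at least one grid point and at
  most one full grid interval.
\<close>

lemma dceil_dfloor:
  assumes "0 < T" "0 \<le> s" "t \<le> T" "0 < t - s" "T / 2 ^ n \<le> t - s" "t - s < 2 * T / 2 ^ n"
  shows "dfloor T n t = dceil T n s \<or> dfloor T n t = Suc (dceil T n s)"
proof -
  have "1 \<le> t * 2 ^ n / T - s * 2 ^ n / T" "t * 2 ^ n / T - s * 2 ^ n / T < 2"
    using assms by (auto simp: field_simps)
  then have "\<lfloor>t * 2 ^ n / T\<rfloor> = \<lceil>s * 2 ^ n / T\<rceil> \<or> \<lfloor>t * 2 ^ n / T\<rfloor> = \<lceil>s * 2 ^ n / T\<rceil> + 1"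
    by linarith
  moreover have "real (dfloor T n t) = of_int \<lfloor>t * 2 ^ n / T\<rfloor>"
    "real (dceil T n s) = of_int \<lceil>s * 2 ^ n / T\<rceil>"
    using assms by (auto intro!: real_dfloor real_dceil)
  ultimately show ?thesis by linarith
qed


section \<open>Residuals on the dyadic grid\<close>

text \<open>One level of the scale, with the uniform bound on a compact time interval made explicit.\<close>

locale evolution = banach_on X N for X :: "'a::real_vector set" and N :: "'a \<Rightarrow> real" +
  fixes S :: "real \<Rightarrow> 'a \<Rightarrow> 'a" and T Mb :: real
  assumes T_pos: "0 < T"
    and maps: "0 \<le> t \<Longrightarrow> x \<in> X \<Longrightarrow> S t x \<in> X"
    and add: "0 \<le> t \<Longrightarrow> x \<in> X \<Longrightarrow> y \<in> X \<Longrightarrow> S t (x + y) = S t x + S t y"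
    and scale: "0 \<le> t \<Longrightarrow> x \<in> X \<Longrightarrow> S t (c *\<^sub>R x) = c *\<^sub>R S t x"
    and S_id: "x \<in> X \<Longrightarrow> S 0 x = x"
    and semigroup: "0 \<le> v \<Longrightarrow> 0 \<le> t \<Longrightarrow> x \<in> X \<Longrightarrow> S (v + t) x = S v (S t x)"
    and strongly_continuous:
      "x \<in> X \<Longrightarrow> continuous_map (top_of_set {0..}) (ntop X N) (\<lambda>t. S t x)"
    and S_bound: "0 \<le> t \<Longrightarrow> t \<le> T \<Longrightarrow> x \<in> X \<Longrightarrow> N (S t x) \<le> Mb * N x"
    and Mb_ge_1: "1 \<le> Mb"
begin

lemma S_uminus: "0 \<le> t \<Longrightarrow> x \<in> X \<Longrightarrow> S t (- x) = - S t x"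
  using scale[of t x "-1"] by simp

lemma S_diff: "0 \<le> t \<Longrightarrow> x \<in> X \<Longrightarrow> y \<in> X \<Longrightarrow> S t (x - y) = S t x - S t y"
  using add[of t x "- y"] by (simp add: S_uminus uminus_mem)

lemma S_0: "0 \<le> t \<Longrightarrow> S t 0 = 0"
  using S_diff[of t 0 0] by simp

text \<open>Joint continuity: the uniform bound takes care of the moving argument.\<close>

lemma tends_S:
  assumes f: "tends f l" and v: "v \<longlonglongrightarrow> w" "\<And>n. 0 \<le> v n" "\<And>n. v n \<le> T"
  shows "tends (\<lambda>n. S (v n) (f n)) (S w l)"
proof -
  have l: "l \<in> X" and fn: "f n \<in> X" for n
    using f by (auto simp: tends_def)
  have w: "0 \<le> w"
    using v by (auto intro: LIMSEQ_le_const)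
  have c: "tends (\<lambda>n. S (v n) l) (S w l)"
    using v w l by (intro continuous_map_tends[where D = "{0..}", OF strongly_continuous]) auto
  show ?thesis
  proof (rule tends_null)
    fix n
    show "S (v n) (f n) \<in> X" "S w l \<in> X"
      using fn l v w by (auto intro: maps)
    have "N (S (v n) (f n) - S w l) \<le> N (S (v n) (f n) - S (v n) l) + N (S (v n) l - S w l)"
      using fn l v w by (intro triangle_via maps) auto
    also have "N (S (v n) (f n) - S (v n) l) = N (S (v n) (f n - l))"
      using fn l v by (simp add: S_diff)
    also have "\<dots> \<le> Mb * N (f n - l)"
      using fn l v by (intro S_bound diff_mem) auto
    finally show "N (S (v n) (f n) - S w l) \<le> Mb * N (f n - l) + N (S (v n) l - S w l)"
      by simp
  next
    have "(\<lambda>n. Mb * N (f n - l) + N (S (v n) l - S w l)) \<longlonglongrightarrow> Mb * 0 + 0"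
      using f c unfolding tends_def by (intro tendsto_intros) auto
    then show "(\<lambda>n. Mb * N (f n - l) + N (S (v n) l - S w l)) \<longlonglongrightarrow> 0"
      by simp
  qed
qed

end

text \<open>
  On a compact time interval strong continuity bounds every single orbit, and uniform boundedness
  turns this into a bound on the operators.
\<close>

lemma evolution_of_scale_semigroup:
  assumes "scale_semigroup B nrm S T" "0 < T"
  shows "\<exists>Mb. evolution (B \<alpha>) (nrm \<alpha>) S T Mb"
proof -
  interpret scale_semigroup B nrm S T by fact
  interpret banach_on "B \<alpha>" "nrm \<alpha>" by (rule banach)
  have "\<exists>C\<ge>1. \<forall>t\<in>{0..T}. \<forall>x\<in>B \<alpha>. nrm \<alpha> (S t x) \<le> C * nrm \<alpha> x"
  proof (rule uniform_boundedness)
    fix x assume x: "x \<in> B \<alpha>"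
    have "continuous_on {0..} (\<lambda>t. nrm \<alpha> (S t x))"
      by (rule continuous_on_norm) (rule strongly_continuous[OF x])
    then have "continuous_on {0..T} (\<lambda>t. nrm \<alpha> (S t x))"
      by (rule continuous_on_subset) auto
    then have "compact ((\<lambda>t. nrm \<alpha> (S t x)) ` {0..T})"
      by (rule compact_continuous_image) simp
    then have "bdd_above ((\<lambda>t. nrm \<alpha> (S t x)) ` {0..T})"
      by (intro bounded_imp_bdd_above compact_imp_bounded)
    then show "\<exists>C. \<forall>t\<in>{0..T}. nrm \<alpha> (S t x) \<le> C"
      by (auto simp: bdd_above_def)
  qed (auto simp: maps add scale bounded)
  then obtain C where "1 \<le> C" "\<forall>t\<in>{0..T}. \<forall>x\<in>B \<alpha>. nrm \<alpha> (S t x) \<le> C * nrm \<alpha> x"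
    by blast
  then have "evolution (B \<alpha>) (nrm \<alpha>) S T C"
    using \<open>0 < T\<close>
    by unfold_locales
      (auto simp: maps add scale zero semigroup strongly_continuous)
  then show ?thesis ..
qed

locale sewing_defect = evolution X N S T Mb
  for X :: "'a::real_vector set" and N S T Mb +
  fixes r :: "'a rule" and H :: "real \<times> real \<times> real \<Rightarrow> 'a" and \<gamma> :: real
  assumes H_ZC: "H \<in> ZC T X N S \<gamma>"
    and \<gamma>_pos: "0 < \<gamma>"
    and rec: "recursion_ok T X S r H"
begin

abbreviation (input) R :: "real \<Rightarrow> real \<Rightarrow> 'a" where
  "R \<equiv> dy_R T S r H"

definition G :: real where
  "G = enn2real (hnorm3 T X N \<gamma> H)"

lemma G_nonneg: "0 \<le> G"
  by (simp add: G_def)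

lemma hnorm3_finite: "hnorm3 T X N \<gamma> H < \<top>"
  using H_ZC by (simp add: ZC_def)

lemma H_cont: "H \<in> cont_maps (simp3 T) X N"
  using H_ZC by (simp add: ZC_def)

lemma H_mem: "H x \<in> X"
  using H_cont by (rule cont_maps_mem)

lemma H_bound: "0 \<le> s \<Longrightarrow> s \<le> u \<Longrightarrow> u \<le> t \<Longrightarrow> t \<le> T \<Longrightarrow> N (H (t, u, s)) \<le> G * (t - s) powr \<gamma>"
  unfolding G_def by (intro hnorm3_bound T_pos hnorm3_finite) (simp add: simp3_def)

lemma H_face: "0 \<le> s \<Longrightarrow> s \<le> u \<Longrightarrow> u \<le> t \<Longrightarrow> t \<le> T \<Longrightarrow> u = t \<or> u = s \<Longrightarrow> H (t, u, s) = 0"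
  by (intro hnorm3_face[OF T_pos hnorm3_finite]) (auto simp: simp3_def)

lemma H_cocycle:
  assumes "0 \<le> s" "s \<le> v" "v \<le> u" "u \<le> t" "t \<le> T"
  shows "H (t, v, s) - H (t, u, s) + H (t, u, v) = S (t - u) (H (u, v, s))"
proof -
  have "delta3 S H (t, u, v, s) = 0"
    using H_ZC assms unfolding ZC_def by (auto simp: simp4_def)
  then show ?thesis
    by (simp add: delta3_def algebra_simps)
qed

lemma germ_mem: "germ H t s \<in> X"
  by (simp add: germ_def uminus_mem H_mem)

lemma gen_res_eq:
  assumes "k < 2 ^ n"
  shows "gen_res T S r H n k = germ H (dpt T n (Suc k)) (dpt T n k) - lvl_I T S r H n (Suc k) +
    S (dpt T n (Suc k) - dpt T n k) (lvl_I T S r H n k)"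
  using assms T_pos by (simp add: gen_res_def dy_R_def dy_I_dpt)

text \<open>
  The residual handed to the rule inside the recursion is the residual computed from the final
  path, since values at coarse grid points are never revised.
\<close>

lemma lvl_I_midpoint:
  assumes "k < 2 ^ n"
  shows "lvl_I T S r H (Suc n) (Suc (2 * k)) =
    germ H (dpt T (Suc n) (Suc (2 * k))) (dpt T n k) +
    S (dpt T (Suc n) (Suc (2 * k)) - dpt T n k) (lvl_I T S r H n k) -
    snd (gen_children T S r H n k)"
  using assms by (simp add: Let_def gen_children_def gen_res_eq)

lemma children_mem:
  assumes "k < 2 ^ n"
  shows "fst (gen_children T S r H n k) \<in> X" "snd (gen_children T S r H n k) \<in> X"
  using rec assms by (auto simp: recursion_ok_def Let_def)

lemma midpoint: "(dpt T n k + dpt T n (Suc k)) / 2 = dpt T (Suc n) (Suc (2 * k))"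
  by (simp add: dpt_def field_simps)

lemma dpt_Suc_double: "dpt T (Suc n) (2 * k) = dpt T n k"
  using dpt_double[of T 1 n k] by simp

lemma split_eq:
  assumes "k < 2 ^ n"
  shows "gen_res T S r H n k = fst (gen_children T S r H n k) +
    S (dpt T n (Suc k) - dpt T (Suc n) (Suc (2 * k))) (snd (gen_children T S r H n k)) +
    H (dpt T n (Suc k), dpt T (Suc n) (Suc (2 * k)), dpt T n k)"
  using rec assms by (simp add: recursion_ok_def Let_def midpoint)

lemma lvl_I_mem: "k \<le> 2 ^ n \<Longrightarrow> lvl_I T S r H n k \<in> X"
proof (induction n arbitrary: k)
  case 0
  then show ?case by (simp add: germ_mem)
next
  case (Suc n)
  show ?case
  proof (cases "even k")
    case True
    then show ?thesis
      using Suc by (auto simp: Let_def)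
  next
    case False
    then obtain i where i: "k = Suc (2 * i)"
      by (metis oddE Suc_eq_plus1)
    then have i': "i < 2 ^ n"
      using Suc.prems by simp
    have "dpt T n i \<le> dpt T (Suc n) (Suc (2 * i))"
      using T_pos by (simp add: dpt_def field_simps)
    then show ?thesis
      unfolding i lvl_I_midpoint[OF i']
      using i' Suc.IH[of i] by (intro diff_mem add_mem germ_mem maps children_mem) auto
  qed
qed

lemma dy_I_mem: "t \<in> dyadics T \<Longrightarrow> dy_I T S r H t \<in> X"
  using T_pos by (auto simp: dyadics_def dy_I_dpt lvl_I_mem)

lemma R_mem: "t \<in> dyadics T \<Longrightarrow> s \<in> dyadics T \<Longrightarrow> s \<le> t \<Longrightarrow> R t s \<in> X"
  unfolding dy_R_def by (intro add_mem diff_mem germ_mem dy_I_mem maps) auto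

lemma R_refl: "t \<in> dyadics T \<Longrightarrow> R t t = 0"
  using dyadics_range[OF T_pos, of t] by (simp add: dy_R_def germ_def S_id dy_I_mem H_face)

text \<open>
  The path \<open>I\<close> contributes a coboundary, which \<open>\<delta>\<close> annihilates, and the germ is built from \<open>H\<close> so
  that its own coboundary is \<open>H\<close>.
\<close>

lemma R_cocycle:
  assumes "t \<in> dyadics T" "u \<in> dyadics T" "s \<in> dyadics T" "s \<le> u" "u \<le> t"
  shows "R t s = R t u + S (t - u) (R u s) + H (t, u, s)"
proof -
  have rng: "0 \<le> s" "t \<le> T"
    using dyadics_range[OF T_pos] assms by auto
  let ?I = "dy_I T S r H"
  have I: "?I t \<in> X" "?I u \<in> X" "?I s \<in> X"
    using assms dy_I_mem by auto
  have "S (t - u) (R u s) = S (t - u) (germ H u s) - S (t - u) (?I u) + S (t - u) (S (u - s) (?I s))"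
    unfolding dy_R_def using assms I
    by (simp add: add S_diff germ_mem maps diff_mem)
  also have "S (t - u) (S (u - s) (?I s)) = S (t - s) (?I s)"
    using semigroup[of "t - u" "u - s" "?I s"] assms I by simp
  also have "S (t - u) (germ H u s) = - (H (t, s, 0) - H (t, u, 0) + H (t, u, s))"
    using H_cocycle[of 0 s u t] assms rng by (simp add: germ_def S_uminus H_mem)
  finally show ?thesis
    by (simp add: dy_R_def germ_def)
qed

text \<open>
  The value of \<open>I\<close> at the midpoint is chosen exactly so that the left child becomes the residual of
  the left half.
\<close>

lemma gen_res_left:
  assumes "k < 2 ^ n"
  shows "gen_res T S r H (Suc n) (2 * k) = snd (gen_children T S r H n k)"
proof -
  have "2 * k < 2 ^ Suc n" using assms by simp
  then have "gen_res T S r H (Suc n) (2 * k) =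
      germ H (dpt T (Suc n) (Suc (2 * k))) (dpt T n k) - lvl_I T S r H (Suc n) (Suc (2 * k)) +
      S (dpt T (Suc n) (Suc (2 * k)) - dpt T n k) (lvl_I T S r H n k)"
    using lvl_I_double[of T S r H 1 n k] by (simp add: gen_res_eq dpt_Suc_double del: lvl_I.simps)
  then show ?thesis
    by (simp add: lvl_I_midpoint[OF assms] del: lvl_I.simps)
qed

text \<open>The right child is forced by the splitting relation once the left one is known.\<close>

lemma gen_res_right:
  assumes "k < 2 ^ n"
  shows "gen_res T S r H (Suc n) (Suc (2 * k)) = fst (gen_children T S r H n k)"
proof -
  let ?a = "dpt T n k" and ?b = "dpt T (Suc n) (Suc (2 * k))" and ?c = "dpt T n (Suc k)"
  have c: "dpt T (Suc n) (Suc (Suc (2 * k))) = ?c"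
    using dpt_Suc_double[of n "Suc k"] by simp
  have "2 * k < 2 ^ Suc n" "Suc (2 * k) \<le> 2 ^ Suc n" "Suc k \<le> 2 ^ n"
    using assms by simp_all
  then have "?a \<in> dyadics T" "?b \<in> dyadics T" "?c \<in> dyadics T"
    using assms by (auto intro: dpt_dyadic)
  moreover have "?a \<le> ?b" "?b \<le> ?c"
    using T_pos by (auto simp: dpt_def field_simps)
  ultimately have "R ?c ?a = R ?c ?b + S (?c - ?b) (R ?b ?a) + H (?c, ?b, ?a)"
    by (intro R_cocycle)
  moreover have "R ?b ?a = snd (gen_children T S r H n k)"
    using gen_res_left[OF assms] by (simp add: gen_res_def dpt_Suc_double)
  moreover have "R ?c ?a = gen_res T S r H n k" "R ?c ?b = gen_res T S r H (Suc n) (Suc (2 * k))"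
    by (simp_all add: gen_res_def c)
  ultimately show ?thesis
    using split_eq[OF assms] by simp
qed

text \<open>
  The initial choice \<open>I T = B T 0\<close> makes the scalar recursion for the residuals start at zero.
\<close>

lemma gen_res_root: "gen_res T S r H 0 0 = 0"
  using T_pos by (simp add: gen_res_eq dpt_def S_0)

lemma gen_res_bound:
  assumes adm: "admissible T N S r \<gamma> \<kappa> H CH" "0 \<le> CH" "\<And>L. 0 \<le> \<kappa> L"
    and b: "\<And>n. 0 \<le> b n" "\<And>n. \<kappa> (T / 2 ^ n) * b n + (T / 2 ^ n) powr \<gamma> \<le> b (Suc n)"
  shows "k < 2 ^ n \<Longrightarrow> N (gen_res T S r H n k) \<le> CH * b n"
proof (induction n arbitrary: k)
  case 0
  then show ?case
    using assms by (simp add: gen_res_root)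
next
  case (Suc n)
  define i where "i = k div 2"
  have i: "i < 2 ^ n" and k: "k = 2 * i \<or> k = Suc (2 * i)"
    using Suc.prems by (auto simp: i_def)
  have "N (gen_res T S r H (Suc n) k)
      \<le> max (N (fst (gen_children T S r H n i))) (N (snd (gen_children T S r H n i)))"
    using k gen_res_left[OF i] gen_res_right[OF i] by auto
  also have "\<dots> \<le> \<kappa> (T / 2 ^ n) * N (gen_res T S r H n i) + CH * (T / 2 ^ n) powr \<gamma>"
    using adm(1) i by (simp add: admissible_def Let_def dpt_Suc)
  also have "\<dots> \<le> \<kappa> (T / 2 ^ n) * (CH * b n) + CH * (T / 2 ^ n) powr \<gamma>"
    using Suc.IH[OF i] adm(3) by (intro add_right_mono mult_left_mono) auto
  also have "\<dots> = CH * (\<kappa> (T / 2 ^ n) * b n + (T / 2 ^ n) powr \<gamma>)"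
    by (simp add: algebra_simps)
  also have "\<dots> \<le> CH * b (Suc n)"
    using b(2) adm(2) by (intro mult_left_mono) auto
  finally show ?case .
qed

text \<open>
  Chaining from the right end point. Every step is taken in the form in which the residual that
  remains to be estimated carries no semigroup operator, so that the bound \<open>Mb\<close> enters once per
  level instead of as a power.
\<close>

lemma chain_right:
  assumes \<beta>: "\<And>n. 0 \<le> \<beta> n" "\<And>n k. k < 2 ^ n \<Longrightarrow> N (gen_res T S r H n k) \<le> \<beta> n"
    and t: "t \<in> dyadics T" "t = dpt T m k0" and "n \<le> m"
  shows "N (R t (dpt T n (dfloor T n t))) \<le>
    (\<Sum>j=n..<m. Mb * (\<beta> (Suc j) + G * (T / 2 ^ j) powr \<gamma>))"
  using \<open>n \<le> m\<close>
proof (induction n rule: inc_induct)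
  case base
  show ?case
    using t by (simp add: dfloor_dpt[OF T_pos] R_refl)
next
  case (step n)
  have rng: "0 \<le> t" "t \<le> T" using dyadics_range[OF T_pos t(1)] by auto
  define a where "a = dpt T n (dfloor T n t)"
  define b where "b = dpt T (Suc n) (dfloor T (Suc n) t)"
  have ab: "a \<in> dyadics T" "b \<in> dyadics T"
    unfolding a_def b_def by (intro dpt_dyadic dfloor_bound T_pos rng)+
  have le: "b \<le> t" "t - a \<le> T / 2 ^ n" "0 \<le> a"
    using dfloor_le[OF T_pos rng, of "Suc n"] dfloor_gt[OF T_pos rng, of n]
      dyadics_range[OF T_pos ab(1)]
    by (auto simp: a_def b_def)
  have a': "a = dpt T (Suc n) (2 * dfloor T n t)"
    by (simp add: a_def dpt_Suc_double)
  have "a \<le> b \<and> N (R b a) \<le> \<beta> (Suc n)"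
    using dfloor_Suc[OF T_pos rng, of n]
  proof
    assume "dfloor T (Suc n) t = 2 * dfloor T n t"
    then have "b = a" by (simp add: a' b_def)
    then show ?thesis using ab \<beta> by (simp add: R_refl)
  next
    assume eq: "dfloor T (Suc n) t = Suc (2 * dfloor T n t)"
    then have "2 * dfloor T n t < 2 ^ Suc n"
      using dfloor_bound[OF T_pos rng, of "Suc n"] by simp
    moreover have "R b a = gen_res T S r H (Suc n) (2 * dfloor T n t)"
      by (simp add: gen_res_def a' b_def eq)
    moreover have "a \<le> b"
      using T_pos by (simp add: a' b_def eq dpt_Suc)
    ultimately show ?thesis using \<beta>(2) by simp
  qed
  then have Rba: "a \<le> b" "N (R b a) \<le> \<beta> (Suc n)" by auto
  have "R t a = R t b + S (t - b) (R b a) + H (t, b, a)"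
    using t ab Rba le by (intro R_cocycle) auto
  then have "N (R t a) \<le> N (R t b) + N (S (t - b) (R b a)) + N (H (t, b, a))"
    using t ab Rba le by (simp add: triangle3 R_mem maps H_mem)
  also have "N (S (t - b) (R b a)) \<le> Mb * \<beta> (Suc n)"
  proof -
    have "N (S (t - b) (R b a)) \<le> Mb * N (R b a)"
      using ab Rba rng le by (intro S_bound R_mem) auto
    also have "\<dots> \<le> Mb * \<beta> (Suc n)"
      using Rba(2) Mb_ge_1 by (intro mult_left_mono) auto
    finally show ?thesis .
  qed
  also have "N (H (t, b, a)) \<le> Mb * (G * (T / 2 ^ n) powr \<gamma>)"
  proof -
    have "N (H (t, b, a)) \<le> G * (t - a) powr \<gamma>"
      using Rba le rng by (intro H_bound) auto
    also have "\<dots> \<le> G * (T / 2 ^ n) powr \<gamma>"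
      using G_nonneg \<gamma>_pos le Rba by (intro mult_left_mono powr_mono2) auto
    also have "\<dots> \<le> Mb * (G * (T / 2 ^ n) powr \<gamma>)"
      using mult_right_mono[OF Mb_ge_1, of "G * (T / 2 ^ n) powr \<gamma>"] G_nonneg by simp
    finally show ?thesis .
  qed
  also have "N (R t b) \<le> (\<Sum>j=Suc n..<m. Mb * (\<beta> (Suc j) + G * (T / 2 ^ j) powr \<gamma>))"
    using step.IH by (simp add: b_def)
  finally show ?case
    using step.hyps by (simp add: a_def b_def sum.atLeast_Suc_lessThan algebra_simps)
qed

text \<open>
  At the left end point the semigroup acts on the part still to be estimated. Quantifying over
  the accumulated operator \<open>S v\<close> again keeps one factor \<open>Mb\<close> per level.
\<close>

lemma chain_left:
  assumes \<beta>: "\<And>n. 0 \<le> \<beta> n" "\<And>n k. k < 2 ^ n \<Longrightarrow> N (gen_res T S r H n k) \<le> \<beta> n"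
    and s: "s \<in> dyadics T" "s = dpt T m k0" and "n \<le> m"
  shows "0 \<le> v \<Longrightarrow> v + dpt T n (dceil T n s) \<le> T \<Longrightarrow>
    N (S v (R (dpt T n (dceil T n s)) s)) \<le>
    (\<Sum>j=n..<m. Mb * (\<beta> (Suc j) + G * (T / 2 ^ j) powr \<gamma>))"
  using \<open>n \<le> m\<close>
proof (induction n arbitrary: v rule: inc_induct)
  case base
  then show ?case
    using s by (simp add: dceil_dpt[OF T_pos] R_refl S_0)
next
  case (step n)
  have rng: "0 \<le> s" "s \<le> T" using dyadics_range[OF T_pos s(1)] by auto
  define a where "a = dpt T n (dceil T n s)"
  define b where "b = dpt T (Suc n) (dceil T (Suc n) s)"
  have ab: "a \<in> dyadics T" "b \<in> dyadics T"
    unfolding a_def b_def by (intro dpt_dyadic dceil_bound T_pos rng)+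
  have le: "s \<le> b" "a - s \<le> T / 2 ^ n" "a \<le> T" "s \<le> a"
    using dceil_ge[OF T_pos rng, of "Suc n"] dceil_lt[OF T_pos rng, of n]
      dyadics_range[OF T_pos ab(1)] dceil_ge[OF T_pos rng, of n]
    by (auto simp: a_def b_def)
  have va: "0 \<le> v" "v + a \<le> T" using step.prems by (auto simp: a_def)
  have a': "a = dpt T (Suc n) (2 * dceil T n s)"
    by (simp add: a_def dpt_Suc_double)
  have "b \<le> a \<and> N (R a b) \<le> \<beta> (Suc n)"
    using dceil_Suc[OF T_pos rng, of n]
  proof
    assume "dceil T (Suc n) s = 2 * dceil T n s"
    then have "b = a" by (simp add: a' b_def)
    then show ?thesis using ab \<beta> by (simp add: R_refl)
  next
    assume eq: "Suc (dceil T (Suc n) s) = 2 * dceil T n s"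
    then have "dceil T (Suc n) s < 2 ^ Suc n"
      using dceil_bound[OF T_pos rng, of n] by simp
    moreover have "R a b = gen_res T S r H (Suc n) (dceil T (Suc n) s)"
      by (simp add: gen_res_def a' b_def eq)
    moreover have "b \<le> a"
      using T_pos by (simp add: a' b_def dpt_Suc flip: eq)
    ultimately show ?thesis using \<beta>(2) by simp
  qed
  then have Rab: "b \<le> a" "N (R a b) \<le> \<beta> (Suc n)" by auto
  have "R a s = R a b + S (a - b) (R b s) + H (a, b, s)"
    using s ab Rab le by (intro R_cocycle) auto
  then have "S v (R a s) = S v (R a b) + S (v + (a - b)) (R b s) + S v (H (a, b, s))"
    using s ab Rab le va by (simp add: add semigroup R_mem maps H_mem add_mem)
  then have "N (S v (R a s)) \<le>
      N (S v (R a b)) + N (S (v + (a - b)) (R b s)) + N (S v (H (a, b, s)))"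
    using s ab Rab le va by (simp add: triangle3 R_mem maps H_mem)
  also have "N (S v (R a b)) \<le> Mb * \<beta> (Suc n)"
  proof -
    have "N (S v (R a b)) \<le> Mb * N (R a b)"
      using ab Rab rng le va by (intro S_bound R_mem) auto
    also have "\<dots> \<le> Mb * \<beta> (Suc n)"
      using Rab(2) Mb_ge_1 by (intro mult_left_mono) auto
    finally show ?thesis .
  qed
  also have "N (S v (H (a, b, s))) \<le> Mb * (G * (T / 2 ^ n) powr \<gamma>)"
  proof -
    have "N (S v (H (a, b, s))) \<le> Mb * N (H (a, b, s))"
      using va le rng by (intro S_bound H_mem) auto
    also have "N (H (a, b, s)) \<le> G * (a - s) powr \<gamma>"
      using Rab le rng by (intro H_bound) auto
    also have "\<dots> \<le> G * (T / 2 ^ n) powr \<gamma>"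
      using G_nonneg \<gamma>_pos le Rab by (intro mult_left_mono powr_mono2) auto
    finally show ?thesis using Mb_ge_1 by simp
  qed
  also have "N (S (v + (a - b)) (R b s)) \<le>
      (\<Sum>j=Suc n..<m. Mb * (\<beta> (Suc j) + G * (T / 2 ^ j) powr \<gamma>))"
    using step.IH[of "v + (a - b)"] va Rab by (simp add: b_def)
  finally show ?case
    using step.hyps by (simp add: a_def b_def sum.atLeast_Suc_lessThan algebra_simps)
qed

text \<open>
  An increment of length comparable to the mesh of level \<open>n\<close> is at most one grid interval of that
  level plus the two end pieces.
\<close>

lemma chain:
  assumes \<beta>: "\<And>n. 0 \<le> \<beta> n" "\<And>n k. k < 2 ^ n \<Longrightarrow> N (gen_res T S r H n k) \<le> \<beta> n"
    and s: "s \<in> dyadics T" and t: "t \<in> dyadics T" and "s < t"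
    and n: "T / 2 ^ n \<le> t - s" "t - s < 2 * T / 2 ^ n"
    and \<Sigma>: "\<And>m. (\<Sum>j=n..<m. \<beta> (Suc j) + G * (T / 2 ^ j) powr \<gamma>) \<le> \<Sigma>"
  shows "N (R t s) \<le> Mb\<^sup>2 * (2 * \<Sigma> + \<beta> n + 2 * G * (t - s) powr \<gamma>)"
proof -
  have rng: "0 \<le> s" "s \<le> T" "0 \<le> t" "t \<le> T"
    using dyadics_range[OF T_pos] s t by auto
  obtain ns where ns: "\<forall>n\<ge>ns. \<exists>k\<le>2 ^ n. s = dpt T n k" using dyadics_level[OF s] by blast
  obtain nt where nt: "\<forall>n\<ge>nt. \<exists>k\<le>2 ^ n. t = dpt T n k" using dyadics_level[OF t] by blast
  define m where "m = max n (max ns nt)"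
  have m: "n \<le> m" "ns \<le> m" "nt \<le> m" by (auto simp: m_def)
  obtain ks kt where ks: "s = dpt T m ks" and kt: "t = dpt T m kt"
    using ns nt m by blast
  have sums: "(\<Sum>j=n..<m. Mb * (\<beta> (Suc j) + G * (T / 2 ^ j) powr \<gamma>)) \<le> Mb * \<Sigma>"
    using \<Sigma>[of m] Mb_ge_1 by (simp add: mult_left_mono flip: sum_distrib_left)
  define a where "a = dpt T n (dceil T n s)"
  define b where "b = dpt T n (dfloor T n t)"
  have ab: "a \<in> dyadics T" "b \<in> dyadics T"
    unfolding a_def b_def by (intro dpt_dyadic dceil_bound dfloor_bound T_pos rng)+
  have le: "s \<le> a" "b \<le> t"
    unfolding a_def b_def using dceil_ge[OF T_pos] dfloor_le[OF T_pos] rng by auto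
  have "a \<le> b \<and> N (R b a) \<le> \<beta> n"
    using dceil_dfloor[OF T_pos rng(1,4) _ n, simplified, OF \<open>s < t\<close>]
  proof (elim disjE)
    assume "dfloor T n t = dceil T n s"
    then show ?thesis using ab \<beta>(1)[of n] by (simp add: a_def b_def R_refl)
  next
    assume eq: "dfloor T n t = Suc (dceil T n s)"
    then have "dceil T n s < 2 ^ n"
      using dfloor_bound[OF T_pos rng(3,4), of n] by simp
    moreover have "R b a = gen_res T S r H n (dceil T n s)"
      by (simp add: gen_res_def a_def b_def eq)
    moreover have "a \<le> b"
      using T_pos by (simp add: a_def b_def eq dpt_Suc)
    ultimately show ?thesis using \<beta>(2) by simp
  qed
  then have Rba: "a \<le> b" "N (R b a) \<le> \<beta> n" by auto
  have Hle: "N (H (x, u, s)) \<le> G * (t - s) powr \<gamma>" if "s \<le> u" "u \<le> x" "x \<le> t" for x u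
  proof -
    have "N (H (x, u, s)) \<le> G * (x - s) powr \<gamma>"
      using that rng by (intro H_bound) auto
    also have "\<dots> \<le> G * (t - s) powr \<gamma>"
      using G_nonneg \<gamma>_pos that by (intro mult_left_mono powr_mono2) auto
    finally show ?thesis .
  qed
  have "N (R b s) \<le> N (R b a) + N (S (b - a) (R a s)) + N (H (b, a, s))"
    using R_cocycle[OF ab(2,1) s le(1) Rba(1)] ab s le Rba
    by (simp add: triangle3 R_mem maps H_mem)
  also have "N (S (b - a) (R a s)) \<le> Mb * \<Sigma>"
    unfolding a_def
    by (rule order_trans[OF chain_left[OF \<beta> s ks m(1)] sums])
      (use Rba le rng in \<open>auto simp: a_def\<close>)
  also have "N (H (b, a, s)) \<le> G * (t - s) powr \<gamma>"
    using le Rba by (intro Hle) auto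
  finally have 1: "N (R b s) \<le> \<beta> n + Mb * \<Sigma> + G * (t - s) powr \<gamma>"
    using Rba(2) by simp
  have "N (R t s) \<le> N (R t b) + N (S (t - b) (R b s)) + N (H (t, b, s))"
    using R_cocycle[OF t ab(2) s] ab s t le Rba
    by (simp add: triangle3 R_mem maps H_mem)
  also have "N (R t b) \<le> Mb * \<Sigma>"
    unfolding b_def using chain_right[OF \<beta> t kt m(1)] sums by simp
  also have "N (S (t - b) (R b s)) \<le> Mb * N (R b s)"
    using ab s le Rba rng by (intro S_bound R_mem) auto
  also have "N (H (t, b, s)) \<le> G * (t - s) powr \<gamma>"
    using le Rba by (intro Hle) auto
  finally have 2: "N (R t s) \<le> Mb * \<Sigma> + Mb * N (R b s) + G * (t - s) powr \<gamma>"
    by simp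
  \<comment> \<open>Splitting off both ends nests two operators, hence the square of \<open>Mb\<close>.\<close>
  have MbN: "Mb * N (R b s) \<le> Mb * (\<beta> n + Mb * \<Sigma> + G * (t - s) powr \<gamma>)"
    using 1 Mb_ge_1 by (intro mult_left_mono) auto
  have \<Sigma>0: "0 \<le> \<Sigma>" using \<Sigma>[of n] by simp
  have Mb2: "1 \<le> Mb\<^sup>2" "Mb \<le> Mb\<^sup>2"
    using Mb_ge_1 by (auto intro: one_le_power self_le_power)
  have g0: "0 \<le> G * (t - s) powr \<gamma>"
    using G_nonneg by simp
  have "N (R t s) \<le> Mb * \<Sigma> + Mb\<^sup>2 * \<Sigma> + Mb * \<beta> n + Mb * (G * (t - s) powr \<gamma>)
      + G * (t - s) powr \<gamma>"
    using 2 MbN by (simp add: algebra_simps power2_eq_square)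
  also have "\<dots> \<le> Mb\<^sup>2 * \<Sigma> + Mb\<^sup>2 * \<Sigma> + Mb\<^sup>2 * \<beta> n + Mb\<^sup>2 * (G * (t - s) powr \<gamma>)
      + Mb\<^sup>2 * (G * (t - s) powr \<gamma>)"
    using mult_right_mono[OF Mb2(2) \<Sigma>0] mult_right_mono[OF Mb2(2) \<beta>(1)[of n]]
      mult_right_mono[OF Mb2(2) g0] mult_right_mono[OF Mb2(1) g0]
    by linarith
  finally show ?thesis
    by (simp add: algebra_simps)
qed

end

text \<open>
  The constant depends on the defect only through \<open>CH\<close> and its norm, which is what makes the
  moment bounds pathwise consequences.
\<close>

theorem (in evolution) dyadic_residual_bound:
  assumes adm: "admissible_factor \<gamma> \<kappa>" and "0 < \<gamma>"
  shows "\<exists>C>0. \<forall>r H CH s t. H \<in> ZC T X N S \<gamma> \<longrightarrow> recursion_ok T X S r H \<longrightarrow>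
    admissible T N S r \<gamma> \<kappa> H CH \<longrightarrow> 0 \<le> CH \<longrightarrow>
    s \<in> dyadics T \<longrightarrow> t \<in> dyadics T \<longrightarrow> s < t \<longrightarrow>
    N (dy_R T S r H t s) \<le> C * (enn2real (hnorm3 T X N \<gamma> H) + CH) * modulus \<gamma> (t - s)"
proof -
  obtain K b where K: "0 \<le> K" "\<And>n. 0 \<le> b n" "\<And>n. b n \<le> K * level_size \<gamma> n"
    "\<And>n. \<kappa> (T / 2 ^ n) * b n + (T / 2 ^ n) powr \<gamma> \<le> b (Suc n)"
    using level_profile[OF adm T_pos \<open>0 < \<gamma>\<close>] by blast
  obtain K' where K': "0 < K'" "\<And>n d. 0 < d \<Longrightarrow> T / 2 ^ n \<le> d \<Longrightarrow> d < 2 * T / 2 ^ n \<Longrightarrow>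
      level_size \<gamma> n \<le> K' * modulus \<gamma> d"
    using level_size_le_modulus[OF T_pos \<open>0 < \<gamma>\<close>] by blast
  define K1 where "K1 = K * level_size \<gamma> 1 + T powr \<gamma>"
  define E where "E = suminf (level_size \<gamma>)"
  have K1: "0 < K1"
    using K(1) T_pos level_size_nonneg[of \<gamma> 1] by (simp add: K1_def add_nonneg_pos)
  have E: "0 \<le> E"
    unfolding E_def by (intro suminf_nonneg summable_level_size \<open>0 < \<gamma>\<close> level_size_nonneg)
  define K2 where "K2 = 2 * (K1 * E) + K + 2 * (2 powr \<gamma> * T powr \<gamma>)"
  have K2: "0 < K2"
    using K(1) K1 E T_pos by (simp add: K2_def add_nonneg_pos)
  define C where "C = Mb\<^sup>2 * K2 * K'"
  have C: "0 < C"
    using K2 K' Mb_ge_1 by (simp add: C_def)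
  have "N (dy_R T S r H t s) \<le> C * (enn2real (hnorm3 T X N \<gamma> H) + CH) * modulus \<gamma> (t - s)"
    if H: "H \<in> ZC T X N S \<gamma>" "recursion_ok T X S r H" "admissible T N S r \<gamma> \<kappa> H CH" "0 \<le> CH"
      and st: "s \<in> dyadics T" "t \<in> dyadics T" "s < t" for r H CH s t
  proof -
    interpret sewing_defect X N S T Mb r H \<gamma>
      by unfold_locales (use H \<open>0 < \<gamma>\<close> in auto)
    define D where "D = G + CH"
    have D: "0 \<le> D" "G \<le> D" "CH \<le> D" using G_nonneg H(4) by (auto simp: D_def)
    obtain n where n: "T / 2 ^ n \<le> t - s" "t - s < 2 * T / 2 ^ n"
      using level_of_length[of "t - s" T] st dyadics_range[OF T_pos st(1)]
        dyadics_range[OF T_pos st(2)] by auto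
    let ?l = "level_size \<gamma>"
    define \<beta> where "\<beta> n = CH * b n" for n
    have \<beta>0: "0 \<le> \<beta> n" for n using H(4) K(2) by (simp add: \<beta>_def)
    have \<beta>: "N (gen_res T S r H n k) \<le> \<beta> n" if "k < 2 ^ n" for n k
      unfolding \<beta>_def
      using gen_res_bound[OF H(3,4) admissible_factor_nonneg[OF adm] K(2,4) that] .
    have \<beta>K: "\<beta> n \<le> D * (K * ?l n)" for n
      unfolding \<beta>_def using D K H(4) by (intro mult_mono) auto
    have \<Sigma>: "(\<Sum>j=n..<m. \<beta> (Suc j) + G * (T / 2 ^ j) powr \<gamma>) \<le> D * (K1 * E) * ?l n" for m
    proof -
      have "\<beta> (Suc j) + G * (T / 2 ^ j) powr \<gamma> \<le> D * K1 * ?l j" for j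
      proof -
        have "\<beta> (Suc j) \<le> D * (K * (?l j * ?l 1))"
          using level_size_add[of \<gamma> j 1] D K(1)
          by (intro order_trans[OF \<beta>K]) (auto intro!: mult_left_mono)
        moreover have "G * (T / 2 ^ j) powr \<gamma> \<le> D * (T powr \<gamma> * ?l j)"
          using D powr_grid_le[OF T_pos] by (intro mult_mono) auto
        ultimately show ?thesis by (simp add: K1_def algebra_simps)
      qed
      then have "(\<Sum>j=n..<m. \<beta> (Suc j) + G * (T / 2 ^ j) powr \<gamma>) \<le> D * K1 * (\<Sum>j=n..<m. ?l j)"
        unfolding sum_distrib_left by (intro sum_mono)
      also have "\<dots> \<le> D * K1 * (E * ?l n)"
        unfolding E_def using D K1 by (intro mult_left_mono level_size_tail \<open>0 < \<gamma>\<close>) auto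
      finally show ?thesis by (simp add: mult_ac)
    qed
    have tail: "G * (t - s) powr \<gamma> \<le> D * (2 powr \<gamma> * T powr \<gamma> * ?l n)"
    proof -
      have "(t - s) powr \<gamma> \<le> (2 * (T / 2 ^ n)) powr \<gamma>"
        using n st \<open>0 < \<gamma>\<close> by (intro powr_mono2) auto
      also have "\<dots> = 2 powr \<gamma> * (T / 2 ^ n) powr \<gamma>"
        using T_pos powr_mult[of 2 "T / 2 ^ n" \<gamma>] by simp
      also have "\<dots> \<le> 2 powr \<gamma> * (T powr \<gamma> * ?l n)"
        by (intro mult_left_mono powr_grid_le T_pos) auto
      finally show ?thesis
        using D by (intro mult_mono) (auto simp: mult.assoc)
    qed
    have "N (dy_R T S r H t s) \<le>
        Mb\<^sup>2 * (2 * (D * (K1 * E) * ?l n) + \<beta> n + 2 * G * (t - s) powr \<gamma>)"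
      by (rule chain[OF \<beta>0 \<beta> st n \<Sigma>])
    also have "\<dots> \<le> Mb\<^sup>2 * (2 * (D * (K1 * E) * ?l n) + D * (K * ?l n)
        + 2 * (D * (2 powr \<gamma> * T powr \<gamma> * ?l n)))"
      using \<beta>K[of n] tail by (intro mult_left_mono) (linarith, simp)
    also have "\<dots> = Mb\<^sup>2 * K2 * D * ?l n"
      by (simp add: K2_def algebra_simps)
    also have "\<dots> \<le> Mb\<^sup>2 * K2 * D * (K' * modulus \<gamma> (t - s))"
      using K'(2)[OF _ n] st K2 D by (intro mult_left_mono) auto
    finally show ?thesis
      by (simp add: C_def D_def G_def mult_ac)
  qed
  with C show ?thesis by blast
qed


section \<open>Extension to the simplex\<close>

lemma compact_simp3: "compact (simp3 T)"
proof -
  have "simp3 T = ({0..T} \<times> ({0..T} \<times> {0..T})) \<inter>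
      ({x. snd (snd x) \<le> fst (snd x)} \<inter> {x. fst (snd x) \<le> fst x})"
    by (auto simp: simp3_def)
  moreover have "compact ({0..T} \<times> ({0..T} \<times> {0..T}))"
    by (intro compact_Times compact_Icc)
  moreover have "closed ({x. snd (snd x) \<le> fst (snd x)} \<inter> {x :: real \<times> real \<times> real. fst (snd x) \<le> fst x})"
    by (intro closed_Int closed_Collect_le continuous_intros)
  ultimately show ?thesis
    by (simp only: compact_Int_closed)
qed

text \<open>The canonical dyadic approximation from below; it preserves the order of its arguments.\<close>

abbreviation dyf :: "real \<Rightarrow> nat \<Rightarrow> real \<Rightarrow> real" where
  "dyf T n t \<equiv> dpt T n (dfloor T n t)"

lemma dyf_dyadic: "0 < T \<Longrightarrow> 0 \<le> t \<Longrightarrow> t \<le> T \<Longrightarrow> dyf T n t \<in> dyadics T"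
  by (intro dpt_dyadic dfloor_bound)

lemma dyf_mono: "0 < T \<Longrightarrow> s \<le> t \<Longrightarrow> dyf T n s \<le> dyf T n t"
  by (intro dpt_mono dfloor_mono) auto

lemma dyf_eventually:
  assumes "0 < T" "t \<in> dyadics T"
  shows "\<forall>\<^sub>F n in sequentially. dyf T n t = t"
proof -
  obtain n0 where "\<forall>n\<ge>n0. \<exists>k\<le>2 ^ n. t = dpt T n k"
    using dyadics_level[OF assms(2)] by blast
  then have "\<forall>n\<ge>n0. dyf T n t = t"
    using dfloor_dpt[OF assms(1)] by metis
  then show ?thesis
    unfolding eventually_sequentially by blast
qed

context evolution
begin

lemma is_sewing_tends:
  assumes "is_sewing T X N S r H R" "(t, s) \<in> simp2 T"
  shows "tends (\<lambda>n. dy_R T S r H (dyf T n t) (dyf T n s)) (R (t, s))"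
proof -
  have rng: "0 \<le> s" "s \<le> t" "t \<le> T" using assms(2) by (auto simp: simp2_def)
  have dy: "dyf T n t \<in> dyadics T" "dyf T n s \<in> dyadics T" "dyf T n s \<le> dyf T n t" for n
    using rng T_pos by (auto intro: dyf_dyadic dyf_mono)
  have "tends (\<lambda>n. R (dyf T n t, dyf T n s)) (R (t, s))"
  proof (rule continuous_map_tends[where D = "simp2 T"])
    show "continuous_map (top_of_set (simp2 T)) (ntop X N) R"
      using assms(1) by (simp add: is_sewing_def cont_maps_def)
    show "(dyf T n t, dyf T n s) \<in> simp2 T" for n
      using dy dyadics_range[OF T_pos] by (auto simp: simp2_def)
    show "(\<lambda>n. (dyf T n t, dyf T n s)) \<longlonglongrightarrow> (t, s)"
      using rng by (intro tendsto_Pair dfloor_tendsto T_pos) auto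
  qed (rule assms(2))
  moreover have "R (dyf T n t, dyf T n s) = dy_R T S r H (dyf T n t) (dyf T n s)" for n
    using assms(1) dy by (simp add: is_sewing_def)
  ultimately show ?thesis by simp
qed

lemma is_sewing_unique:
  assumes "is_sewing T X N S r H R" "is_sewing T X N S r H R'"
  shows "R = R'"
proof
  fix x :: "real \<times> real"
  show "R x = R' x"
  proof (cases "x \<in> simp2 T")
    case True
    obtain t s where x: "x = (t, s)" by (cases x)
    show ?thesis
      using is_sewing_tends[OF assms(1)] is_sewing_tends[OF assms(2)] True tends_unique
      unfolding x by blast
  next
    case False
    then show ?thesis
      using assms by (simp add: is_sewing_def cont_maps_def del: split_paired_All)
  qed
qed

lemma sewing_eq: "is_sewing T X N S r H R \<Longrightarrow> sewing T X N S r H = R"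
  unfolding sewing_def by (blast intro: the_equality is_sewing_unique)

end

text \<open>
  What the extension to the simplex consumes: the bound on dyadic residuals, in whatever way it was
  obtained, and the residual continuity criterion.
\<close>

locale sewable_defect = sewing_defect X N S T Mb r H \<gamma>
  for X :: "'a::real_vector set" and N S T Mb r H \<gamma> +
  fixes D :: real
  assumes res_cont: "residual_continuity T N S r H"
    and R_bound: "s \<in> dyadics T \<Longrightarrow> t \<in> dyadics T \<Longrightarrow> s < t \<Longrightarrow>
      N (dy_R T S r H t s) \<le> D * modulus \<gamma> (t - s)"
    and D_nonneg: "0 \<le> D"
begin

lemma H_small:
  assumes "0 < e"
  shows "\<exists>d>0. \<forall>s u t. 0 \<le> s \<longrightarrow> s \<le> u \<longrightarrow> u \<le> t \<longrightarrow> t \<le> T \<longrightarrow> t - u < d \<or> u - s < d \<longrightarrow>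
    N (H (t, u, s)) < e"
proof -
  have "uniformly_continuous_on (simp3 T) (\<lambda>x. N (H x))"
    using H_cont
    by (intro compact_uniformly_continuous continuous_on_norm compact_simp3)
      (simp add: cont_maps_def)
  then obtain d where d: "d > 0"
    "\<And>x y. x \<in> simp3 T \<Longrightarrow> y \<in> simp3 T \<Longrightarrow> dist y x < d \<Longrightarrow> dist (N (H y)) (N (H x)) < e"
    using \<open>0 < e\<close> unfolding uniformly_continuous_on_def by metis
  have "N (H (t, u, s)) < e"
    if "0 \<le> s" "s \<le> u" "u \<le> t" "t \<le> T" "t - u < d \<or> u - s < d" for s u t
    using that(5)
  proof
    assume "t - u < d"
    then have "dist (N (H (t, u, s))) (N (H (u, u, s))) < e"
      using that by (intro d(2)) (auto simp: simp3_def dist_Pair_Pair dist_real_def)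
    moreover have "H (u, u, s) = 0"
      using that by (intro H_face) auto
    ultimately show ?thesis by (simp add: dist_real_def)
  next
    assume "u - s < d"
    then have "dist (N (H (t, u, s))) (N (H (t, s, s))) < e"
      using that by (intro d(2)) (auto simp: simp3_def dist_Pair_Pair dist_real_def)
    moreover have "H (t, s, s) = 0"
      using that by (intro H_face) auto
    ultimately show ?thesis by (simp add: dist_real_def)
  qed
  with \<open>d > 0\<close> show ?thesis by blast
qed

lemma residual_small:
  assumes "0 < e"
  shows "\<exists>d>0. \<forall>h s t. 0 < h \<longrightarrow> h < d \<longrightarrow> s \<in> dyadics T \<longrightarrow> t \<in> dyadics T \<longrightarrow> s \<le> t \<longrightarrow>
    t + h \<le> T \<longrightarrow> N (S h (R t s) - R t s) < e"
proof -
  let ?A = "\<lambda>h. {(t, s). s \<in> dyadics T \<and> t \<in> dyadics T \<and> s \<le> t \<and> t + h \<le> T}"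
  have "\<forall>\<^sub>F h in at_right 0. (SUP (t, s)\<in>?A h. ennreal (N (S h (R t s) - R t s))) < ennreal e"
    using res_cont \<open>0 < e\<close> unfolding residual_continuity_def
    by (intro order_tendstoD(2)) auto
  then obtain d where d: "d > 0"
    "\<And>h. 0 < h \<Longrightarrow> h < d \<Longrightarrow> (SUP (t, s)\<in>?A h. ennreal (N (S h (R t s) - R t s))) < ennreal e"
    unfolding eventually_at_right_field by auto
  have "N (S h (R t s) - R t s) < e"
    if h: "0 < h" "h < d" and st: "s \<in> dyadics T" "t \<in> dyadics T" "s \<le> t" "t + h \<le> T" for h s t
  proof -
    have "ennreal (N (S h (R t s) - R t s)) \<le>
        (SUP (t, s)\<in>?A h. ennreal (N (S h (R t s) - R t s)))"
      by (rule SUP_upper2[of "(t, s)"]) (use st in auto)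
    also note d(2)[OF h]
    finally show ?thesis
      using h st by (subst (asm) ennreal_less_iff) (auto intro!: nonneg diff_mem maps R_mem)
  qed
  with \<open>d > 0\<close> show ?thesis by blast
qed

lemma D_modulus_small:
  assumes "0 < e"
  shows "\<exists>d>0. \<forall>h. 0 \<le> h \<longrightarrow> h < d \<longrightarrow> D * modulus \<gamma> h < e"
proof -
  obtain d where d: "d > 0" "\<And>h. 0 \<le> h \<Longrightarrow> h < d \<Longrightarrow> modulus \<gamma> h < e / (D + 1)"
    using modulus_small[OF \<gamma>_pos, of "e / (D + 1)"] assms D_nonneg by auto
  have "D * modulus \<gamma> h < e" if "0 \<le> h" "h < d" for h
  proof -
    have "D * modulus \<gamma> h \<le> (D + 1) * modulus \<gamma> h"
      by (intro mult_right_mono modulus_nonneg) auto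
    also have "\<dots> < e"
      using d(2)[OF that] D_nonneg by (simp add: pos_less_divide_eq mult.commute)
    finally show ?thesis .
  qed
  with d(1) show ?thesis by blast
qed

lemma R_bound': "s \<in> dyadics T \<Longrightarrow> t \<in> dyadics T \<Longrightarrow> s \<le> t \<Longrightarrow> N (R t s) \<le> D * modulus \<gamma> (t - s)"
  using R_bound[of s t] D_nonneg modulus_nonneg[of \<gamma> 0] by (cases "s = t") (auto simp: R_refl)

text \<open>
  This is where residual continuity enters: moving the upper end point by \<open>h\<close> replaces \<open>R t s\<close> by
  \<open>S h (R t s)\<close>, and strong continuity alone does not make the difference small uniformly over all
  residuals.
\<close>

lemma R_upper:
  assumes "0 < e"
  shows "\<exists>d>0. \<forall>s t t'. s \<in> dyadics T \<longrightarrow> t \<in> dyadics T \<longrightarrow> t' \<in> dyadics T \<longrightarrow> s \<le> t \<longrightarrow> t \<le> t' \<longrightarrow>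
    t' - t < d \<longrightarrow> N (R t' s - R t s) < e"
proof -
  have e3: "0 < e / 3" using assms by simp
  obtain d1 where d1: "d1 > 0" "\<And>h. 0 \<le> h \<Longrightarrow> h < d1 \<Longrightarrow> D * modulus \<gamma> h < e / 3"
    using D_modulus_small[OF e3] by blast
  obtain d2 where d2: "d2 > 0" "\<And>h s t. 0 < h \<Longrightarrow> h < d2 \<Longrightarrow> s \<in> dyadics T \<Longrightarrow> t \<in> dyadics T \<Longrightarrow>
      s \<le> t \<Longrightarrow> t + h \<le> T \<Longrightarrow> N (S h (R t s) - R t s) < e / 3"
    using residual_small[OF e3] by blast
  obtain d3 where d3: "d3 > 0" "\<And>s u t. 0 \<le> s \<Longrightarrow> s \<le> u \<Longrightarrow> u \<le> t \<Longrightarrow> t \<le> T \<Longrightarrow>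
      t - u < d3 \<or> u - s < d3 \<Longrightarrow> N (H (t, u, s)) < e / 3"
    using H_small[OF e3] by blast
  define d where "d = min d1 (min d2 d3)"
  have "N (R t' s - R t s) < e"
    if dy: "s \<in> dyadics T" "t \<in> dyadics T" "t' \<in> dyadics T" and le: "s \<le> t" "t \<le> t'" "t' - t < d"
    for s t t'
  proof (cases "t = t'")
    case True
    then show ?thesis using assms by simp
  next
    case False
    have rng: "0 \<le> s" "t' \<le> T" using dyadics_range[OF T_pos] dy by auto
    have eq: "R t' s - R t s = R t' t + (S (t' - t) (R t s) - R t s) + H (t', t, s)"
      using R_cocycle[of t' t s] dy le by simp
    have "N (R t' s - R t s) \<le>
        N (R t' t) + N (S (t' - t) (R t s) - R t s) + N (H (t', t, s))"
      unfolding eq using dy le by (intro triangle3 R_mem maps H_mem diff_mem) auto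
    moreover have "N (R t' t) < e / 3"
      using R_bound'[of t t'] d1(2)[of "t' - t"] dy le by (auto simp: d_def)
    moreover have "N (S (t' - t) (R t s) - R t s) < e / 3"
      using False dy le rng by (intro d2(2)) (auto simp: d_def)
    moreover have "N (H (t', t, s)) < e / 3"
      using le rng by (intro d3(2)) (auto simp: d_def)
    ultimately show ?thesis by linarith
  qed
  moreover have "d > 0" using d1 d2 d3 by (simp add: d_def)
  ultimately show ?thesis by blast
qed

lemma R_lower:
  assumes "0 < e"
  shows "\<exists>d>0. \<forall>s s' t. s \<in> dyadics T \<longrightarrow> s' \<in> dyadics T \<longrightarrow> t \<in> dyadics T \<longrightarrow> s \<le> s' \<longrightarrow> s' \<le> t \<longrightarrow>
    s' - s < d \<longrightarrow> N (R t s - R t s') < e"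
proof -
  have e2: "0 < e / (2 * Mb)" "0 < e / 2" using assms Mb_ge_1 by simp_all
  obtain d1 where d1: "d1 > 0" "\<And>h. 0 \<le> h \<Longrightarrow> h < d1 \<Longrightarrow> D * modulus \<gamma> h < e / (2 * Mb)"
    using D_modulus_small[OF e2(1)] by blast
  obtain d3 where d3: "d3 > 0" "\<And>s u t. 0 \<le> s \<Longrightarrow> s \<le> u \<Longrightarrow> u \<le> t \<Longrightarrow> t \<le> T \<Longrightarrow>
      t - u < d3 \<or> u - s < d3 \<Longrightarrow> N (H (t, u, s)) < e / 2"
    using H_small[OF e2(2)] by blast
  define d where "d = min d1 d3"
  have "N (R t s - R t s') < e"
    if dy: "s \<in> dyadics T" "s' \<in> dyadics T" "t \<in> dyadics T" and le: "s \<le> s'" "s' \<le> t" "s' - s < d"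
    for s s' t
  proof -
    have rng: "0 \<le> s" "t \<le> T" using dyadics_range[OF T_pos] dy by auto
    have eq: "R t s - R t s' = S (t - s') (R s' s) + H (t, s', s)"
      using R_cocycle[of t s' s] dy le by simp
    have "N (R t s - R t s') \<le> N (S (t - s') (R s' s)) + N (H (t, s', s))"
      unfolding eq using dy le by (intro triangle R_mem maps H_mem) auto
    moreover have "N (S (t - s') (R s' s)) \<le> Mb * N (R s' s)"
      using dy le rng by (intro S_bound R_mem) auto
    moreover have "N (R s' s) < e / (2 * Mb)"
      using R_bound'[of s s'] d1(2)[of "s' - s"] dy le by (auto simp: d_def)
    then have "Mb * N (R s' s) < e / 2"
      using Mb_ge_1 by (simp add: field_simps)
    moreover have "N (H (t, s', s)) < e / 2"
      using le rng by (intro d3(2)) (auto simp: d_def)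
    ultimately show ?thesis by linarith
  qed
  moreover have "d > 0" using d1 d3 by (simp add: d_def)
  ultimately show ?thesis by blast
qed

lemma R_uniformly_continuous:
  assumes "0 < e"
  shows "\<exists>d>0. \<forall>s t s' t'. s \<in> dyadics T \<longrightarrow> t \<in> dyadics T \<longrightarrow> s' \<in> dyadics T \<longrightarrow> t' \<in> dyadics T \<longrightarrow>
    s \<le> t \<longrightarrow> s' \<le> t' \<longrightarrow> \<bar>t - t'\<bar> < d \<longrightarrow> \<bar>s - s'\<bar> < d \<longrightarrow> N (R t s - R t' s') < e"
proof -
  have e4: "0 < e / 4" using assms by simp
  obtain d1 where d1: "d1 > 0" "\<And>s t t'. s \<in> dyadics T \<Longrightarrow> t \<in> dyadics T \<Longrightarrow> t' \<in> dyadics T \<Longrightarrow>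
      s \<le> t \<Longrightarrow> t \<le> t' \<Longrightarrow> t' - t < d1 \<Longrightarrow> N (R t' s - R t s) < e / 4"
    using R_upper[OF e4] by blast
  obtain d2 where d2: "d2 > 0" "\<And>s s' t. s \<in> dyadics T \<Longrightarrow> s' \<in> dyadics T \<Longrightarrow> t \<in> dyadics T \<Longrightarrow>
      s \<le> s' \<Longrightarrow> s' \<le> t \<Longrightarrow> s' - s < d2 \<Longrightarrow> N (R t s - R t s') < e / 4"
    using R_lower[OF e4] by blast
  define d where "d = min d1 d2"
  have half: "N (R t' s' - R t s) < e / 2"
    if dy: "s \<in> dyadics T" "t \<in> dyadics T" "s' \<in> dyadics T" "t' \<in> dyadics T"
      and le: "s' \<le> s" "s \<le> t" "t \<le> t'" "t' - t < d" "s - s' < d" for s t s' t'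
  proof -
    have "N (R t' s' - R t s) \<le> N (R t' s' - R t' s) + N (R t' s - R t s)"
      using dy le by (intro triangle_via R_mem) auto
    moreover have "N (R t' s' - R t' s) < e / 4"
      by (rule d2(2)) (use dy le in \<open>auto simp: d_def\<close>)
    moreover have "N (R t' s - R t s) < e / 4"
      by (rule d1(2)) (use dy le in \<open>auto simp: d_def\<close>)
    ultimately show ?thesis by linarith
  qed
  have "N (R t s - R t' s') < e"
    if dy: "s \<in> dyadics T" "t \<in> dyadics T" "s' \<in> dyadics T" "t' \<in> dyadics T"
      and le: "s \<le> t" "s' \<le> t'" "\<bar>t - t'\<bar> < d" "\<bar>s - s'\<bar> < d" for s t s' t'
  proof -
    \<comment> \<open>The enclosing interval keeps both comparisons inside the simplex.\<close>
    let ?t = "max t t'" and ?s = "min s s'"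
    have m: "?t \<in> dyadics T" "?s \<in> dyadics T" using dy by (auto simp: max_def min_def)
    have "N (R ?t ?s - R t s) < e / 2"
      by (rule half) (use dy m le in auto)
    moreover have "N (R ?t ?s - R t' s') < e / 2"
      by (rule half) (use dy m le in auto)
    moreover have "N (R t s - R t' s') \<le> N (R t s - R ?t ?s) + N (R ?t ?s - R t' s')"
      using dy m le by (intro triangle_via R_mem) auto
    moreover have "N (R t s - R ?t ?s) = N (R ?t ?s - R t s)"
      using dy m le by (intro N_diff_commute R_mem) auto
    ultimately show ?thesis by linarith
  qed
  moreover have "d > 0" using d1 d2 by (simp add: d_def)
  ultimately show ?thesis by blast
qed

definition ext :: "real \<times> real \<Rightarrow> 'a" where
  "ext = (\<lambda>(t, s). if (t, s) \<in> simp2 T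
    then (SOME l. tends (\<lambda>n. R (dyf T n t) (dyf T n s)) l) else 0)"

lemma dyf_facts:
  assumes "(t, s) \<in> simp2 T"
  shows "dyf T n t \<in> dyadics T" "dyf T n s \<in> dyadics T" "dyf T n s \<le> dyf T n t"
    "R (dyf T n t) (dyf T n s) \<in> X"
    "(\<lambda>n. dyf T n t) \<longlonglongrightarrow> t" "(\<lambda>n. dyf T n s) \<longlonglongrightarrow> s"
  using assms T_pos unfolding simp2_def
  by (auto intro!: dyf_dyadic dyf_mono R_mem dfloor_tendsto)

lemma ext_tends:
  assumes ts: "(t, s) \<in> simp2 T"
  shows "tends (\<lambda>n. R (dyf T n t) (dyf T n s)) (ext (t, s))"
proof -
  have "\<exists>l. tends (\<lambda>n. R (dyf T n t) (dyf T n s)) l"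
  proof (rule Cauchy_tends)
    fix e :: real assume "0 < e"
    then obtain d where d: "d > 0" "\<And>s t s' t'. s \<in> dyadics T \<Longrightarrow> t \<in> dyadics T \<Longrightarrow>
        s' \<in> dyadics T \<Longrightarrow> t' \<in> dyadics T \<Longrightarrow> s \<le> t \<Longrightarrow> s' \<le> t' \<Longrightarrow> \<bar>t - t'\<bar> < d \<Longrightarrow> \<bar>s - s'\<bar> < d \<Longrightarrow>
        N (R t s - R t' s') < e"
      using R_uniformly_continuous by blast
    have "Cauchy (\<lambda>n. dyf T n t)" "Cauchy (\<lambda>n. dyf T n s)"
      using dyf_facts[OF ts] by (auto intro: LIMSEQ_imp_Cauchy)
    then obtain n1 n2 where
      "\<forall>m\<ge>n1. \<forall>n\<ge>n1. dist (dyf T m t) (dyf T n t) < d"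
      "\<forall>m\<ge>n2. \<forall>n\<ge>n2. dist (dyf T m s) (dyf T n s) < d"
      using \<open>d > 0\<close> unfolding Cauchy_def by metis
    then show "\<exists>n0. \<forall>n\<ge>n0. \<forall>m\<ge>n0.
        N (R (dyf T n t) (dyf T n s) - R (dyf T m t) (dyf T m s)) < e"
      using dyf_facts[OF ts]
      by (intro exI[of _ "max n1 n2"] allI impI d(2)) (auto simp: dist_real_def)
  qed (rule dyf_facts[OF ts])
  then show ?thesis
    using ts unfolding ext_def by (simp add: someI_ex)
qed

lemma ext_dyadic:
  assumes "t \<in> dyadics T" "s \<in> dyadics T" "s \<le> t"
  shows "ext (t, s) = R t s"
proof -
  have ts: "(t, s) \<in> simp2 T"
    using assms dyadics_range[OF T_pos] by (auto simp: simp2_def)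
  have "\<forall>\<^sub>F n in sequentially. R (dyf T n t) (dyf T n s) = R t s"
    using dyf_eventually[OF T_pos assms(1)] dyf_eventually[OF T_pos assms(2)]
    by eventually_elim simp
  then have "tends (\<lambda>n. R (dyf T n t) (dyf T n s)) (R t s)"
    using assms dyf_facts[OF ts] by (intro tends_eventually R_mem) auto
  then show ?thesis
    using ext_tends[OF ts] tends_unique by blast
qed

lemma ext_uniformly_continuous:
  assumes "0 < e"
  shows "\<exists>d>0. \<forall>x\<in>simp2 T. \<forall>y\<in>simp2 T. dist y x < d \<longrightarrow> N (ext y - ext x) < e"
proof -
  have "0 < e / 2" using assms by simp
  then obtain d where d: "d > 0" "\<And>s t s' t'. s \<in> dyadics T \<Longrightarrow> t \<in> dyadics T \<Longrightarrow>
      s' \<in> dyadics T \<Longrightarrow> t' \<in> dyadics T \<Longrightarrow> s \<le> t \<Longrightarrow> s' \<le> t' \<Longrightarrow> \<bar>t - t'\<bar> < d \<Longrightarrow> \<bar>s - s'\<bar> < d \<Longrightarrow>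
      N (R t s - R t' s') < e / 2"
    using R_uniformly_continuous by blast
  have "N (ext (t', s') - ext (t, s)) < e"
    if x: "(t, s) \<in> simp2 T" and y: "(t', s') \<in> simp2 T" and dist: "dist (t', s') (t, s) < d"
    for t s t' s'
  proof -
    have "\<bar>t' - t\<bar> < d" "\<bar>s' - s\<bar> < d"
      using dist dist_fst_le[of "(t', s')" "(t, s)"] dist_snd_le[of "(t', s')" "(t, s)"]
      by (auto simp: dist_real_def)
    moreover have "(\<lambda>n. \<bar>dyf T n t' - dyf T n t\<bar>) \<longlonglongrightarrow> \<bar>t' - t\<bar>"
      "(\<lambda>n. \<bar>dyf T n s' - dyf T n s\<bar>) \<longlonglongrightarrow> \<bar>s' - s\<bar>"
      using dyf_facts[OF x] dyf_facts[OF y] by (auto intro!: tendsto_rabs tendsto_diff)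
    ultimately have ev: "\<forall>\<^sub>F n in sequentially. \<bar>dyf T n t' - dyf T n t\<bar> < d"
      "\<forall>\<^sub>F n in sequentially. \<bar>dyf T n s' - dyf T n s\<bar> < d"
      by (auto intro: order_tendstoD)
    have "\<forall>\<^sub>F n in sequentially.
        N (R (dyf T n t') (dyf T n s') - R (dyf T n t) (dyf T n s)) \<le> e / 2"
      using ev by eventually_elim (use dyf_facts[OF x] dyf_facts[OF y] d(2) in \<open>auto intro!: less_imp_le\<close>)
    moreover have "(\<lambda>n. N (R (dyf T n t') (dyf T n s') - R (dyf T n t) (dyf T n s)))
        \<longlonglongrightarrow> N (ext (t', s') - ext (t, s))"
      by (intro tends_norm tends_diff ext_tends x y)
    ultimately have "N (ext (t', s') - ext (t, s)) \<le> e / 2"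
      by (intro tendsto_upperbound[where F = sequentially]) auto
    then show ?thesis using assms by simp
  qed
  with d(1) show ?thesis
    by (intro exI[of _ d]) auto
qed

lemma ext_mem: "ext x \<in> X"
proof (cases "x \<in> simp2 T")
  case True
  then show ?thesis using ext_tends[of "fst x" "snd x"] by (simp add: tends_def)
qed (auto simp: ext_def split: prod.splits)

lemma is_sewing_ext: "is_sewing T X N S r H ext"
proof -
  have "continuous_map (top_of_set (simp2 T)) (ntop X N) ext"
    unfolding continuous_map_ntop using ext_mem ext_uniformly_continuous by blast
  moreover have "ext x = 0" if "x \<notin> simp2 T" for x
    using that by (cases x) (auto simp: ext_def)
  ultimately show ?thesis
    unfolding is_sewing_def cont_maps_def using ext_dyadic by blast
qed

lemma sewing_eq_ext: "sewing T X N S r H = ext"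
  by (rule sewing_eq[OF is_sewing_ext])

lemma ext_bound:
  assumes "0 \<le> s" "s < t" "t \<le> T"
  shows "N (ext (t, s)) \<le> D * modulus \<gamma> (t - s)"
proof -
  have ts: "(t, s) \<in> simp2 T" using assms by (simp add: simp2_def)
  note f = dyf_facts[OF ts]
  have lim: "(\<lambda>n. dyf T n t - dyf T n s) \<longlonglongrightarrow> t - s"
    by (intro tendsto_diff f)
  have "(\<lambda>n. D * modulus \<gamma> (dyf T n t - dyf T n s)) \<longlonglongrightarrow> D * modulus \<gamma> (t - s)"
    using assms by (intro tendsto_mult tendsto_const isCont_tendsto_compose[OF _ lim] isCont_modulus) simp
  moreover have "(\<lambda>n. N (R (dyf T n t) (dyf T n s))) \<longlonglongrightarrow> N (ext (t, s))"
    by (intro tends_norm ext_tends ts)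
  ultimately show ?thesis
    using R_bound'[OF f(2,1,3)] by (intro tendsto_le[OF sequentially_bot]) auto
qed

text \<open>
  The cocycle relation at the dyadic approximations converges term by term; the term in which both
  the operator and its argument move is handled by \<open>tends_S\<close>.
\<close>

lemma delta2_ext:
  assumes "x \<in> simp3 T"
  shows "delta2 S ext x = H x"
proof -
  obtain t u s where x: "x = (t, u, s)" by (cases x)
  have rng: "0 \<le> s" "s \<le> u" "u \<le> t" "t \<le> T"
    using assms by (auto simp: x simp3_def)
  have tu: "(t, u) \<in> simp2 T" and us: "(u, s) \<in> simp2 T" and ts: "(t, s) \<in> simp2 T"
    using rng by (auto simp: simp2_def)
  let ?t = "\<lambda>n. dyf T n t" and ?u = "\<lambda>n. dyf T n u" and ?s = "\<lambda>n. dyf T n s"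
  note f = dyf_facts[OF tu] dyf_facts[OF us]
  have dist: "0 \<le> ?t n - ?u n" "?t n - ?u n \<le> T" for n
    using f(3) dyadics_range[OF T_pos f(1), of n] dyadics_range[OF T_pos f(2), of n] by auto
  have "tends (\<lambda>n. S (?t n - ?u n) (R (?u n) (?s n))) (S (t - u) (ext (u, s)))"
    using dist f by (intro tends_S ext_tends us tendsto_diff) auto
  then have "tends (\<lambda>n. R (?t n) (?s n) - R (?t n) (?u n) - S (?t n - ?u n) (R (?u n) (?s n)))
      (ext (t, s) - ext (t, u) - S (t - u) (ext (u, s)))"
    by (intro tends_diff ext_tends tu ts)
  moreover have "R (?t n) (?s n) - R (?t n) (?u n) - S (?t n - ?u n) (R (?u n) (?s n)) =
      H (?t n, ?u n, ?s n)" for n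
    using R_cocycle[OF f(1,2,8,9,3), of n] by (simp add: algebra_simps)
  moreover have "tends (\<lambda>n. H (?t n, ?u n, ?s n)) (H (t, u, s))"
  proof (rule continuous_map_tends[where D = "simp3 T"])
    show "continuous_map (top_of_set (simp3 T)) (ntop X N) H"
      using H_cont by (simp add: cont_maps_def)
    show "(?t n, ?u n, ?s n) \<in> simp3 T" for n
      using f dyadics_range[OF T_pos f(1), of n] dyadics_range[OF T_pos f(8), of n]
      by (auto simp: simp3_def)
    show "(\<lambda>n. (?t n, ?u n, ?s n)) \<longlonglongrightarrow> (t, u, s)"
      using f by (intro tendsto_Pair) auto
  qed (use rng in \<open>auto simp: simp3_def\<close>)
  ultimately have "ext (t, s) - ext (t, u) - S (t - u) (ext (u, s)) = H (t, u, s)"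
    using tends_unique by simp
  then show ?thesis
    by (simp add: x delta2_def algebra_simps)
qed

end

text \<open>
  The quantifier order is the point: one constant serves all rules and all defects that share the
  factor \<open>\<kappa>\<close>.
\<close>

theorem (in evolution) pathwise_sewing:
  assumes adm: "admissible_factor \<gamma> \<kappa>" and "0 < \<gamma>"
  shows "\<exists>C>0. \<forall>r H CH. H \<in> ZC T X N S \<gamma> \<longrightarrow> recursion_ok T X S r H \<longrightarrow>
    admissible T N S r \<gamma> \<kappa> H CH \<longrightarrow> 0 \<le> CH \<longrightarrow> residual_continuity T N S r H \<longrightarrow>
    is_sewing T X N S r H (sewing T X N S r H) \<and>
    (\<forall>s t. 0 \<le> s \<longrightarrow> s < t \<longrightarrow> t \<le> T \<longrightarrow> N (sewing T X N S r H (t, s)) \<le>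
      C * (enn2real (hnorm3 T X N \<gamma> H) + CH) * modulus \<gamma> (t - s)) \<and>
    (\<forall>x\<in>simp3 T. delta2 S (sewing T X N S r H) x = H x)"
proof -
  obtain C where C: "C > 0" "\<And>r H CH s t. H \<in> ZC T X N S \<gamma> \<Longrightarrow> recursion_ok T X S r H \<Longrightarrow>
      admissible T N S r \<gamma> \<kappa> H CH \<Longrightarrow> 0 \<le> CH \<Longrightarrow>
      s \<in> dyadics T \<Longrightarrow> t \<in> dyadics T \<Longrightarrow> s < t \<Longrightarrow>
      N (dy_R T S r H t s) \<le> C * (enn2real (hnorm3 T X N \<gamma> H) + CH) * modulus \<gamma> (t - s)"
    using dyadic_residual_bound[OF assms] by blast
  have "is_sewing T X N S r H (sewing T X N S r H) \<and>
    (\<forall>s t. 0 \<le> s \<longrightarrow> s < t \<longrightarrow> t \<le> T \<longrightarrow> N (sewing T X N S r H (t, s)) \<le>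
      C * (enn2real (hnorm3 T X N \<gamma> H) + CH) * modulus \<gamma> (t - s)) \<and>
    (\<forall>x\<in>simp3 T. delta2 S (sewing T X N S r H) x = H x)"
    if H: "H \<in> ZC T X N S \<gamma>" "recursion_ok T X S r H" "admissible T N S r \<gamma> \<kappa> H CH" "0 \<le> CH"
      "residual_continuity T N S r H" for r H CH
  proof -
    interpret sewable_defect X N S T Mb r H \<gamma> "C * (enn2real (hnorm3 T X N \<gamma> H) + CH)"
    proof unfold_locales
      show "0 \<le> C * (enn2real (hnorm3 T X N \<gamma> H) + CH)"
        using C(1) H(4) by simp
    qed (use H \<open>0 < \<gamma>\<close> C(2)[OF H(1-4)] in auto)
    show ?thesis
      unfolding sewing_eq_ext using is_sewing_ext ext_bound delta2_ext by blast
  qed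
  with C(1) show ?thesis by blast
qed


section \<open>The two target norms\<close>

text \<open>The Hoelder and the logarithmic norm are the same weighted supremum, for \<open>modulus \<gamma>\<close>.\<close>

definition modulus_norm ::
  "real \<Rightarrow> ('a \<Rightarrow> real) \<Rightarrow> real \<Rightarrow> (real \<times> real \<Rightarrow> 'a) \<Rightarrow> ennreal" where
  "modulus_norm T N \<gamma> g =
    (SUP (t, s)\<in>{(t, s). 0 \<le> s \<and> s < t \<and> t \<le> T}. ennreal (N (g (t, s)) / modulus \<gamma> (t - s)))"

lemma hnorm2_eq: "\<gamma> \<noteq> 1 \<Longrightarrow> hnorm2 T N \<gamma> g = modulus_norm T N \<gamma> g"
  unfolding hnorm2_def modulus_norm_def by (intro SUP_cong) (auto simp: modulus_def)

lemma lognorm2_eq: "lognorm2 T N g = modulus_norm T N 1 g"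
  unfolding lognorm2_def modulus_norm_def by (intro SUP_cong) (auto simp: modulus_def)

lemma modulus_norm_le:
  assumes "\<And>s t. 0 \<le> s \<Longrightarrow> s < t \<Longrightarrow> t \<le> T \<Longrightarrow> N (g (t, s)) \<le> K * modulus \<gamma> (t - s)"
  shows "modulus_norm T N \<gamma> g \<le> ennreal K"
  unfolding modulus_norm_def
proof (rule SUP_least)
  fix x assume "x \<in> {(t, s). 0 \<le> s \<and> s < t \<and> t \<le> T}"
  then obtain t s where x: "x = (t, s)" "0 \<le> s" "s < t" "t \<le> T" by auto
  then have "N (g (t, s)) / modulus \<gamma> (t - s) \<le> K"
    using assms[of s t] modulus_pos[of "t - s" \<gamma>] by (simp add: pos_divide_le_eq)
  then show "(case x of (t, s) \<Rightarrow> ennreal (N (g (t, s)) / modulus \<gamma> (t - s))) \<le> ennreal K"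
    by (simp add: x ennreal_leI)
qed

lemma (in banach_on) modulus_norm_triangle:
  assumes "\<And>x. g x \<in> X" "\<And>x. h x \<in> X" "\<And>x. x \<in> simp2 T \<Longrightarrow> f x = g x + h x"
  shows "modulus_norm T N \<gamma> f \<le> modulus_norm T N \<gamma> g + modulus_norm T N \<gamma> h"
  unfolding modulus_norm_def[of T N \<gamma> f]
proof (rule SUP_least)
  fix x assume x: "x \<in> {(t, s). 0 \<le> s \<and> s < t \<and> t \<le> T}"
  obtain t s where ts: "x = (t, s)" by (cases x)
  let ?m = "modulus \<gamma> (t - s)"
  have m: "0 < ?m" using x by (auto simp: ts intro: modulus_pos)
  have "f (t, s) = g (t, s) + h (t, s)"
    using x by (intro assms) (auto simp: ts simp2_def)
  then have "N (f (t, s)) / ?m \<le> N (g (t, s)) / ?m + N (h (t, s)) / ?m"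
    using m triangle[OF assms(1,2)] by (simp add: divide_right_mono flip: add_divide_distrib)
  then have "ennreal (N (f (t, s)) / ?m) \<le> ennreal (N (g (t, s)) / ?m) + ennreal (N (h (t, s)) / ?m)"
    using m assms by (simp add: nonneg ennreal_leI flip: ennreal_plus)
  also have "\<dots> \<le> modulus_norm T N \<gamma> g + modulus_norm T N \<gamma> h"
    unfolding modulus_norm_def
    using x by (intro add_mono SUP_upper2[of x]) (auto simp: ts)
  finally show "(case x of (t, s) \<Rightarrow> ennreal (N (f (t, s)) / modulus \<gamma> (t - s))) \<le>
      modulus_norm T N \<gamma> g + modulus_norm T N \<gamma> h"
    by (simp add: ts)
qed


section \<open>Linearity of the sewing map\<close>

lemma lvl_I_0: "lvl_I T S r H n 0 = 0"
  by (induction n) (simp_all add: Let_def)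

text \<open>
  Only the residuals are assumed to be linear in the defect; the path inherits this by solving
  for its values along the grid from left to right.
\<close>

lemma (in evolution) lvl_I_diff:
  assumes H: "sewing_defect X N S T Mb r H \<gamma>" "sewing_defect X N S T Mb r H' \<gamma>"
    "sewing_defect X N S T Mb r (\<lambda>x. H x - H' x) \<gamma>"
    and lin: "\<And>n k. k < 2 ^ n \<Longrightarrow>
      gen_res T S r (\<lambda>x. H x - H' x) n k = gen_res T S r H n k - gen_res T S r H' n k"
  shows "k \<le> 2 ^ n \<Longrightarrow>
    lvl_I T S r (\<lambda>x. H x - H' x) n k = lvl_I T S r H n k - lvl_I T S r H' n k"
proof (induction k)
  case 0
  then show ?case by (simp add: lvl_I_0)
next
  case (Suc k)
  interpret H: sewing_defect X N S T Mb r H \<gamma> by fact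
  interpret H': sewing_defect X N S T Mb r H' \<gamma> by fact
  interpret D: sewing_defect X N S T Mb r "\<lambda>x. H x - H' x" \<gamma> by fact
  have k: "k < 2 ^ n" using Suc.prems by simp
  have "0 \<le> dpt T n (Suc k) - dpt T n k"
    using T_pos by (simp add: dpt_Suc)
  then have "S (dpt T n (Suc k) - dpt T n k) (lvl_I T S r (\<lambda>x. H x - H' x) n k) =
      S (dpt T n (Suc k) - dpt T n k) (lvl_I T S r H n k) -
      S (dpt T n (Suc k) - dpt T n k) (lvl_I T S r H' n k)"
    using Suc.IH k by (simp add: S_diff H.lvl_I_mem H'.lvl_I_mem)
  then show ?case
    using lin[OF k] H.gen_res_eq[OF k] H'.gen_res_eq[OF k] D.gen_res_eq[OF k]
    by (simp add: germ_def algebra_simps)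
qed

lemma (in evolution) dy_R_diff:
  assumes H: "sewing_defect X N S T Mb r H \<gamma>" "sewing_defect X N S T Mb r H' \<gamma>"
    "sewing_defect X N S T Mb r (\<lambda>x. H x - H' x) \<gamma>"
    and lin: "\<And>n k. k < 2 ^ n \<Longrightarrow>
      gen_res T S r (\<lambda>x. H x - H' x) n k = gen_res T S r H n k - gen_res T S r H' n k"
    and dy: "s \<in> dyadics T" "t \<in> dyadics T" "s \<le> t"
  shows "dy_R T S r (\<lambda>x. H x - H' x) t s = dy_R T S r H t s - dy_R T S r H' t s"
proof -
  have I: "dy_I T S r (\<lambda>x. H x - H' x) v = dy_I T S r H v - dy_I T S r H' v"
    if "v \<in> dyadics T" for v
    using that T_pos lvl_I_diff[OF H lin] by (auto simp: dyadics_def dy_I_dpt)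
  have "S (t - s) (dy_I T S r H s - dy_I T S r H' s) =
      S (t - s) (dy_I T S r H s) - S (t - s) (dy_I T S r H' s)"
    using dy by (intro S_diff sewing_defect.dy_I_mem[OF H(1)] sewing_defect.dy_I_mem[OF H(2)]) auto
  then show ?thesis
    using dy by (simp add: dy_R_def germ_def I)
qed

lemma (in evolution) is_sewing_mem: "is_sewing T X N S r H R \<Longrightarrow> R x \<in> X"
  by (auto simp: is_sewing_def cont_maps_mem)

lemma (in evolution) is_sewing_diff:
  assumes H: "sewing_defect X N S T Mb r H \<gamma>" "sewing_defect X N S T Mb r H' \<gamma>"
    "sewing_defect X N S T Mb r (\<lambda>x. H x - H' x) \<gamma>"
    and lin: "\<And>n k. k < 2 ^ n \<Longrightarrow>
      gen_res T S r (\<lambda>x. H x - H' x) n k = gen_res T S r H n k - gen_res T S r H' n k"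
    and R: "is_sewing T X N S r H R" "is_sewing T X N S r H' R'"
      "is_sewing T X N S r (\<lambda>x. H x - H' x) R''"
    and x: "x \<in> simp2 T"
  shows "R'' x = R x - R' x"
proof -
  obtain t s where ts: "x = (t, s)" by (cases x)
  have rng: "0 \<le> s" "s \<le> t" "t \<le> T" using x by (auto simp: ts simp2_def)
  have "dy_R T S r (\<lambda>x. H x - H' x) (dyf T n t) (dyf T n s) =
      dy_R T S r H (dyf T n t) (dyf T n s) - dy_R T S r H' (dyf T n t) (dyf T n s)" for n
    using rng T_pos by (intro dy_R_diff[OF H lin] dyf_dyadic dyf_mono) auto
  then have "tends (\<lambda>n. dy_R T S r (\<lambda>x. H x - H' x) (dyf T n t) (dyf T n s)) (R (t, s) - R' (t, s))"
    using tends_diff[OF is_sewing_tends[OF R(1)] is_sewing_tends[OF R(2)]] x by (simp add: ts)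
  then show ?thesis
    using is_sewing_tends[OF R(3)] x tends_unique unfolding ts by blast
qed


section \<open>Measurability and moments\<close>

text \<open>
  The norm of the sewing is measurable although it is only defined on a subspace: it is Lipschitz
  there, and a relatively open subset of the subspace is cut out by an open set of the whole
  space.
\<close>

lemma (in banach_on) measurable_Lipschitz:
  assumes "0 < T" and H: "H \<in> M \<rightarrow>\<^sub>M ZC_borel T X N S \<gamma>"
    and V: "V \<subseteq> ZC T X N S \<gamma>" "\<And>\<omega>. \<omega> \<in> space M \<Longrightarrow> H \<omega> \<in> V"
    and f: "\<And>h h'. h \<in> V \<Longrightarrow> h' \<in> V \<Longrightarrow>
      f h \<le> f h' + ennreal C * hnorm3 T X N \<gamma> (\<lambda>x. h x - h' x)"
  shows "(\<lambda>\<omega>. f (H \<omega>) :: ennreal) \<in> borel_measurable M"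
proof (rule borel_measurableI_greater)
  fix y :: ennreal
  let ?d = "\<lambda>h h'. enn2real (hnorm3 T X N \<gamma> (\<lambda>x. h x - h' x))"
  interpret Metric_space "ZC T X N S \<gamma>" ?d
    by (rule Metric_space_ZC) fact
  have d: "hnorm3 T X N \<gamma> (\<lambda>x. h x - h' x) = ennreal (?d h h')" if "h \<in> V" "h' \<in> V" for h h'
  proof -
    have "hnorm3 T X N \<gamma> h < \<top>" "hnorm3 T X N \<gamma> h' < \<top>"
      using that V(1) by (auto simp: ZC_def)
    then show ?thesis
      using hnorm3_diff_finite[of T \<gamma> h h'] by (simp add: ennreal_enn2real)
  qed
  define U where "U = \<Union>{mball g \<rho> | g \<rho>. g \<in> V \<and> (\<forall>h\<in>V \<inter> mball g \<rho>. y < f h)}"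
  have "openin mtopology U"
    unfolding U_def by (rule openin_Union) auto
  moreover have "{U. openin mtopology U} \<subseteq> Pow (ZC T X N S \<gamma>)"
    using openin_subset[of mtopology] by (simp add: subset_iff)
  ultimately have "U \<in> sets (ZC_borel T X N S \<gamma>)"
    unfolding ZC_borel_def by (subst sets_measure_of) auto
  then have "H -` U \<inter> space M \<in> sets M"
    using H by (rule measurable_sets[rotated])
  also have "H -` U \<inter> space M = {\<omega> \<in> space M. y < f (H \<omega>)}"
  proof (intro set_eqI iffI)
    fix \<omega> assume "\<omega> \<in> H -` U \<inter> space M"
    then show "\<omega> \<in> {\<omega> \<in> space M. y < f (H \<omega>)}"
      using V(2) by (auto simp: U_def)
  next
    fix \<omega> assume \<omega>: "\<omega> \<in> {\<omega> \<in> space M. y < f (H \<omega>)}"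
    then have g: "H \<omega> \<in> V" using V(2) by auto
    have "\<exists>e>0. y + ennreal e < f (H \<omega>)"
      using \<omega> ennreal_le_epsilon[of y "f (H \<omega>)"] by (force simp: not_le)
    then obtain e where e: "e > 0" "y + ennreal e < f (H \<omega>)" by blast
    \<comment> \<open>Within this radius the Lipschitz estimate loses at most \<open>e\<close>.\<close>
    define \<rho> where "\<rho> = e / (\<bar>C\<bar> + 1)"
    have \<rho>: "\<rho> > 0" using e by (simp add: \<rho>_def)
    have "y < f h" if h: "h \<in> V" "h \<in> mball (H \<omega>) \<rho>" for h
    proof (rule ccontr)
      assume "\<not> y < f h"
      have "C * ?d (H \<omega>) h \<le> e"
      proof -
        have "C * ?d (H \<omega>) h \<le> (\<bar>C\<bar> + 1) * \<rho>"
          using h by (intro mult_mono) auto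
        then show ?thesis by (simp add: \<rho>_def)
      qed
      then have "ennreal C * hnorm3 T X N \<gamma> (\<lambda>x. H \<omega> x - h x) \<le> ennreal e"
        by (subst d[OF g h(1)]) (simp add: ennreal_leI flip: ennreal_mult'')
      with \<open>\<not> y < f h\<close> have "f (H \<omega>) \<le> y + ennreal e"
        using f[OF g h(1)] by (meson add_mono not_less order_trans)
      with e(2) show False by simp
    qed
    moreover have "H \<omega> \<in> mball (H \<omega>) \<rho>"
      using g V(1) \<rho> by (auto simp: hnorm3_zero)
    ultimately have "H \<omega> \<in> U"
      unfolding U_def using g by blast
    then show "\<omega> \<in> H -` U \<inter> space M"
      using \<omega> by simp
  qed
  finally show "{\<omega> \<in> space M. y < f (H \<omega>)} \<in> sets M" .
qed

lemma (in banach_on) measurable_hnorm3: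
  assumes "0 < T" "H \<in> M \<rightarrow>\<^sub>M ZC_borel T X N S \<gamma>" "\<And>\<omega>. \<omega> \<in> space M \<Longrightarrow> H \<omega> \<in> ZC T X N S \<gamma>"
  shows "(\<lambda>\<omega>. hnorm3 T X N \<gamma> (H \<omega>)) \<in> borel_measurable M"
  using assms(1,2) order_refl assms(3)
proof (rule measurable_Lipschitz)
  fix h h' :: "real \<times> real \<times> real \<Rightarrow> 'a"
  show "hnorm3 T X N \<gamma> h \<le> hnorm3 T X N \<gamma> h' + ennreal 1 * hnorm3 T X N \<gamma> (\<lambda>x. h x - h' x)"
    using hnorm3_triangle[of T \<gamma> h' "\<lambda>x. h x - h' x"] by simp
qed

lemma ZC_borel_space:
  assumes "banach_on X N" "0 < T" "H \<in> M \<rightarrow>\<^sub>M ZC_borel T X N S \<gamma>" "\<omega> \<in> space M"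
  shows "H \<omega> \<in> ZC T X N S \<gamma>"
proof -
  interpret Metric_space "ZC T X N S \<gamma>" "\<lambda>h h'. enn2real (hnorm3 T X N \<gamma> (\<lambda>x. h x - h' x))"
    by (rule banach_on.Metric_space_ZC[OF assms(1,2)])
  have "{U. openin mtopology U} \<subseteq> Pow (ZC T X N S \<gamma>)"
    using openin_subset[of mtopology] by (simp add: subset_iff)
  then have "space (ZC_borel T X N S \<gamma>) = ZC T X N S \<gamma>"
    unfolding ZC_borel_def by (rule space_measure_of)
  then show ?thesis
    using measurable_space[OF assms(3,4)] by simp
qed

lemma epowr_measurable [measurable]: "(\<lambda>x. epowr x p) \<in> borel_measurable borel"
  unfolding epowr_def[abs_def] by measurable

lemma epowr_mono: "0 \<le> p \<Longrightarrow> x \<le> y \<Longrightarrow> epowr x p \<le> epowr y p"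
  by (auto simp: epowr_def top_unique less_top intro!: ennreal_leI powr_mono2 enn2real_mono)

lemma epowr_cmult:
  assumes "0 < C"
  shows "epowr (ennreal C * x) p = ennreal (C powr p) * epowr x p"
  using assms by (auto simp: epowr_def ennreal_mult_eq_top_iff ennreal_top_mult ennreal_mult_top
      enn2real_mult powr_mult ennreal_mult)

lemma moment_bound:
  assumes "0 < C" "0 \<le> p" "g \<in> borel_measurable M"
    and "\<And>\<omega>. \<omega> \<in> space M \<Longrightarrow> f \<omega> \<le> ennreal C * g \<omega>"
  shows "(\<integral>\<^sup>+\<omega>. epowr (f \<omega>) p \<partial>M) \<le> ennreal (C powr p) * (\<integral>\<^sup>+\<omega>. epowr (g \<omega>) p \<partial>M)"
proof -
  have "(\<integral>\<^sup>+\<omega>. epowr (f \<omega>) p \<partial>M) \<le> (\<integral>\<^sup>+\<omega>. ennreal (C powr p) * epowr (g \<omega>) p \<partial>M)"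
    using assms by (intro nn_integral_mono) (simp add: epowr_mono flip: epowr_cmult)
  also have "\<dots> = ennreal (C powr p) * (\<integral>\<^sup>+\<omega>. epowr (g \<omega>) p \<partial>M)"
    using assms(3) by (intro nn_integral_cmult) measurable
  finally show ?thesis .
qed

context evolution
begin

text \<open>
  The admissibility constant of each realization enters the pathwise bound additively, next to the
  norm of the defect.
\<close>

lemma individual_moments:
  assumes adm: "admissible_factor \<gamma> \<kappa>" and "0 < \<gamma>"
  shows "\<exists>C>0. \<forall>p\<ge>1. \<forall>H CH. individual_defect M T X N S r \<gamma> \<kappa> H CH \<longrightarrow>
    (let R = (\<lambda>\<omega>. sewing T X N S r (H \<omega>)) in
      (\<forall>\<omega>\<in>space M. is_sewing T X N S r (H \<omega>) (R \<omega>) \<and> modulus_norm T N \<gamma> (R \<omega>) < \<top>) \<and>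
      (\<integral>\<^sup>+\<omega>. epowr (modulus_norm T N \<gamma> (R \<omega>)) p \<partial>M)
        \<le> ennreal (C powr p) *
          (\<integral>\<^sup>+\<omega>. epowr (hnorm3 T X N \<gamma> (H \<omega>) + ennreal (CH \<omega>)) p \<partial>M) \<and>
      (AE \<omega> in M. \<forall>x\<in>simp3 T. delta2 S (R \<omega>) x = H \<omega> x))"
proof -
  obtain C where C: "C > 0" and sew: "\<And>r H CH. H \<in> ZC T X N S \<gamma> \<Longrightarrow> recursion_ok T X S r H \<Longrightarrow>
    admissible T N S r \<gamma> \<kappa> H CH \<Longrightarrow> 0 \<le> CH \<Longrightarrow> residual_continuity T N S r H \<Longrightarrow>
    is_sewing T X N S r H (sewing T X N S r H) \<and>
    (\<forall>s t. 0 \<le> s \<longrightarrow> s < t \<longrightarrow> t \<le> T \<longrightarrow> N (sewing T X N S r H (t, s)) \<le>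
      C * (enn2real (hnorm3 T X N \<gamma> H) + CH) * modulus \<gamma> (t - s)) \<and>
    (\<forall>x\<in>simp3 T. delta2 S (sewing T X N S r H) x = H x)"
    using pathwise_sewing[OF assms] by blast
  show ?thesis
  proof (intro exI[of _ C] conjI C allI impI)
    fix p :: real and H CH
    assume "1 \<le> p" and ind: "individual_defect M T X N S r \<gamma> \<kappa> H CH"
    then have meas: "H \<in> M \<rightarrow>\<^sub>M ZC_borel T X N S \<gamma>" "CH \<in> borel_measurable M"
      by (auto simp: individual_defect_def)
    have H: "H \<omega> \<in> ZC T X N S \<gamma>" if "\<omega> \<in> space M" for \<omega>
      by (rule ZC_borel_space[OF banach_on_axioms T_pos meas(1) that])
    let ?R = "\<lambda>\<omega>. sewing T X N S r (H \<omega>)"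
    have CH: "0 \<le> CH \<omega>" if "\<omega> \<in> space M" for \<omega>
      using ind that by (simp add: individual_defect_def)
    have sew': "is_sewing T X N S r (H \<omega>) (?R \<omega>)"
      "modulus_norm T N \<gamma> (?R \<omega>) \<le> ennreal C * (hnorm3 T X N \<gamma> (H \<omega>) + ennreal (CH \<omega>))"
      "\<forall>x\<in>simp3 T. delta2 S (?R \<omega>) x = H \<omega> x"
      "hnorm3 T X N \<gamma> (H \<omega>) < \<top>" if \<omega>: "\<omega> \<in> space M" for \<omega>
    proof -
      have *: "is_sewing T X N S r (H \<omega>) (?R \<omega>) \<and>
        (\<forall>s t. 0 \<le> s \<longrightarrow> s < t \<longrightarrow> t \<le> T \<longrightarrow> N (?R \<omega> (t, s)) \<le>
          C * (enn2real (hnorm3 T X N \<gamma> (H \<omega>)) + CH \<omega>) * modulus \<gamma> (t - s)) \<and>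
        (\<forall>x\<in>simp3 T. delta2 S (?R \<omega>) x = H \<omega> x)"
        using ind \<omega> H[OF \<omega>] by (intro sew) (auto simp: individual_defect_def)
      then show "is_sewing T X N S r (H \<omega>) (?R \<omega>)" "\<forall>x\<in>simp3 T. delta2 S (?R \<omega>) x = H \<omega> x"
        by auto
      show fin: "hnorm3 T X N \<gamma> (H \<omega>) < \<top>"
        using H[OF \<omega>] by (simp add: ZC_def)
      have "modulus_norm T N \<gamma> (?R \<omega>) \<le> ennreal (C * (enn2real (hnorm3 T X N \<gamma> (H \<omega>)) + CH \<omega>))"
        using * by (intro modulus_norm_le) auto
      also have "\<dots> = ennreal C * (hnorm3 T X N \<gamma> (H \<omega>) + ennreal (CH \<omega>))"
        using C CH[OF \<omega>] fin by (simp add: ennreal_mult ennreal_plus ennreal_enn2real)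
      finally show "modulus_norm T N \<gamma> (?R \<omega>) \<le>
        ennreal C * (hnorm3 T X N \<gamma> (H \<omega>) + ennreal (CH \<omega>))" .
    qed
    have fin: "modulus_norm T N \<gamma> (?R \<omega>) < \<top>" if \<omega>: "\<omega> \<in> space M" for \<omega>
      using sew'(2)[OF \<omega>] sew'(4)[OF \<omega>]
      by (elim order_le_less_trans) (simp add: ennreal_mult_less_top)
    have "(\<lambda>\<omega>. hnorm3 T X N \<gamma> (H \<omega>) + ennreal (CH \<omega>)) \<in> borel_measurable M"
      using measurable_hnorm3[OF T_pos meas(1) H] meas(2) by measurable
    then have "(\<integral>\<^sup>+\<omega>. epowr (modulus_norm T N \<gamma> (?R \<omega>)) p \<partial>M)
        \<le> ennreal (C powr p) *
          (\<integral>\<^sup>+\<omega>. epowr (hnorm3 T X N \<gamma> (H \<omega>) + ennreal (CH \<omega>)) p \<partial>M)"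
      using C \<open>1 \<le> p\<close> sew'(2) by (intro moment_bound) auto
    then show "let R = ?R in
      (\<forall>\<omega>\<in>space M. is_sewing T X N S r (H \<omega>) (R \<omega>) \<and> modulus_norm T N \<gamma> (R \<omega>) < \<top>) \<and>
      (\<integral>\<^sup>+\<omega>. epowr (modulus_norm T N \<gamma> (R \<omega>)) p \<partial>M)
        \<le> ennreal (C powr p) *
          (\<integral>\<^sup>+\<omega>. epowr (hnorm3 T X N \<gamma> (H \<omega>) + ennreal (CH \<omega>)) p \<partial>M) \<and>
      (AE \<omega> in M. \<forall>x\<in>simp3 T. delta2 S (R \<omega>) x = H \<omega> x)"
      unfolding Let_def using sew' fin by auto
  qed
qed

text \<open>
  Here the admissibility constant is controlled by the norm of the defect and is absorbed into the
  constant \<open>C'\<close>. Linearity of the domain allows the pathwise bound to be applied to the difference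
  of two defects, which is the Lipschitz estimate that measurability needs.
\<close>

lemma selection_moments:
  assumes sel: "selection_domain T X N S r \<gamma> D" and "0 < \<gamma>"
  shows "\<exists>C>0. \<forall>p\<ge>1. \<forall>H. Lp_defect M T X N S \<gamma> p D H \<longrightarrow>
    (let R = (\<lambda>\<omega>. sewing T X N S r (H \<omega>)) in
      (\<forall>\<omega>\<in>space M. is_sewing T X N S r (H \<omega>) (R \<omega>) \<and> modulus_norm T N \<gamma> (R \<omega>) < \<top>) \<and>
      (\<lambda>\<omega>. modulus_norm T N \<gamma> (R \<omega>)) \<in> borel_measurable M \<and>
      (\<integral>\<^sup>+\<omega>. epowr (modulus_norm T N \<gamma> (R \<omega>)) p \<partial>M)
        \<le> ennreal (C powr p) * (\<integral>\<^sup>+\<omega>. epowr (hnorm3 T X N \<gamma> (H \<omega>)) p \<partial>M) \<and>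
      (AE \<omega> in M. \<forall>x\<in>simp3 T. delta2 S (R \<omega>) x = H \<omega> x))"
proof -
  obtain \<kappa> Cs where adm: "admissible_factor \<gamma> \<kappa>" and Cs: "0 \<le> Cs"
    and dom: "\<And>H. H \<in> D \<Longrightarrow> recursion_ok T X S r H \<and> residual_continuity T N S r H \<and>
      (\<exists>CH. 0 \<le> CH \<and> ennreal CH \<le> ennreal Cs * hnorm3 T X N \<gamma> H \<and>
        admissible T N S r \<gamma> \<kappa> H CH)"
    using sel unfolding selection_domain_def by blast
  have D_ZC: "D \<subseteq> ZC T X N S \<gamma>"
    using sel by (simp add: selection_domain_def)
  have addD: "(\<lambda>x. H x + H' x) \<in> D" and scaleD: "(\<lambda>x. c *\<^sub>R H x) \<in> D"
    if "H \<in> D" "H' \<in> D" for H H' c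
    using sel that unfolding selection_domain_def by auto
  have gen_res_add: "gen_res T S r (\<lambda>x. H x + H' x) n k = gen_res T S r H n k + gen_res T S r H' n k"
    and gen_res_scale: "gen_res T S r (\<lambda>x. c *\<^sub>R H x) n k = c *\<^sub>R gen_res T S r H n k"
    if "H \<in> D" "H' \<in> D" "k < 2 ^ n" for H H' n k c
    using sel that unfolding selection_domain_def by auto
  have diff: "(\<lambda>x. H x - H' x) \<in> D" if "H \<in> D" "H' \<in> D" for H H'
    using addD[OF that(1) scaleD[OF that(2,2), of "-1"]] by simp
  have gen_res_diff: "gen_res T S r (\<lambda>x. H x - H' x) n k = gen_res T S r H n k - gen_res T S r H' n k"
    if "H \<in> D" "H' \<in> D" "k < 2 ^ n" for H H' n k
    using gen_res_add[OF that(1) scaleD[OF that(2,2), of "-1"] that(3)]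
      gen_res_scale[OF that(2,2,3), of "-1"] by simp
  obtain C where C: "C > 0" and sew: "\<And>r H CH. H \<in> ZC T X N S \<gamma> \<Longrightarrow> recursion_ok T X S r H \<Longrightarrow>
    admissible T N S r \<gamma> \<kappa> H CH \<Longrightarrow> 0 \<le> CH \<Longrightarrow> residual_continuity T N S r H \<Longrightarrow>
    is_sewing T X N S r H (sewing T X N S r H) \<and>
    (\<forall>s t. 0 \<le> s \<longrightarrow> s < t \<longrightarrow> t \<le> T \<longrightarrow> N (sewing T X N S r H (t, s)) \<le>
      C * (enn2real (hnorm3 T X N \<gamma> H) + CH) * modulus \<gamma> (t - s)) \<and>
    (\<forall>x\<in>simp3 T. delta2 S (sewing T X N S r H) x = H x)"
    using pathwise_sewing[OF adm \<open>0 < \<gamma>\<close>] by blast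
  define C' where "C' = C * (1 + Cs)"
  have C': "0 < C'" using C Cs by (simp add: C'_def)
  have sew': "is_sewing T X N S r H (sewing T X N S r H)"
    "modulus_norm T N \<gamma> (sewing T X N S r H) \<le> ennreal C' * hnorm3 T X N \<gamma> H"
    "\<forall>x\<in>simp3 T. delta2 S (sewing T X N S r H) x = H x"
    "hnorm3 T X N \<gamma> H < \<top>" "sewing_defect X N S T Mb r H \<gamma>" if H: "H \<in> D" for H
  proof -
    have ZC: "H \<in> ZC T X N S \<gamma>" using H D_ZC by blast
    show fin: "hnorm3 T X N \<gamma> H < \<top>" using ZC by (simp add: ZC_def)
    show "sewing_defect X N S T Mb r H \<gamma>"
      using ZC dom[OF H] \<open>0 < \<gamma>\<close> by unfold_locales auto
    obtain CH where CH: "0 \<le> CH" "ennreal CH \<le> ennreal Cs * hnorm3 T X N \<gamma> H"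
      "admissible T N S r \<gamma> \<kappa> H CH"
      using dom[OF H] by blast
    let ?G = "enn2real (hnorm3 T X N \<gamma> H)"
    have G: "hnorm3 T X N \<gamma> H = ennreal ?G"
      using fin by (simp add: ennreal_enn2real)
    have "ennreal CH \<le> ennreal (Cs * ?G)"
      using CH(2) Cs G by (metis ennreal_mult')
    then have "CH \<le> Cs * ?G"
      using Cs by (subst (asm) ennreal_le_iff) auto
    then have le: "C * (?G + CH) \<le> C' * ?G"
      using C by (simp add: C'_def algebra_simps)
    have *: "is_sewing T X N S r H (sewing T X N S r H) \<and>
      (\<forall>s t. 0 \<le> s \<longrightarrow> s < t \<longrightarrow> t \<le> T \<longrightarrow> N (sewing T X N S r H (t, s)) \<le>
        C * (?G + CH) * modulus \<gamma> (t - s)) \<and>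
      (\<forall>x\<in>simp3 T. delta2 S (sewing T X N S r H) x = H x)"
      using dom[OF H] ZC CH by (intro sew) auto
    then show "is_sewing T X N S r H (sewing T X N S r H)"
      "\<forall>x\<in>simp3 T. delta2 S (sewing T X N S r H) x = H x" by auto
    have "modulus_norm T N \<gamma> (sewing T X N S r H) \<le> ennreal (C * (?G + CH))"
      using * by (intro modulus_norm_le) auto
    also have "\<dots> \<le> ennreal (C' * ?G)"
      using le by (rule ennreal_leI)
    also have "\<dots> = ennreal C' * hnorm3 T X N \<gamma> H"
      using C' G by (metis ennreal_mult' less_imp_le)
    finally show "modulus_norm T N \<gamma> (sewing T X N S r H) \<le> ennreal C' * hnorm3 T X N \<gamma> H" .
  qed
  have Lip: "modulus_norm T N \<gamma> (sewing T X N S r H) \<le>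
      modulus_norm T N \<gamma> (sewing T X N S r H') + ennreal C' * hnorm3 T X N \<gamma> (\<lambda>x. H x - H' x)"
    if "H \<in> D" "H' \<in> D" for H H'
  proof -
    have "modulus_norm T N \<gamma> (sewing T X N S r H) \<le> modulus_norm T N \<gamma> (sewing T X N S r H') +
        modulus_norm T N \<gamma> (sewing T X N S r (\<lambda>x. H x - H' x))"
    proof (rule modulus_norm_triangle)
      fix x assume "x \<in> simp2 T"
      with gen_res_diff[OF that]
      have "sewing T X N S r (\<lambda>x. H x - H' x) x = sewing T X N S r H x - sewing T X N S r H' x"
        by (rule is_sewing_diff[OF sew'(5)[OF that(1)] sew'(5)[OF that(2)] sew'(5)[OF diff[OF that]]
            _ sew'(1)[OF that(1)] sew'(1)[OF that(2)] sew'(1)[OF diff[OF that]]])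
      then show "sewing T X N S r H x =
          sewing T X N S r H' x + sewing T X N S r (\<lambda>x. H x - H' x) x" by simp
    qed (rule is_sewing_mem[OF sew'(1)], rule that diff[OF that])+
    also have "\<dots> \<le> modulus_norm T N \<gamma> (sewing T X N S r H') +
        ennreal C' * hnorm3 T X N \<gamma> (\<lambda>x. H x - H' x)"
      by (intro add_left_mono sew' diff that)
    finally show ?thesis .
  qed
  show ?thesis
  proof (intro exI[of _ C'] conjI C' allI impI)
    fix p :: real and H
    assume "1 \<le> p" and Lp: "Lp_defect M T X N S \<gamma> p D H"
    then have meas: "H \<in> M \<rightarrow>\<^sub>M ZC_borel T X N S \<gamma>" and H: "\<And>\<omega>. \<omega> \<in> space M \<Longrightarrow> H \<omega> \<in> D"
      by (auto simp: Lp_defect_def)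
    let ?R = "\<lambda>\<omega>. sewing T X N S r (H \<omega>)"
    have fin: "modulus_norm T N \<gamma> (?R \<omega>) < \<top>" if \<omega>: "\<omega> \<in> space M" for \<omega>
      using sew'(2)[OF H[OF \<omega>]] sew'(4)[OF H[OF \<omega>]]
      by (elim order_le_less_trans) (simp add: ennreal_mult_less_top)
    have mR: "(\<lambda>\<omega>. modulus_norm T N \<gamma> (?R \<omega>)) \<in> borel_measurable M"
      by (rule measurable_Lipschitz[OF T_pos meas D_ZC H Lip])
    have "(\<lambda>\<omega>. hnorm3 T X N \<gamma> (H \<omega>)) \<in> borel_measurable M"
      using H D_ZC by (intro measurable_hnorm3[OF T_pos meas]) auto
    then have "(\<integral>\<^sup>+\<omega>. epowr (modulus_norm T N \<gamma> (?R \<omega>)) p \<partial>M)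
        \<le> ennreal (C' powr p) * (\<integral>\<^sup>+\<omega>. epowr (hnorm3 T X N \<gamma> (H \<omega>)) p \<partial>M)"
      using C' \<open>1 \<le> p\<close> sew'(2) H by (intro moment_bound) auto
    then show "let R = ?R in
      (\<forall>\<omega>\<in>space M. is_sewing T X N S r (H \<omega>) (R \<omega>) \<and> modulus_norm T N \<gamma> (R \<omega>) < \<top>) \<and>
      (\<lambda>\<omega>. modulus_norm T N \<gamma> (R \<omega>)) \<in> borel_measurable M \<and>
      (\<integral>\<^sup>+\<omega>. epowr (modulus_norm T N \<gamma> (R \<omega>)) p \<partial>M)
        \<le> ennreal (C' powr p) * (\<integral>\<^sup>+\<omega>. epowr (hnorm3 T X N \<gamma> (H \<omega>)) p \<partial>M) \<and>
      (AE \<omega> in M. \<forall>x\<in>simp3 T. delta2 S (R \<omega>) x = H \<omega> x)"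
      unfolding Let_def using sew'(1,3) H fin mR by auto
  qed
qed

end
theorem theorem7p10:
  fixes B :: "real \<Rightarrow> 'a::real_vector set" and nrm :: "real \<Rightarrow> 'a \<Rightarrow> real"
    and S :: "real \<Rightarrow> 'a \<Rightarrow> 'a" and T \<gamma> \<alpha> :: real
    and r :: "'a rule" and M :: "'w measure"
  assumes "0 < T"
    and "prob_space M"
    and "scale_semigroup B nrm S T"
    and "0 < \<gamma>" and "\<gamma> \<le> 1"
  shows
    "(\<gamma> < 1 \<longrightarrow>
       (\<forall>D. selection_domain T (B \<alpha>) (nrm \<alpha>) S r \<gamma> D \<longrightarrow>
         (\<exists>C>0. \<forall>p\<ge>1. \<forall>H. Lp_defect M T (B \<alpha>) (nrm \<alpha>) S \<gamma> p D H \<longrightarrow>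
           (let R = (\<lambda>\<omega>. sewing T (B \<alpha>) (nrm \<alpha>) S r (H \<omega>)) in
             (\<forall>\<omega>\<in>space M. is_sewing T (B \<alpha>) (nrm \<alpha>) S r (H \<omega>) (R \<omega>) \<and>
                R \<omega> \<in> C_holder T (B \<alpha>) (nrm \<alpha>) \<gamma>) \<and>
             (\<lambda>\<omega>. hnorm2 T (nrm \<alpha>) \<gamma> (R \<omega>)) \<in> borel_measurable M \<and>
             (\<integral>\<^sup>+\<omega>. epowr (hnorm2 T (nrm \<alpha>) \<gamma> (R \<omega>)) p \<partial>M)
               \<le> ennreal (C powr p) * (\<integral>\<^sup>+\<omega>. epowr (hnorm3 T (B \<alpha>) (nrm \<alpha>) \<gamma> (H \<omega>)) p \<partial>M) \<and>
             (AE \<omega> in M. \<forall>x\<in>simp3 T. delta2 S (R \<omega>) x = H \<omega> x)))) \<and>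
       (\<forall>\<kappa>. admissible_factor \<gamma> \<kappa> \<longrightarrow>
         (\<exists>C>0. \<forall>p\<ge>1. \<forall>H CH. individual_defect M T (B \<alpha>) (nrm \<alpha>) S r \<gamma> \<kappa> H CH \<longrightarrow>
           (let R = (\<lambda>\<omega>. sewing T (B \<alpha>) (nrm \<alpha>) S r (H \<omega>)) in
             (\<forall>\<omega>\<in>space M. is_sewing T (B \<alpha>) (nrm \<alpha>) S r (H \<omega>) (R \<omega>) \<and>
                R \<omega> \<in> C_holder T (B \<alpha>) (nrm \<alpha>) \<gamma>) \<and>
             (\<integral>\<^sup>+\<omega>. epowr (hnorm2 T (nrm \<alpha>) \<gamma> (R \<omega>)) p \<partial>M)
               \<le> ennreal (C powr p) *
                 (\<integral>\<^sup>+\<omega>. epowr (hnorm3 T (B \<alpha>) (nrm \<alpha>) \<gamma> (H \<omega>) + ennreal (CH \<omega>)) p \<partial>M) \<and>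
             (AE \<omega> in M. \<forall>x\<in>simp3 T. delta2 S (R \<omega>) x = H \<omega> x))))) \<and>
     (\<gamma> = 1 \<longrightarrow>
       (\<forall>D. selection_domain T (B \<alpha>) (nrm \<alpha>) S r 1 D \<longrightarrow>
         (\<exists>C>0. \<forall>p\<ge>1. \<forall>H. Lp_defect M T (B \<alpha>) (nrm \<alpha>) S 1 p D H \<longrightarrow>
           (let R = (\<lambda>\<omega>. sewing T (B \<alpha>) (nrm \<alpha>) S r (H \<omega>)) in
             (\<forall>\<omega>\<in>space M. is_sewing T (B \<alpha>) (nrm \<alpha>) S r (H \<omega>) (R \<omega>) \<and>
                R \<omega> \<in> C_log T (B \<alpha>) (nrm \<alpha>)) \<and>
             (\<lambda>\<omega>. lognorm2 T (nrm \<alpha>) (R \<omega>)) \<in> borel_measurable M \<and>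
             (\<integral>\<^sup>+\<omega>. epowr (lognorm2 T (nrm \<alpha>) (R \<omega>)) p \<partial>M)
               \<le> ennreal (C powr p) * (\<integral>\<^sup>+\<omega>. epowr (hnorm3 T (B \<alpha>) (nrm \<alpha>) 1 (H \<omega>)) p \<partial>M) \<and>
             (AE \<omega> in M. \<forall>x\<in>simp3 T. delta2 S (R \<omega>) x = H \<omega> x)))) \<and>
       (\<forall>\<kappa>. admissible_factor 1 \<kappa> \<longrightarrow>
         (\<exists>C>0. \<forall>p\<ge>1. \<forall>H CH. individual_defect M T (B \<alpha>) (nrm \<alpha>) S r 1 \<kappa> H CH \<longrightarrow>
           (let R = (\<lambda>\<omega>. sewing T (B \<alpha>) (nrm \<alpha>) S r (H \<omega>)) in
             (\<forall>\<omega>\<in>space M. is_sewing T (B \<alpha>) (nrm \<alpha>) S r (H \<omega>) (R \<omega>) \<and>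
                R \<omega> \<in> C_log T (B \<alpha>) (nrm \<alpha>)) \<and>
             (\<integral>\<^sup>+\<omega>. epowr (lognorm2 T (nrm \<alpha>) (R \<omega>)) p \<partial>M)
               \<le> ennreal (C powr p) *
                 (\<integral>\<^sup>+\<omega>. epowr (hnorm3 T (B \<alpha>) (nrm \<alpha>) 1 (H \<omega>) + ennreal (CH \<omega>)) p \<partial>M) \<and>
             (AE \<omega> in M. \<forall>x\<in>simp3 T. delta2 S (R \<omega>) x = H \<omega> x)))))"

proof -
  obtain Mb where "evolution (B \<alpha>) (nrm \<alpha>) S T Mb"
    using evolution_of_scale_semigroup[OF assms(3,1)] by blast
  then interpret evolution "B \<alpha>" "nrm \<alpha>" S T Mb .
  have holder: "g \<in> C_holder T (B \<alpha>) (nrm \<alpha>) \<gamma>"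
    if "is_sewing T (B \<alpha>) (nrm \<alpha>) S r H g" "hnorm2 T (nrm \<alpha>) \<gamma> g < \<top>" for H g
    using that by (simp add: C_holder_def is_sewing_def)
  have log: "g \<in> C_log T (B \<alpha>) (nrm \<alpha>)"
    if "is_sewing T (B \<alpha>) (nrm \<alpha>) S r H g" "lognorm2 T (nrm \<alpha>) g < \<top>" for H g
    using that by (simp add: C_log_def is_sewing_def)
  show ?thesis
  proof (intro conjI impI allI)
    fix D assume "\<gamma> < 1" and D: "selection_domain T (B \<alpha>) (nrm \<alpha>) S r \<gamma> D"
    then have eq: "modulus_norm T (nrm \<alpha>) \<gamma> g = hnorm2 T (nrm \<alpha>) \<gamma> g" for g
      by (simp add: hnorm2_eq)
    show "\<exists>C>0. \<forall>p\<ge>1. \<forall>H. Lp_defect M T (B \<alpha>) (nrm \<alpha>) S \<gamma> p D H \<longrightarrow>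
           (let R = (\<lambda>\<omega>. sewing T (B \<alpha>) (nrm \<alpha>) S r (H \<omega>)) in
             (\<forall>\<omega>\<in>space M. is_sewing T (B \<alpha>) (nrm \<alpha>) S r (H \<omega>) (R \<omega>) \<and>
                R \<omega> \<in> C_holder T (B \<alpha>) (nrm \<alpha>) \<gamma>) \<and>
             (\<lambda>\<omega>. hnorm2 T (nrm \<alpha>) \<gamma> (R \<omega>)) \<in> borel_measurable M \<and>
             (\<integral>\<^sup>+\<omega>. epowr (hnorm2 T (nrm \<alpha>) \<gamma> (R \<omega>)) p \<partial>M)
               \<le> ennreal (C powr p) * (\<integral>\<^sup>+\<omega>. epowr (hnorm3 T (B \<alpha>) (nrm \<alpha>) \<gamma> (H \<omega>)) p \<partial>M) \<and>
             (AE \<omega> in M. \<forall>x\<in>simp3 T. delta2 S (R \<omega>) x = H \<omega> x))"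
      using selection_moments[OF D assms(4), of M] holder unfolding Let_def eq by meson
  next
    fix \<kappa> assume "\<gamma> < 1" and \<kappa>: "admissible_factor \<gamma> \<kappa>"
    then have eq: "modulus_norm T (nrm \<alpha>) \<gamma> g = hnorm2 T (nrm \<alpha>) \<gamma> g" for g
      by (simp add: hnorm2_eq)
    show "\<exists>C>0. \<forall>p\<ge>1. \<forall>H CH. individual_defect M T (B \<alpha>) (nrm \<alpha>) S r \<gamma> \<kappa> H CH \<longrightarrow>
           (let R = (\<lambda>\<omega>. sewing T (B \<alpha>) (nrm \<alpha>) S r (H \<omega>)) in
             (\<forall>\<omega>\<in>space M. is_sewing T (B \<alpha>) (nrm \<alpha>) S r (H \<omega>) (R \<omega>) \<and>
                R \<omega> \<in> C_holder T (B \<alpha>) (nrm \<alpha>) \<gamma>) \<and>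
             (\<integral>\<^sup>+\<omega>. epowr (hnorm2 T (nrm \<alpha>) \<gamma> (R \<omega>)) p \<partial>M)
               \<le> ennreal (C powr p) *
                 (\<integral>\<^sup>+\<omega>. epowr (hnorm3 T (B \<alpha>) (nrm \<alpha>) \<gamma> (H \<omega>) + ennreal (CH \<omega>)) p \<partial>M) \<and>
             (AE \<omega> in M. \<forall>x\<in>simp3 T. delta2 S (R \<omega>) x = H \<omega> x))"
      using individual_moments[OF \<kappa> assms(4), of M r] holder unfolding Let_def eq by meson
  next
    fix D assume D: "selection_domain T (B \<alpha>) (nrm \<alpha>) S r 1 D"
    show "\<exists>C>0. \<forall>p\<ge>1. \<forall>H. Lp_defect M T (B \<alpha>) (nrm \<alpha>) S 1 p D H \<longrightarrow>
           (let R = (\<lambda>\<omega>. sewing T (B \<alpha>) (nrm \<alpha>) S r (H \<omega>)) in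
             (\<forall>\<omega>\<in>space M. is_sewing T (B \<alpha>) (nrm \<alpha>) S r (H \<omega>) (R \<omega>) \<and>
                R \<omega> \<in> C_log T (B \<alpha>) (nrm \<alpha>)) \<and>
             (\<lambda>\<omega>. lognorm2 T (nrm \<alpha>) (R \<omega>)) \<in> borel_measurable M \<and>
             (\<integral>\<^sup>+\<omega>. epowr (lognorm2 T (nrm \<alpha>) (R \<omega>)) p \<partial>M)
               \<le> ennreal (C powr p) * (\<integral>\<^sup>+\<omega>. epowr (hnorm3 T (B \<alpha>) (nrm \<alpha>) 1 (H \<omega>)) p \<partial>M) \<and>
             (AE \<omega> in M. \<forall>x\<in>simp3 T. delta2 S (R \<omega>) x = H \<omega> x))"
      using selection_moments[OF D zero_less_one, of M] log
      unfolding Let_def lognorm2_eq[symmetric] by meson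
  next
    fix \<kappa> assume \<kappa>: "admissible_factor 1 \<kappa>"
    show "\<exists>C>0. \<forall>p\<ge>1. \<forall>H CH. individual_defect M T (B \<alpha>) (nrm \<alpha>) S r 1 \<kappa> H CH \<longrightarrow>
           (let R = (\<lambda>\<omega>. sewing T (B \<alpha>) (nrm \<alpha>) S r (H \<omega>)) in
             (\<forall>\<omega>\<in>space M. is_sewing T (B \<alpha>) (nrm \<alpha>) S r (H \<omega>) (R \<omega>) \<and>
                R \<omega> \<in> C_log T (B \<alpha>) (nrm \<alpha>)) \<and>
             (\<integral>\<^sup>+\<omega>. epowr (lognorm2 T (nrm \<alpha>) (R \<omega>)) p \<partial>M)
               \<le> ennreal (C powr p) *
                 (\<integral>\<^sup>+\<omega>. epowr (hnorm3 T (B \<alpha>) (nrm \<alpha>) 1 (H \<omega>) + ennreal (CH \<omega>)) p \<partial>M) \<and>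
             (AE \<omega> in M. \<forall>x\<in>simp3 T. delta2 S (R \<omega>) x = H \<omega> x))"
      using individual_moments[OF \<kappa> zero_less_one, of M r] log
      unfolding Let_def lognorm2_eq[symmetric] by meson
  qed
qed

end
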